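(* Let $I$ be an at most countable set, let $A$ be an $I\times I$-matrix with entries in $\{0,1\}$ and with no zero rows, and let $E_A$ be the associated graph. Then $\mathcal O_A$ is an AF-algebra if and only if $E_A$ has no cycles.
   Context: The graph $E_A$ is the directed graph with vertex set $I$ and edge set $\{(i,j)\in I\times I: A(i,j)=1\}$. A cycle in $E_A$ is a finite sequence of vertices $(i_1,\dots,i_n)$, $n\ge1$, with $A(i_k,i_{k+1})=1$ for $1\le k<n$ and $A(i_n,i_1)=1$. $\mathcal O_A$ is the generalized Cuntz–Krieger algebra of Exel and Laca: in the universal unital $C^*$-algebra generated by partial isometries $\{S_i: i\in I\}$ subject to the relations below, it is the $C^*$-subalgebra generated by $\{S_i: i\in I\}$. Relations: (i) $S_i^*S_i$ commutes with $S_j^*S_j$ for all $i,j$; (ii) $S_i^*S_j=0$ if $i\ne j$; (iii) $(S_i^*S_i)S_j=A(i,j)S_j$ for all $i,j$; (iv) for each pair of finite subsets $X,Y\subseteq I$ such that $A(X,Y,j):=\prod_{x\in X}A(x,j)\prod_{y\in Y}(1-A(y,j))$ vanishes for all but finitely many $j\in I$, one has $\prod_{x\in X}S_x^*S_x\prod_{y\in Y}(1-S_y^*S_y)=\sum_{j\in I}A(X,Y,j)S_jS_j^*$. *)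

theory Defs
  imports "HOL-Algebra.Ring" "HOL-Algebra.Module" "HOL-Analysis.Abstract_Metric_Spaces"
    "HOL-Library.Countable_Set"
begin

section \<open>C*-algebras\<close>

text \<open>
  The \<open>one\<close> field inherited from the ring record is meaningless unless the algebra is unital.
\<close>

record 'a cstar = "(complex, 'a) module" +
  star :: "'a \<Rightarrow> 'a" (\<open>(_\<^sup>\<star>\<index>)\<close> [1000] 1000)
  cnorm :: "'a \<Rightarrow> real"

text \<open>Set to \<open>0\<close> off the carrier because \<open>Metric_space\<close> wants a globally symmetric distance.\<close>

definition cdist :: "('a, 'm) cstar_scheme \<Rightarrow> 'a \<Rightarrow> 'a \<Rightarrow> real" where
  "cdist B x y = (if x \<in> carrier B \<and> y \<in> carrier B then cnorm B (x \<ominus>\<^bsub>B\<^esub> y) else 0)"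

locale pre_cstar_algebra = abelian_group B for B :: "('a, 'm) cstar_scheme" (structure) +
  assumes m_closed: "\<lbrakk>x \<in> carrier B; y \<in> carrier B\<rbrakk> \<Longrightarrow> x \<otimes> y \<in> carrier B"
    and m_assoc: "\<lbrakk>x \<in> carrier B; y \<in> carrier B; z \<in> carrier B\<rbrakk>
      \<Longrightarrow> (x \<otimes> y) \<otimes> z = x \<otimes> (y \<otimes> z)"
    and l_distr: "\<lbrakk>x \<in> carrier B; y \<in> carrier B; z \<in> carrier B\<rbrakk>
      \<Longrightarrow> (x \<oplus> y) \<otimes> z = x \<otimes> z \<oplus> y \<otimes> z"
    and r_distr: "\<lbrakk>x \<in> carrier B; y \<in> carrier B; z \<in> carrier B\<rbrakk>
      \<Longrightarrow> z \<otimes> (x \<oplus> y) = z \<otimes> x \<oplus> z \<otimes> y"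
    and smult_closed: "x \<in> carrier B \<Longrightarrow> c \<odot> x \<in> carrier B"
    and smult_l_distr: "x \<in> carrier B \<Longrightarrow> (c + d) \<odot> x = c \<odot> x \<oplus> d \<odot> x"
    and smult_r_distr: "\<lbrakk>x \<in> carrier B; y \<in> carrier B\<rbrakk>
      \<Longrightarrow> c \<odot> (x \<oplus> y) = c \<odot> x \<oplus> c \<odot> y"
    and smult_assoc1: "x \<in> carrier B \<Longrightarrow> (c * d) \<odot> x = c \<odot> (d \<odot> x)"
    and smult_one: "x \<in> carrier B \<Longrightarrow> 1 \<odot> x = x"
    and smult_mult_left: "\<lbrakk>x \<in> carrier B; y \<in> carrier B\<rbrakk> \<Longrightarrow> (c \<odot> x) \<otimes> y = c \<odot> (x \<otimes> y)"
    and smult_mult_right: "\<lbrakk>x \<in> carrier B; y \<in> carrier B\<rbrakk> \<Longrightarrow> x \<otimes> (c \<odot> y) = c \<odot> (x \<otimes> y)"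
    and star_closed: "x \<in> carrier B \<Longrightarrow> x\<^sup>\<star> \<in> carrier B"
    and star_star: "x \<in> carrier B \<Longrightarrow> x\<^sup>\<star>\<^sup>\<star> = x"
    and star_add: "\<lbrakk>x \<in> carrier B; y \<in> carrier B\<rbrakk> \<Longrightarrow> (x \<oplus> y)\<^sup>\<star> = x\<^sup>\<star> \<oplus> y\<^sup>\<star>"
    and star_mult: "\<lbrakk>x \<in> carrier B; y \<in> carrier B\<rbrakk> \<Longrightarrow> (x \<otimes> y)\<^sup>\<star> = y\<^sup>\<star> \<otimes> x\<^sup>\<star>"
    and star_smult: "x \<in> carrier B \<Longrightarrow> (c \<odot> x)\<^sup>\<star> = cnj c \<odot> x\<^sup>\<star>"
    and cnorm_nonneg: "x \<in> carrier B \<Longrightarrow> 0 \<le> cnorm B x"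
    and cnorm_eq_0_iff: "x \<in> carrier B \<Longrightarrow> cnorm B x = 0 \<longleftrightarrow> x = \<zero>"
    and cnorm_triangle: "\<lbrakk>x \<in> carrier B; y \<in> carrier B\<rbrakk>
      \<Longrightarrow> cnorm B (x \<oplus> y) \<le> cnorm B x + cnorm B y"
    and cnorm_smult: "x \<in> carrier B \<Longrightarrow> cnorm B (c \<odot> x) = cmod c * cnorm B x"
    and cnorm_mult: "\<lbrakk>x \<in> carrier B; y \<in> carrier B\<rbrakk>
      \<Longrightarrow> cnorm B (x \<otimes> y) \<le> cnorm B x * cnorm B y"
    and cnorm_star_mult: "x \<in> carrier B \<Longrightarrow> cnorm B (x\<^sup>\<star> \<otimes> x) = (cnorm B x)\<^sup>2"

locale cstar_algebra = pre_cstar_algebra +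
  assumes complete: "Metric_space.mcomplete (carrier B) (cdist B)"

text \<open>
  The zero algebra counts as unital (with \<open>\<one> = \<zero>\<close>): for an empty index set, relation (iv)
  below with \<open>X = Y = {}\<close> forces the universal algebra to be zero.
\<close>

locale unital_cstar_algebra = cstar_algebra B + ring B
  for B :: "('a, 'm) cstar_scheme" (structure)

definition cstar_topology :: "('a, 'm) cstar_scheme \<Rightarrow> 'a topology" where
  "cstar_topology B = Metric_space.mtopology (carrier B) (cdist B)"

definition cstar_subalgebra :: "('a, 'm) cstar_scheme \<Rightarrow> 'a set \<Rightarrow> bool" where
  "cstar_subalgebra B D \<longleftrightarrow>
     D \<subseteq> carrier B \<and> \<zero>\<^bsub>B\<^esub> \<in> D \<and>
     (\<forall>x\<in>D. \<forall>y\<in>D. x \<oplus>\<^bsub>B\<^esub> y \<in> D \<and> x \<otimes>\<^bsub>B\<^esub> y \<in> D) \<and>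
     (\<forall>x\<in>D. x\<^sup>\<star>\<^bsub>B\<^esub> \<in> D \<and> (\<forall>c. c \<odot>\<^bsub>B\<^esub> x \<in> D)) \<and>
     closedin (cstar_topology B) D"

definition cstar_generated :: "('a, 'm) cstar_scheme \<Rightarrow> 'a set \<Rightarrow> 'a set" where
  "cstar_generated B X = cstar_subalgebra B hull X"

definition unital_cstar_hom ::
  "('a, 'm) cstar_scheme \<Rightarrow> ('b, 'n) cstar_scheme \<Rightarrow> ('a \<Rightarrow> 'b) set" where
  "unital_cstar_hom B C = {\<phi> \<in> ring_hom B C.
     \<forall>x\<in>carrier B. \<phi> (x\<^sup>\<star>\<^bsub>B\<^esub>) = (\<phi> x)\<^sup>\<star>\<^bsub>C\<^esub> \<and> (\<forall>c. \<phi> (c \<odot>\<^bsub>B\<^esub> x) = c \<odot>\<^bsub>C\<^esub> \<phi> x)}"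

definition finite_dimensional :: "('a, 'm) cstar_scheme \<Rightarrow> 'a set \<Rightarrow> bool" where
  "finite_dimensional B D \<longleftrightarrow>
     (\<exists>G. finite G \<and> G \<subseteq> carrier B \<and> (\<forall>x\<in>D. \<exists>c. x = (\<Oplus>\<^bsub>B\<^esub>g\<in>G. c g \<odot>\<^bsub>B\<^esub> g)))"

definition AF_algebra :: "('a, 'm) cstar_scheme \<Rightarrow> bool" where
  "AF_algebra B \<longleftrightarrow> cstar_algebra B \<and>
     (\<exists>F :: nat \<Rightarrow> 'a set.
        (\<forall>n. cstar_subalgebra B (F n) \<and> finite_dimensional B (F n) \<and> F n \<subseteq> F (Suc n)) \<and>
        cstar_topology B closure_of (\<Union>n. F n) = carrier B)"


section \<open>Exel--Laca algebras\<close>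

definition partial_isometry :: "('a, 'm) cstar_scheme \<Rightarrow> 'a \<Rightarrow> bool" where
  "partial_isometry B v \<longleftrightarrow> v \<in> carrier B \<and> v \<otimes>\<^bsub>B\<^esub> v\<^sup>\<star>\<^bsub>B\<^esub> \<otimes>\<^bsub>B\<^esub> v = v"

definition matrix_prod :: "('i \<Rightarrow> 'i \<Rightarrow> int) \<Rightarrow> 'i set \<Rightarrow> 'i set \<Rightarrow> 'i \<Rightarrow> int" where
  "matrix_prod A X Y j = (\<Prod>x\<in>X. A x j) * (\<Prod>y\<in>Y. 1 - A y j)"

text \<open>
  \<open>finprod\<close> only makes sense for commuting factors; here they commute by relation (i), the
  second clause.  \<open>finsum\<close> requires a finite index set, so the sum over \<open>j \<in> I\<close> is
  restricted to the support of \<open>A(X,Y,\<cdot>)\<close>, which is finite by hypothesis.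
\<close>

definition exel_laca_family ::
  "'i set \<Rightarrow> ('i \<Rightarrow> 'i \<Rightarrow> int) \<Rightarrow> ('a, 'm) cstar_scheme \<Rightarrow> ('i \<Rightarrow> 'a) \<Rightarrow> bool" where
  "exel_laca_family I A B S \<longleftrightarrow>
     (let Q = (\<lambda>i. (S i)\<^sup>\<star>\<^bsub>B\<^esub> \<otimes>\<^bsub>B\<^esub> S i) in
       (\<forall>i\<in>I. partial_isometry B (S i)) \<and>
       (\<forall>i\<in>I. \<forall>j\<in>I. Q i \<otimes>\<^bsub>B\<^esub> Q j = Q j \<otimes>\<^bsub>B\<^esub> Q i) \<and>
       (\<forall>i\<in>I. \<forall>j\<in>I. i \<noteq> j \<longrightarrow> (S i)\<^sup>\<star>\<^bsub>B\<^esub> \<otimes>\<^bsub>B\<^esub> S j = \<zero>\<^bsub>B\<^esub>) \<and>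
       (\<forall>i\<in>I. \<forall>j\<in>I. Q i \<otimes>\<^bsub>B\<^esub> S j = of_int (A i j) \<odot>\<^bsub>B\<^esub> S j) \<and>
       (\<forall>X Y. finite X \<and> X \<subseteq> I \<and> finite Y \<and> Y \<subseteq> I \<and> finite {j \<in> I. matrix_prod A X Y j \<noteq> 0} \<longrightarrow>
          (\<Otimes>\<^bsub>B\<^esub>x\<in>X. Q x) \<otimes>\<^bsub>B\<^esub> (\<Otimes>\<^bsub>B\<^esub>y\<in>Y. \<one>\<^bsub>B\<^esub> \<ominus>\<^bsub>B\<^esub> Q y) =
          (\<Oplus>\<^bsub>B\<^esub>j\<in>{j \<in> I. matrix_prod A X Y j \<noteq> 0}.
             of_int (matrix_prod A X Y j) \<odot>\<^bsub>B\<^esub> (S j \<otimes>\<^bsub>B\<^esub> (S j)\<^sup>\<star>\<^bsub>B\<^esub>))))"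

text \<open>
  HOL cannot quantify over all types inside a formula, so the universal property is tested on
  the unital C*-algebras whose carrier is a set of elements of one fixed type.  This is no
  restriction when the index set is countable: a C*-algebra generated by countably many
  elements has an isomorphic copy with carrier in \<open>test_elem\<close>.  See
  \<open>universal_exel_laca_hom\<close> below for the resulting universal property on arbitrary types, and
  \<open>universal_exel_laca_exists\<close> for the existence of a universal algebra.
  (The type is chosen so that the operators on l2(N) live in it directly.)
\<close>

type_synonym test_elem = "(nat \<Rightarrow> complex) \<Rightarrow> (nat \<Rightarrow> complex)"

definition universal_exel_laca ::
  "'i set \<Rightarrow> ('i \<Rightarrow> 'i \<Rightarrow> int) \<Rightarrow> ('a, 'm) cstar_scheme \<Rightarrow> ('i \<Rightarrow> 'a) \<Rightarrow> bool" where
  "universal_exel_laca I A U S \<longleftrightarrow>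
     unital_cstar_algebra U \<and> exel_laca_family I A U S \<and>
     cstar_generated U (insert \<one>\<^bsub>U\<^esub> (S ` I)) = carrier U \<and>
     (\<forall>(B :: test_elem cstar) T. unital_cstar_algebra B \<and> exel_laca_family I A B T \<longrightarrow>
        (\<exists>\<phi>\<in>unital_cstar_hom U B. \<forall>i\<in>I. \<phi> (S i) = T i))"

text \<open>The algebra \<open>O_A\<close> inside a universal algebra \<open>U\<close> with generators \<open>S\<close>.\<close>

definition exel_laca_algebra ::
  "('a, 'm) cstar_scheme \<Rightarrow> ('i \<Rightarrow> 'a) \<Rightarrow> 'i set \<Rightarrow> ('a, 'm) cstar_scheme" where
  "exel_laca_algebra U S I = U\<lparr>carrier := cstar_generated U (S ` I)\<rparr>"

definition graph_edges :: "'i set \<Rightarrow> ('i \<Rightarrow> 'i \<Rightarrow> int) \<Rightarrow> ('i \<times> 'i) set" where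
  "graph_edges I A = {(i, j) \<in> I \<times> I. A i j = 1}"

definition graph_cycle :: "('i \<times> 'i) set \<Rightarrow> 'i list \<Rightarrow> bool" where
  "graph_cycle E p \<longleftrightarrow> p \<noteq> [] \<and>
     (\<forall>k. Suc k < length p \<longrightarrow> (p ! k, p ! Suc k) \<in> E) \<and> (last p, hd p) \<in> E"

section \<open>Metric and topology\<close>

context pre_cstar_algebra
begin

lemma smult_0_left: "x \<in> carrier B \<Longrightarrow> 0 \<odot> x = \<zero>"
  using smult_l_distr[of x 0 0] smult_closed[of x 0]
  by (metis add.l_cancel_one' add_0 zero_closed)

lemma a_inv_eq: "x \<in> carrier B \<Longrightarrow> \<ominus> x = (-1) \<odot> x"
  using smult_l_distr[of x 1 "-1"] smult_closed[of x "-1"] smult_0_left[of x] smult_one[of x]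
  by (metis add.inv_comm add.inv_equality add.right_inverse add_eq_0_iff)

lemma cdist_eq: "x \<in> carrier B \<Longrightarrow> y \<in> carrier B \<Longrightarrow> cdist B x y = cnorm B (x \<oplus> (-1) \<odot> y)"
  by (simp add: cdist_def a_minus_def a_inv_eq)

lemma cnorm_minus: "x \<in> carrier B \<Longrightarrow> cnorm B (\<ominus> x) = cnorm B x"
  by (simp add: a_inv_eq cnorm_smult)

lemma cnorm_zero: "cnorm B \<zero> = 0"
  using cnorm_eq_0_iff[of \<zero>] by simp

lemma smult_0_right: "c \<odot> \<zero> = \<zero>"
  using smult_0_left[of \<zero>] smult_assoc1[of \<zero> c 0] by simp

lemma star_zero: "\<zero>\<^sup>\<star> = \<zero>"
  using star_smult[of \<zero> 0] smult_0_left[of "\<zero>\<^sup>\<star>"] star_closed[of \<zero>] smult_0_right by simp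

lemma mult_zero_left: "x \<in> carrier B \<Longrightarrow> \<zero> \<otimes> x = \<zero>"
  using smult_mult_left[of \<zero> x 0] smult_0_left[of "\<zero> \<otimes> x"] smult_0_right m_closed by simp

lemma mult_zero_right: "x \<in> carrier B \<Longrightarrow> x \<otimes> \<zero> = \<zero>"
  using smult_mult_right[of x \<zero> 0] smult_0_left[of "x \<otimes> \<zero>"] smult_0_right m_closed by simp


lemma cdist_commute: "cdist B x y = cdist B y x"
proof (cases "x \<in> carrier B \<and> y \<in> carrier B")
  case True
  then have "\<ominus> (x \<ominus> y) = y \<ominus> x" by (simp add: a_minus_def minus_add a_comm)
  then show ?thesis using True cnorm_minus[of "x \<ominus> y"] by (simp add: cdist_def)
qed (auto simp: cdist_def)

lemma cstar_metric: "Metric_space (carrier B) (cdist B)"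
proof
  show "0 \<le> cdist B x y" for x y by (simp add: cdist_def cnorm_nonneg)
  show "cdist B x y = cdist B y x" for x y by (rule cdist_commute)
  show "cdist B x y = 0 \<longleftrightarrow> x = y" if "x \<in> carrier B" "y \<in> carrier B" for x y
    using that cnorm_eq_0_iff[of "x \<ominus> y"] minus_equality[of x "\<ominus> y"]
    by (auto simp: cdist_def a_minus_def r_neg)
  show "cdist B x z \<le> cdist B x y + cdist B y z"
    if "x \<in> carrier B" "y \<in> carrier B" "z \<in> carrier B" for x y z
  proof -
    have "x \<ominus> z = (x \<ominus> y) \<oplus> (y \<ominus> z)" using that
      by (simp add: a_minus_def a_assoc) (metis a_inv_closed a_assoc l_neg l_zero)
    then show ?thesis using that cnorm_triangle[of "x \<ominus> y" "y \<ominus> z"] by (simp add: cdist_def)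
  qed
qed

lemma cstar_limitin:
  "limitin (cstar_topology B) \<sigma> x sequentially \<longleftrightarrow>
     x \<in> carrier B \<and> (\<forall>e>0. \<exists>N. \<forall>n\<ge>N. \<sigma> n \<in> carrier B \<and> cdist B (\<sigma> n) x < e)"
  unfolding cstar_topology_def Metric_space.limitin_metric[OF cstar_metric] eventually_sequentially ..

lemma closedin_cstar_iff:
  "closedin (cstar_topology B) D \<longleftrightarrow> D \<subseteq> carrier B \<and>
    (\<forall>(\<sigma> :: nat \<Rightarrow> 'a) x. range \<sigma> \<subseteq> D \<and> x \<in> carrier B \<and> (\<forall>e>0. \<exists>N. \<forall>n\<ge>N. cdist B (\<sigma> n) x < e) \<longrightarrow> x \<in> D)"
proof -
  have "closedin (cstar_topology B) D \<longleftrightarrow> D \<subseteq> carrier B \<and>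
      (\<forall>\<sigma> l. range \<sigma> \<subseteq> D \<and> limitin (cstar_topology B) \<sigma> l sequentially \<longrightarrow> l \<in> D)"
    unfolding cstar_topology_def Metric_space.metric_closedin_iff_sequentially_closed[OF cstar_metric] ..
  moreover have "range \<sigma> \<subseteq> D \<and> limitin (cstar_topology B) \<sigma> l sequentially \<longleftrightarrow>
      range \<sigma> \<subseteq> D \<and> l \<in> carrier B \<and> (\<forall>e>0. \<exists>N. \<forall>n\<ge>N. cdist B (\<sigma> n) l < e)"
    if "D \<subseteq> carrier B" for \<sigma> l
    unfolding cstar_limitin using that by (auto simp: image_subset_iff subset_iff)
  ultimately show ?thesis by metis
qed

lemma cstar_algebraI:
  assumes "\<And>\<sigma> :: nat \<Rightarrow> 'a. \<lbrakk>range \<sigma> \<subseteq> carrier B; \<forall>e>0. \<exists>N. \<forall>n\<ge>N. \<forall>m\<ge>N. cdist B (\<sigma> n) (\<sigma> m) < e\<rbrakk>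
    \<Longrightarrow> \<exists>x\<in>carrier B. \<forall>e>0. \<exists>N. \<forall>n\<ge>N. cdist B (\<sigma> n) x < e"
  shows "cstar_algebra B"
proof (unfold_locales, unfold Metric_space.mcomplete_def[OF cstar_metric], intro allI impI)
  fix \<sigma> assume "Metric_space.MCauchy (carrier B) (cdist B) \<sigma>"
  note this[unfolded Metric_space.MCauchy_def[OF cstar_metric]]
  then have *: "range \<sigma> \<subseteq> carrier B" and "\<forall>e>0. \<exists>N. \<forall>n n'. N \<le> n \<longrightarrow> N \<le> n' \<longrightarrow> cdist B (\<sigma> n) (\<sigma> n') < e"
    by (rule conjunct1, rule conjunct2)
  then have **: "\<forall>e>0. \<exists>N. \<forall>n\<ge>N. \<forall>m\<ge>N. cdist B (\<sigma> n) (\<sigma> m) < e"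
    by simp
  show "\<exists>x. limitin (Metric_space.mtopology (carrier B) (cdist B)) \<sigma> x sequentially"
    using assms[OF * **] * unfolding cstar_limitin[unfolded cstar_topology_def] by (auto simp: image_subset_iff)
qed
end

lemma (in cstar_algebra) cauchy_limit:
  fixes \<sigma> :: "nat \<Rightarrow> 'a"
  assumes "range \<sigma> \<subseteq> carrier B" "\<forall>e>0. \<exists>N. \<forall>n\<ge>N. \<forall>m\<ge>N. cdist B (\<sigma> n) (\<sigma> m) < e"
  obtains x where "x \<in> carrier B" "\<And>e. e > 0 \<Longrightarrow> \<exists>N. \<forall>n\<ge>N. cdist B (\<sigma> n) x < e"
proof -
  have "Metric_space.MCauchy (carrier B) (cdist B) \<sigma>"
    unfolding Metric_space.MCauchy_def[OF cstar_metric] using assms by simp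
  then obtain x where "limitin (cstar_topology B) \<sigma> x sequentially"
    using complete unfolding Metric_space.mcomplete_def[OF cstar_metric] cstar_topology_def by blast
  then have x: "x \<in> carrier B" "\<forall>e>0. \<exists>N. \<forall>n\<ge>N. \<sigma> n \<in> carrier B \<and> cdist B (\<sigma> n) x < e"
    unfolding cstar_limitin by auto
  have "\<exists>N. \<forall>n\<ge>N. cdist B (\<sigma> n) x < e" if "e > 0" for e
    using x(2)[rule_format, OF that] by auto
  then show thesis using that x(1) by simp
qed

lemma (in unital_cstar_algebra) cnorm_one_le: "cnorm B \<one> \<le> 1"
proof -
  have "\<one>\<^sup>\<star> = \<one>" using star_mult[of "\<one>\<^sup>\<star>" \<one>] star_star[of \<one>] star_closed[of \<one>] by simp
  then have "cnorm B \<one> = (cnorm B \<one>)\<^sup>2" using cnorm_star_mult[of \<one>] by simp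
  then have "cnorm B \<one> = 0 \<or> cnorm B \<one> = 1" by (simp add: power2_eq_square)
  then show ?thesis by auto
qed

section \<open>Subalgebras\<close>

context cstar_algebra
begin

lemma sub_pre:
  assumes "cstar_subalgebra B D"
  shows "pre_cstar_algebra (B\<lparr>carrier := D\<rparr>)"
proof -
  have D: "D \<subseteq> carrier B" "\<zero> \<in> D" "\<And>x y. x \<in> D \<Longrightarrow> y \<in> D \<Longrightarrow> x \<oplus> y \<in> D"
    "\<And>x y. x \<in> D \<Longrightarrow> y \<in> D \<Longrightarrow> x \<otimes> y \<in> D" "\<And>x. x \<in> D \<Longrightarrow> x\<^sup>\<star> \<in> D" "\<And>x c. x \<in> D \<Longrightarrow> c \<odot> x \<in> D"
    using assms unfolding cstar_subalgebra_def by auto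
  note in_B = subsetD[OF D(1)]
  have "abelian_group (B\<lparr>carrier := D\<rparr>)"
  proof (rule abelian_groupI, simp_all add: D in_B a_assoc)
    show "x \<oplus> y = y \<oplus> x" if "x \<in> D" "y \<in> D" for x y using that in_B a_comm by blast
    show "\<exists>y\<in>D. y \<oplus> x = \<zero>" if "x \<in> D" for x
      using a_inv_eq[of x] that D in_B l_neg by metis
  qed
  then interpret A: abelian_group "B\<lparr>carrier := D\<rparr>" .
  show ?thesis
    by unfold_locales
      (use D in_B in \<open>simp_all add: m_assoc l_distr r_distr smult_l_distr smult_r_distr smult_assoc1 smult_one
        smult_mult_left smult_mult_right star_star star_add star_mult star_smult cnorm_nonneg
        cnorm_eq_0_iff cnorm_triangle cnorm_smult cnorm_mult cnorm_star_mult\<close>)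
qed

lemma sub_cdist:
  assumes "cstar_subalgebra B D" "x \<in> D" "y \<in> D"
  shows "cdist (B\<lparr>carrier := D\<rparr>) x y = cdist B x y"
proof -
  interpret A: pre_cstar_algebra "B\<lparr>carrier := D\<rparr>" by (rule sub_pre[OF assms(1)])
  have "D \<subseteq> carrier B" using assms unfolding cstar_subalgebra_def by auto
  then show ?thesis using A.cdist_eq[of x y] cdist_eq[of x y] assms subsetD[of D "carrier B"] by simp
qed

lemma sub_cstar_algebra:
  assumes "cstar_subalgebra B D"
  shows "cstar_algebra (B\<lparr>carrier := D\<rparr>)"
proof -
  interpret A: pre_cstar_algebra "B\<lparr>carrier := D\<rparr>" by (rule sub_pre[OF assms(1)])
  have D: "D \<subseteq> carrier B" and cl: "closedin (cstar_topology B) D" using assms unfolding cstar_subalgebra_def by auto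
  show ?thesis
  proof (rule A.cstar_algebraI)
    fix \<sigma> :: "nat \<Rightarrow> 'a" assume s: "range \<sigma> \<subseteq> carrier (B\<lparr>carrier := D\<rparr>)"
      "\<forall>e>0. \<exists>N. \<forall>n\<ge>N. \<forall>m\<ge>N. cdist (B\<lparr>carrier := D\<rparr>) (\<sigma> n) (\<sigma> m) < e"
    then have sD: "\<And>n. \<sigma> n \<in> D" by auto
    obtain x where x: "x \<in> carrier B" "\<And>e. e > 0 \<Longrightarrow> \<exists>N. \<forall>n\<ge>N. cdist B (\<sigma> n) x < e"
      by (rule cauchy_limit[of \<sigma>]) (use s(2) sD D sub_cdist[OF assms sD sD] in auto)
    have "range \<sigma> \<subseteq> D" using sD by auto
    then have "x \<in> D" using cl[unfolded closedin_cstar_iff, THEN conjunct2, rule_format, of \<sigma> x] x by simp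
    then show "\<exists>x\<in>carrier (B\<lparr>carrier := D\<rparr>). \<forall>e>0. \<exists>N. \<forall>n\<ge>N. cdist (B\<lparr>carrier := D\<rparr>) (\<sigma> n) x < e"
      using x(2) sub_cdist[OF assms sD] by (intro bexI[of _ x]) auto
  qed
qed

lemma cstar_subalgebra_carrier: "cstar_subalgebra B (carrier B)"
  unfolding cstar_subalgebra_def
  using closedin_topspace[of "cstar_topology B"]
  by (auto simp: m_closed star_closed smult_closed cstar_topology_def Metric_space.topspace_mtopology[OF cstar_metric])

lemma cstar_subalgebra_generated:
  assumes "X \<subseteq> carrier B"
  shows "cstar_subalgebra B (cstar_generated B X)"
proof -
  let ?F = "{t. cstar_subalgebra B t \<and> X \<subseteq> t}"
  have "carrier B \<in> ?F" using cstar_subalgebra_carrier assms by simp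
  moreover have "closedin (cstar_topology B) (\<Inter>?F)"
    using calculation by (intro closedin_Inter) (auto simp: cstar_subalgebra_def)
  ultimately show ?thesis
    unfolding cstar_generated_def hull_def cstar_subalgebra_def[of _ "\<Inter>?F"]
    by (intro conjI ballI allI InterI) (auto simp: cstar_subalgebra_def)
qed
end

lemma (in unital_cstar_algebra) sub_unital:
  assumes "cstar_subalgebra B D" "\<one> \<in> D"
  shows "unital_cstar_algebra (B\<lparr>carrier := D\<rparr>)"
proof -
  interpret A: cstar_algebra "B\<lparr>carrier := D\<rparr>" by (rule sub_cstar_algebra[OF assms(1)])
  have "D \<subseteq> carrier B" using assms unfolding cstar_subalgebra_def by auto
  note in_B = subsetD[OF this]
  show ?thesis
    by unfold_locales (use assms in_B A.m_closed A.l_distr A.r_distr in \<open>simp_all add: m_assoc\<close>)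
qed

section \<open>Products\<close>

definition cprod :: "'r set \<Rightarrow> ('r \<Rightarrow> 'a cstar) \<Rightarrow> ('r \<Rightarrow> 'a) cstar" where
  "cprod R Bs = \<lparr>
     carrier = {f \<in> (\<Pi>\<^sub>E r\<in>R. carrier (Bs r)). \<exists>M. \<forall>r\<in>R. cnorm (Bs r) (f r) \<le> M},
     mult = (\<lambda>f g. \<lambda>r\<in>R. f r \<otimes>\<^bsub>Bs r\<^esub> g r),
     one = (\<lambda>r\<in>R. \<one>\<^bsub>Bs r\<^esub>),
     zero = (\<lambda>r\<in>R. \<zero>\<^bsub>Bs r\<^esub>),
     add = (\<lambda>f g. \<lambda>r\<in>R. f r \<oplus>\<^bsub>Bs r\<^esub> g r),
     smult = (\<lambda>c f. \<lambda>r\<in>R. c \<odot>\<^bsub>Bs r\<^esub> f r),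
     star = (\<lambda>f. \<lambda>r\<in>R. (f r)\<^sup>\<star>\<^bsub>Bs r\<^esub>),
     cnorm = (\<lambda>f. SUP r\<in>R. cnorm (Bs r) (f r))\<rparr>"

lemma (in pre_cstar_algebra) cnorm_star: assumes "x \<in> carrier B" shows "cnorm B (x\<^sup>\<star>) = cnorm B x"
proof -
  have le: "cnorm B y \<le> cnorm B (y\<^sup>\<star>)" if "y \<in> carrier B" for y
  proof (cases "cnorm B y = 0")
    case True then show ?thesis using cnorm_nonneg[OF star_closed[OF that]] by simp
  next
    case False
    have "(cnorm B y)\<^sup>2 \<le> cnorm B (y\<^sup>\<star>) * cnorm B y"
      using cnorm_star_mult[OF that] cnorm_mult[OF star_closed[OF that] that] by simp
    then show ?thesis using False cnorm_nonneg[OF that] by (simp add: power2_eq_square)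
  qed
  show ?thesis using le[OF assms] le[OF star_closed[OF assms]] star_star[OF assms] by simp
qed

locale cstar_family =
  fixes R :: "'r set" and Bs :: "'r \<Rightarrow> 'a cstar"
  assumes ne: "R \<noteq> {}" and unital: "\<And>r. r \<in> R \<Longrightarrow> unital_cstar_algebra (Bs r)"
begin

abbreviation P where "P \<equiv> cprod R Bs"

lemma pre: "r \<in> R \<Longrightarrow> pre_cstar_algebra (Bs r)"
  and cst: "r \<in> R \<Longrightarrow> cstar_algebra (Bs r)"
  and rng: "r \<in> R \<Longrightarrow> ring (Bs r)"
  and abg: "r \<in> R \<Longrightarrow> abelian_group (Bs r)"
  using unital unfolding unital_cstar_algebra_def cstar_algebra_def pre_cstar_algebra_def by auto

lemma ab_mon: "r \<in> R \<Longrightarrow> abelian_monoid (Bs r)"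
  using abg abelian_group.axioms(1) by auto

lemmas ax = pre_cstar_algebra.m_closed[OF pre] pre_cstar_algebra.m_assoc[OF pre]
  pre_cstar_algebra.l_distr[OF pre] pre_cstar_algebra.r_distr[OF pre]
  pre_cstar_algebra.smult_closed[OF pre] pre_cstar_algebra.smult_l_distr[OF pre]
  pre_cstar_algebra.smult_r_distr[OF pre] pre_cstar_algebra.smult_assoc1[OF pre]
  pre_cstar_algebra.smult_one[OF pre] pre_cstar_algebra.smult_mult_left[OF pre]
  pre_cstar_algebra.smult_mult_right[OF pre] pre_cstar_algebra.star_closed[OF pre]
  pre_cstar_algebra.star_star[OF pre] pre_cstar_algebra.star_add[OF pre]
  pre_cstar_algebra.star_mult[OF pre] pre_cstar_algebra.star_smult[OF pre]
  abelian_monoid.a_closed[OF ab_mon] abelian_monoid.zero_closed[OF ab_mon]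
  abelian_monoid.a_assoc[OF ab_mon] abelian_monoid.l_zero[OF ab_mon]
  ring.ring_simprules(6)[OF rng] 

lemma carrierI:
  assumes "\<And>r. r \<in> R \<Longrightarrow> f r \<in> carrier (Bs r)" "\<And>r. r \<in> R \<Longrightarrow> cnorm (Bs r) (f r) \<le> M"
  shows "restrict f R \<in> carrier P"
  using assms unfolding cprod_def by auto

lemma carrier_at: "f \<in> carrier P \<Longrightarrow> r \<in> R \<Longrightarrow> f r \<in> carrier (Bs r)"
  unfolding cprod_def by auto

lemma carrier_bdd: assumes "f \<in> carrier P" obtains M where "\<And>r. r \<in> R \<Longrightarrow> cnorm (Bs r) (f r) \<le> M" "M \<ge> 0"
proof -
  obtain M where M: "\<And>r. r \<in> R \<Longrightarrow> cnorm (Bs r) (f r) \<le> M" using assms unfolding cprod_def by auto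
  show thesis by (rule that[of "max M 0"]) (use M in \<open>auto simp: le_max_iff_disj\<close>)
qed

lemma carrier_ext: "f \<in> carrier P \<Longrightarrow> g \<in> carrier P \<Longrightarrow> (\<And>r. r \<in> R \<Longrightarrow> f r = g r) \<Longrightarrow> f = g"
  unfolding cprod_def by (auto intro: PiE_ext)

lemma at [simp]: "r \<in> R \<Longrightarrow> (f \<otimes>\<^bsub>P\<^esub> g) r = f r \<otimes>\<^bsub>Bs r\<^esub> g r"
  "r \<in> R \<Longrightarrow> (f \<oplus>\<^bsub>P\<^esub> g) r = f r \<oplus>\<^bsub>Bs r\<^esub> g r"
  "r \<in> R \<Longrightarrow> (c \<odot>\<^bsub>P\<^esub> f) r = c \<odot>\<^bsub>Bs r\<^esub> f r"
  "r \<in> R \<Longrightarrow> (f\<^sup>\<star>\<^bsub>P\<^esub>) r = (f r)\<^sup>\<star>\<^bsub>Bs r\<^esub>"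
  "r \<in> R \<Longrightarrow> \<one>\<^bsub>P\<^esub> r = \<one>\<^bsub>Bs r\<^esub>"
  "r \<in> R \<Longrightarrow> \<zero>\<^bsub>P\<^esub> r = \<zero>\<^bsub>Bs r\<^esub>"
  unfolding cprod_def by auto

lemma norm_def: "cnorm P f = (SUP r\<in>R. cnorm (Bs r) (f r))"
  unfolding cprod_def by simp

lemma norm_at: assumes "f \<in> carrier P" "r \<in> R" shows "cnorm (Bs r) (f r) \<le> cnorm P f"
proof -
  obtain M where "\<And>r. r \<in> R \<Longrightarrow> cnorm (Bs r) (f r) \<le> M" using carrier_bdd[OF assms(1)] by metis
  then show ?thesis unfolding norm_def using assms by (intro cSUP_upper) (auto simp: bdd_above_def)
qed

lemma norm_le: assumes "\<And>r. r \<in> R \<Longrightarrow> cnorm (Bs r) (f r) \<le> M" shows "cnorm P f \<le> M"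
  unfolding norm_def using assms ne by (intro cSUP_least) auto

lemma nn: "f \<in> carrier P \<Longrightarrow> r \<in> R \<Longrightarrow> 0 \<le> cnorm (Bs r) (f r)"
  using pre_cstar_algebra.cnorm_nonneg[OF pre] carrier_at by blast

lemma norm_nn: "f \<in> carrier P \<Longrightarrow> 0 \<le> cnorm P f"
  using nn norm_at ne by (metis all_not_in_conv order_trans)

lemma closed:
  "\<one>\<^bsub>P\<^esub> \<in> carrier P" "\<zero>\<^bsub>P\<^esub> \<in> carrier P"
  "f \<in> carrier P \<Longrightarrow> g \<in> carrier P \<Longrightarrow> f \<oplus>\<^bsub>P\<^esub> g \<in> carrier P"
  "f \<in> carrier P \<Longrightarrow> g \<in> carrier P \<Longrightarrow> f \<otimes>\<^bsub>P\<^esub> g \<in> carrier P"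
  "f \<in> carrier P \<Longrightarrow> f\<^sup>\<star>\<^bsub>P\<^esub> \<in> carrier P"
  "f \<in> carrier P \<Longrightarrow> c \<odot>\<^bsub>P\<^esub> f \<in> carrier P"
proof -
  have "(\<lambda>r\<in>R. \<one>\<^bsub>Bs r\<^esub>) \<in> carrier P"
    by (rule carrierI[of _ 1]) (auto simp: ax unital_cstar_algebra.cnorm_one_le[OF unital])
  then show "\<one>\<^bsub>P\<^esub> \<in> carrier P" by (simp add: cprod_def)
  have "(\<lambda>r\<in>R. \<zero>\<^bsub>Bs r\<^esub>) \<in> carrier P"
    by (rule carrierI[of _ 0]) (auto simp: ax pre_cstar_algebra.cnorm_zero[OF pre])
  then show "\<zero>\<^bsub>P\<^esub> \<in> carrier P" by (simp add: cprod_def)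
  assume f: "f \<in> carrier P"
  obtain M where M: "\<And>r. r \<in> R \<Longrightarrow> cnorm (Bs r) (f r) \<le> M" "M \<ge> 0" using carrier_bdd[OF f] by metis
  have "(\<lambda>r\<in>R. (f r)\<^sup>\<star>\<^bsub>Bs r\<^esub>) \<in> carrier P"
    by (rule carrierI[of _ M]) (auto simp: ax carrier_at f M pre_cstar_algebra.cnorm_star[OF pre])
  then show "f\<^sup>\<star>\<^bsub>P\<^esub> \<in> carrier P" by (simp add: cprod_def)
  have "(\<lambda>r\<in>R. c \<odot>\<^bsub>Bs r\<^esub> f r) \<in> carrier P"
    by (rule carrierI[of _ "cmod c * M"])
      (auto simp: ax carrier_at f M pre_cstar_algebra.cnorm_smult[OF pre] mult_left_mono)
  then show "c \<odot>\<^bsub>P\<^esub> f \<in> carrier P" by (simp add: cprod_def)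
  assume g: "g \<in> carrier P"
  obtain N where N: "\<And>r. r \<in> R \<Longrightarrow> cnorm (Bs r) (g r) \<le> N" "N \<ge> 0" using carrier_bdd[OF g] by metis
  have "(\<lambda>r\<in>R. f r \<oplus>\<^bsub>Bs r\<^esub> g r) \<in> carrier P"
    by (rule carrierI[of _ "M + N"])
      (auto simp: ax carrier_at f g intro: order_trans[OF pre_cstar_algebra.cnorm_triangle[OF pre] add_mono] M N)
  then show "f \<oplus>\<^bsub>P\<^esub> g \<in> carrier P" by (simp add: cprod_def)
  have "(\<lambda>r\<in>R. f r \<otimes>\<^bsub>Bs r\<^esub> g r) \<in> carrier P"
    by (rule carrierI[of _ "M * N"])
      (auto simp: ax carrier_at f g nn intro!: order_trans[OF pre_cstar_algebra.cnorm_mult[OF pre] mult_mono] M N)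
  then show "f \<otimes>\<^bsub>P\<^esub> g \<in> carrier P" by (simp add: cprod_def)
qed

lemma P_pre: "pre_cstar_algebra P"
proof -
  have "abelian_group P"
  proof (rule abelian_groupI)
    fix x assume x: "x \<in> carrier P"
    show "\<exists>y\<in>carrier P. y \<oplus>\<^bsub>P\<^esub> x = \<zero>\<^bsub>P\<^esub>"
    proof (intro bexI carrier_ext)
      fix r assume r: "r \<in> R"
      interpret pre_cstar_algebra "Bs r" by (rule pre[OF r])
      show "((-1) \<odot>\<^bsub>P\<^esub> x \<oplus>\<^bsub>P\<^esub> x) r = \<zero>\<^bsub>P\<^esub> r"
        using a_inv_eq carrier_at[OF x r] l_neg r by (metis at(2,3,6))
    qed (simp_all add: closed x)
    show "\<zero>\<^bsub>P\<^esub> \<oplus>\<^bsub>P\<^esub> x = x" by (rule carrier_ext) (simp_all add: closed x ax carrier_at)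
    fix y assume y: "y \<in> carrier P"
    show "x \<oplus>\<^bsub>P\<^esub> y = y \<oplus>\<^bsub>P\<^esub> x"
      by (rule carrier_ext) (simp_all add: closed x y carrier_at abelian_monoid.a_comm[OF ab_mon])
    fix z assume z: "z \<in> carrier P"
    show "x \<oplus>\<^bsub>P\<^esub> y \<oplus>\<^bsub>P\<^esub> z = x \<oplus>\<^bsub>P\<^esub> (y \<oplus>\<^bsub>P\<^esub> z)"
      by (rule carrier_ext) (simp_all add: closed x y z ax carrier_at)
  qed (simp_all add: closed)
  then interpret abelian_group P .
  have sq: "x \<in> carrier P \<Longrightarrow> cnorm P (x\<^sup>\<star>\<^bsub>P\<^esub> \<otimes>\<^bsub>P\<^esub> x) = (cnorm P x)\<^sup>2" for x
  proof (rule antisym)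
    assume x: "x \<in> carrier P"
    have *: "cnorm (Bs r) ((x\<^sup>\<star>\<^bsub>P\<^esub> \<otimes>\<^bsub>P\<^esub> x) r) = (cnorm (Bs r) (x r))\<^sup>2" if "r \<in> R" for r
      using pre_cstar_algebra.cnorm_star_mult[OF pre[OF that] carrier_at[OF x that]] that by simp
    show "cnorm P (x\<^sup>\<star>\<^bsub>P\<^esub> \<otimes>\<^bsub>P\<^esub> x) \<le> (cnorm P x)\<^sup>2"
      by (rule norm_le) (simp only: *, intro power_mono norm_at nn x)
    have "cnorm P x \<le> sqrt (cnorm P (x\<^sup>\<star>\<^bsub>P\<^esub> \<otimes>\<^bsub>P\<^esub> x))"
      by (rule norm_le) (use * norm_at[of "x\<^sup>\<star>\<^bsub>P\<^esub> \<otimes>\<^bsub>P\<^esub> x"] x closed in \<open>auto intro!: real_le_rsqrt\<close>)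
    then show "(cnorm P x)\<^sup>2 \<le> cnorm P (x\<^sup>\<star>\<^bsub>P\<^esub> \<otimes>\<^bsub>P\<^esub> x)"
      using norm_nn[OF x] norm_nn[of "x\<^sup>\<star>\<^bsub>P\<^esub> \<otimes>\<^bsub>P\<^esub> x"] x closed
      by (metis power_mono real_sqrt_pow2)
  qed
  have zero: "x \<in> carrier P \<Longrightarrow> cnorm P x = 0 \<longleftrightarrow> x = \<zero>\<^bsub>P\<^esub>" for x
  proof
    assume x: "x \<in> carrier P" and "cnorm P x = 0"
    then have "cnorm (Bs r) (x r) = 0" if "r \<in> R" for r
      using norm_at[OF x that] nn[OF x that] by simp
    then show "x = \<zero>\<^bsub>P\<^esub>"
      by (intro carrier_ext) (simp_all add: x closed pre_cstar_algebra.cnorm_eq_0_iff[OF pre, symmetric] carrier_at)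
  next
    assume "x = \<zero>\<^bsub>P\<^esub>"
    then have "cnorm P x \<le> 0" by (intro norm_le) (simp add: pre_cstar_algebra.cnorm_zero[OF pre])
    then show "cnorm P x = 0" using norm_nn[of x] \<open>x = _\<close> closed by simp
  qed
  have tri: "cnorm P (x \<oplus>\<^bsub>P\<^esub> y) \<le> cnorm P x + cnorm P y" if "x \<in> carrier P" "y \<in> carrier P" for x y
    by (rule norm_le, simp, rule order_trans[OF pre_cstar_algebra.cnorm_triangle[OF pre] add_mono])
      (auto intro: that norm_at carrier_at)
  have mul: "cnorm P (x \<otimes>\<^bsub>P\<^esub> y) \<le> cnorm P x * cnorm P y" if "x \<in> carrier P" "y \<in> carrier P" for x y
    by (rule norm_le, simp, rule order_trans[OF pre_cstar_algebra.cnorm_mult[OF pre] mult_mono])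
      (auto intro: that norm_at carrier_at nn norm_nn)
  have scl: "cnorm P (c \<odot>\<^bsub>P\<^esub> x) \<le> cmod c * cnorm P x" if "x \<in> carrier P" for c x
    by (rule norm_le) (auto simp: that carrier_at pre_cstar_algebra.cnorm_smult[OF pre] intro!: mult_left_mono norm_at)
  have sc: "cnorm P (c \<odot>\<^bsub>P\<^esub> x) = cmod c * cnorm P x" if x: "x \<in> carrier P" for c x
  proof (cases "c = 0")
    case True
    then show ?thesis using scl[OF x, of c] norm_nn[of "c \<odot>\<^bsub>P\<^esub> x"] closed(6)[OF x] by simp
  next
    case False
    have "inverse c \<odot>\<^bsub>P\<^esub> (c \<odot>\<^bsub>P\<^esub> x) = x"
      by (rule carrier_ext) (use False in \<open>simp_all add: closed x carrier_at ax(8)[symmetric] ax(9)\<close>)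
    then have "cnorm P x \<le> inverse (cmod c) * cnorm P (c \<odot>\<^bsub>P\<^esub> x)"
      using scl[of "c \<odot>\<^bsub>P\<^esub> x" "inverse c"] closed x by (simp add: norm_inverse)
    then have "cmod c * cnorm P x \<le> cnorm P (c \<odot>\<^bsub>P\<^esub> x)"
      using False by (simp add: field_simps)
    then show ?thesis using scl[OF x, of c] by simp
  qed
  show ?thesis
    by unfold_locales
      (rule carrier_ext | simp_all add: closed carrier_at ax norm_nn zero tri mul sc sq)+
qed

sublocale PP: pre_cstar_algebra P by (rule P_pre)

lemma cdist_at: assumes "f \<in> carrier P" "g \<in> carrier P" "r \<in> R"
  shows "cdist (Bs r) (f r) (g r) = cnorm (Bs r) ((f \<ominus>\<^bsub>P\<^esub> g) r)"
  using pre_cstar_algebra.cdist_eq[OF pre[OF assms(3)], of "f r" "g r"] assms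
  by (simp add: carrier_at a_minus_def PP.a_inv_eq)

lemma cdist_le: assumes "f \<in> carrier P" "g \<in> carrier P" "r \<in> R"
  shows "cdist (Bs r) (f r) (g r) \<le> cdist P f g"
  using cdist_at[OF assms] norm_at[of "f \<ominus>\<^bsub>P\<^esub> g" r] assms by (simp add: cdist_def)

lemma cdist_leI: assumes "f \<in> carrier P" "g \<in> carrier P" "\<And>r. r \<in> R \<Longrightarrow> cdist (Bs r) (f r) (g r) \<le> e"
  shows "cdist P f g \<le> e"
  using norm_le[of "f \<ominus>\<^bsub>P\<^esub> g" e] assms cdist_at[OF assms(1,2)] by (simp add: cdist_def)

lemma P_cstar: "cstar_algebra P"
proof (rule PP.cstar_algebraI)
  fix \<sigma> :: "nat \<Rightarrow> 'r \<Rightarrow> 'a" assume "range \<sigma> \<subseteq> carrier P"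
    and cau: "\<forall>e>0. \<exists>N. \<forall>n\<ge>N. \<forall>m\<ge>N. cdist P (\<sigma> n) (\<sigma> m) < e"
  then have s: "\<And>n. \<sigma> n \<in> carrier P" by auto
  have "\<exists>x. x \<in> carrier (Bs r) \<and> (\<forall>e>0. \<exists>N. \<forall>n\<ge>N. cdist (Bs r) (\<sigma> n r) x < e)" if r: "r \<in> R" for r
  proof -
    interpret cstar_algebra "Bs r" by (rule cst[OF r])
    have c1: "range (\<lambda>n. \<sigma> n r) \<subseteq> carrier (Bs r)" using carrier_at[OF s r] by auto
    have c2: "\<forall>e>0. \<exists>N. \<forall>n\<ge>N. \<forall>m\<ge>N. cdist (Bs r) (\<sigma> n r) (\<sigma> m r) < e"
      using cau cdist_le[OF s s r] by (meson le_less_trans)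
    show ?thesis by (rule cauchy_limit[OF c1 c2]) (rule exI, rule conjI, assumption, rule allI, rule impI, simp)
  qed
  then obtain l where l: "\<And>r. r \<in> R \<Longrightarrow> l r \<in> carrier (Bs r)"
    "\<And>r e. r \<in> R \<Longrightarrow> e > 0 \<Longrightarrow> \<exists>N. \<forall>n\<ge>N. cdist (Bs r) (\<sigma> n r) (l r) < e"
    by metis
  have unif: "cdist (Bs r) (\<sigma> n r) (l r) \<le> e"
    if r: "r \<in> R" and N: "\<forall>n\<ge>N. \<forall>m\<ge>N. cdist P (\<sigma> n) (\<sigma> m) < e" and n: "n \<ge> N" for r n N e
  proof (rule field_le_epsilon)
    fix d :: real assume "d > 0"
    then obtain N' where N': "\<forall>n\<ge>N'. cdist (Bs r) (\<sigma> n r) (l r) < d" using l(2)[OF r] by blast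
    let ?m = "max N N'"
    interpret Metric_space "carrier (Bs r)" "cdist (Bs r)"
      by (rule pre_cstar_algebra.cstar_metric[OF pre[OF r]])
    have "cdist (Bs r) (\<sigma> n r) (l r) \<le> cdist (Bs r) (\<sigma> n r) (\<sigma> ?m r) + cdist (Bs r) (\<sigma> ?m r) (l r)"
      by (intro triangle carrier_at s r l)
    also have "\<dots> \<le> e + d"
    proof (intro add_mono)
      have "cdist P (\<sigma> n) (\<sigma> ?m) < e" using N n by simp
      then show "cdist (Bs r) (\<sigma> n r) (\<sigma> ?m r) \<le> e" using cdist_le[OF s s r, of n ?m] by linarith
      have "cdist (Bs r) (\<sigma> ?m r) (l r) < d" using N' by simp
      then show "cdist (Bs r) (\<sigma> ?m r) (l r) \<le> d" by simp
    qed
    finally show "cdist (Bs r) (\<sigma> n r) (l r) \<le> e + d" .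
  qed
  obtain N1 where N1: "\<forall>n\<ge>N1. \<forall>m\<ge>N1. cdist P (\<sigma> n) (\<sigma> m) < 1" using cau by (meson zero_less_one)
  obtain M where M: "\<And>r. r \<in> R \<Longrightarrow> cnorm (Bs r) (\<sigma> N1 r) \<le> M" using carrier_bdd[OF s] by metis
  have lc: "restrict l R \<in> carrier P"
  proof (rule carrierI[of _ "M + 1"])
    fix r assume r: "r \<in> R"
    show "l r \<in> carrier (Bs r)" using l r by blast
    interpret pre_cstar_algebra "Bs r" by (rule pre[OF r])
    have c: "\<sigma> N1 r \<in> carrier (Bs r)" "l r \<in> carrier (Bs r)" using carrier_at s l r by auto
    have "l r = \<sigma> N1 r \<oplus>\<^bsub>Bs r\<^esub> \<ominus>\<^bsub>Bs r\<^esub> (\<sigma> N1 r \<ominus>\<^bsub>Bs r\<^esub> l r)"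
      using c by (simp add: a_minus_def minus_add r_neg2)
    then have "cnorm (Bs r) (l r) \<le> cnorm (Bs r) (\<sigma> N1 r) + cdist (Bs r) (\<sigma> N1 r) (l r)"
      using cnorm_triangle[of "\<sigma> N1 r" "\<ominus>\<^bsub>Bs r\<^esub> (\<sigma> N1 r \<ominus>\<^bsub>Bs r\<^esub> l r)"]
        cnorm_minus[of "\<sigma> N1 r \<ominus>\<^bsub>Bs r\<^esub> l r"] c by (simp add: cdist_def)
    then show "cnorm (Bs r) (l r) \<le> M + 1" using M[OF r] unif[OF r N1, of N1] by simp
  qed
  show "\<exists>x\<in>carrier P. \<forall>e>0. \<exists>N. \<forall>n\<ge>N. cdist P (\<sigma> n) x < e"
  proof (intro bexI[OF _ lc] allI impI)
    fix e :: real assume "e > 0"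
    then obtain N where N: "\<forall>n\<ge>N. \<forall>m\<ge>N. cdist P (\<sigma> n) (\<sigma> m) < e/2" using cau by (meson half_gt_zero)
    have "cdist P (\<sigma> n) (restrict l R) \<le> e/2" if "n \<ge> N" for n
      by (intro cdist_leI s lc) (use unif[OF _ N that] in simp)
    then show "\<exists>N. \<forall>n\<ge>N. cdist P (\<sigma> n) (restrict l R) < e" using \<open>e > 0\<close> by (intro exI[of _ N]) fastforce
  qed
qed

lemma P_unital: "unital_cstar_algebra P"
proof -
  have "monoid P"
    by (rule monoidI) (simp_all add: closed PP.m_assoc, auto intro!: carrier_ext simp: closed carrier_at monoid.l_one[OF ring.is_monoid[OF rng]] monoid.r_one[OF ring.is_monoid[OF rng]])
  then show ?thesis
    by (intro unital_cstar_algebra.intro P_cstar ringI PP.abelian_group_axioms) (auto simp: PP.l_distr PP.r_distr)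
qed

lemma proj_hom: "r \<in> R \<Longrightarrow> (\<lambda>f. f r) \<in> unital_cstar_hom P (Bs r)"
  unfolding unital_cstar_hom_def ring_hom_def by (auto simp: carrier_at)

end

section \<open>Homomorphisms and Exel--Laca families\<close>

lemma (in monoid) finprod_commuting:
  assumes "finite X" "f \<in> X \<rightarrow> carrier G"
    "\<And>x y. x \<in> X \<Longrightarrow> y \<in> X \<Longrightarrow> f x \<otimes> f y = f y \<otimes> f x"
  shows "finprod G f X \<in> carrier G"
    and "\<And>a F. F \<subseteq> X \<Longrightarrow> a \<in> X \<Longrightarrow> a \<notin> F \<Longrightarrow> finprod G f (insert a F) = f a \<otimes> finprod G f F"
proof -
  interpret L: LCD X "carrier G" "mult G \<circ> f"
  proof
    fix x y z assume "x \<in> X" "y \<in> X" "z \<in> carrier G"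
    then have "f x \<otimes> (f y \<otimes> z) = (f x \<otimes> f y) \<otimes> z" "f y \<otimes> (f x \<otimes> z) = (f y \<otimes> f x) \<otimes> z"
      using assms(2) by (auto simp: m_assoc Pi_iff)
    then show "(mult G \<circ> f) x ((mult G \<circ> f) y z) = (mult G \<circ> f) y ((mult G \<circ> f) x z)"
      using assms(3) \<open>x \<in> X\<close> \<open>y \<in> X\<close> by simp
  qed (use assms in auto)
  show "finprod G f X \<in> carrier G"
    using assms(1) by (simp add: finprod_def L.foldD_closed)
  show "finprod G f (insert a F) = f a \<otimes> finprod G f F" if "F \<subseteq> X" "a \<in> X" "a \<notin> F" for a F
    using L.foldD_insert[of F a \<one>] that assms(1) by (simp add: finprod_def finite_subset)
qed

lemma (in monoid) finprod_cong_local: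
  assumes "\<And>x. x \<in> X \<Longrightarrow> f x = g x"
  shows "finprod G f X = finprod G g X"
proof -
  have "(A, z) \<in> foldSetD (carrier G) (mult G \<circ> f) \<one> \<Longrightarrow> A \<subseteq> X \<Longrightarrow> \<forall>x\<in>X. f x = g x \<Longrightarrow>
    (A, z) \<in> foldSetD (carrier G) (mult G \<circ> g) \<one>" for A z f g
  proof (induction rule: foldSetD.induct)
    case emptyI then show ?case by (simp add: foldSetD.emptyI)
  next
    case (insertI x A y)
    then have e: "(mult G \<circ> f) x y = (mult G \<circ> g) x y" by simp
    show ?case unfolding e by (rule foldSetD.insertI) (use insertI e in auto)
  qed
  then have "(X, z) \<in> foldSetD (carrier G) (mult G \<circ> f) \<one> \<longleftrightarrow> (X, z) \<in> foldSetD (carrier G) (mult G \<circ> g) \<one>" for z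
    using assms by auto
  then show ?thesis unfolding finprod_def foldD_def by simp
qed

lemma hom_at:
  assumes "\<phi> \<in> unital_cstar_hom U B"
  shows "x \<in> carrier U \<Longrightarrow> \<phi> x \<in> carrier B"
    "x \<in> carrier U \<Longrightarrow> y \<in> carrier U \<Longrightarrow> \<phi> (x \<otimes>\<^bsub>U\<^esub> y) = \<phi> x \<otimes>\<^bsub>B\<^esub> \<phi> y"
    "x \<in> carrier U \<Longrightarrow> y \<in> carrier U \<Longrightarrow> \<phi> (x \<oplus>\<^bsub>U\<^esub> y) = \<phi> x \<oplus>\<^bsub>B\<^esub> \<phi> y"
    "\<phi> \<one>\<^bsub>U\<^esub> = \<one>\<^bsub>B\<^esub>"
    "x \<in> carrier U \<Longrightarrow> \<phi> (x\<^sup>\<star>\<^bsub>U\<^esub>) = (\<phi> x)\<^sup>\<star>\<^bsub>B\<^esub>"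
    "x \<in> carrier U \<Longrightarrow> \<phi> (c \<odot>\<^bsub>U\<^esub> x) = c \<odot>\<^bsub>B\<^esub> \<phi> x"
  using assms unfolding unital_cstar_hom_def ring_hom_def by auto

locale two_cstar = U?: unital_cstar_algebra U + V: unital_cstar_algebra V for U :: "('a,'m) cstar_scheme" and V :: "('b,'n) cstar_scheme" +
  fixes \<phi> assumes hom: "\<phi> \<in> unital_cstar_hom U V"
begin

lemmas h = hom_at[OF hom]

lemma h_zero: "\<phi> \<zero>\<^bsub>U\<^esub> = \<zero>\<^bsub>V\<^esub>"
  using h(6)[of "\<zero>\<^bsub>U\<^esub>" 0] U.smult_0_left[of "\<zero>\<^bsub>U\<^esub>"] V.smult_0_left[of "\<phi> \<zero>\<^bsub>U\<^esub>"] h(1)[of "\<zero>\<^bsub>U\<^esub>"] by simp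

lemma h_minus: "x \<in> carrier U \<Longrightarrow> y \<in> carrier U \<Longrightarrow> \<phi> (x \<ominus>\<^bsub>U\<^esub> y) = \<phi> x \<ominus>\<^bsub>V\<^esub> \<phi> y"
  using h U.a_inv_eq V.a_inv_eq U.smult_closed by (simp add: a_minus_def)

lemma h_finprod:
  assumes "finite X" "f \<in> X \<rightarrow> carrier U"
    "\<And>x y. x \<in> X \<Longrightarrow> y \<in> X \<Longrightarrow> f x \<otimes>\<^bsub>U\<^esub> f y = f y \<otimes>\<^bsub>U\<^esub> f x"
  shows "\<phi> (finprod U f X) = finprod V (\<lambda>x. \<phi> (f x)) X"
  using assms
proof (induction X)
  case empty
  then show ?case using h(4) by (simp add: finprod_def)
next
  case (insert a X)
  have *: "f x \<in> carrier U" if "x \<in> insert a X" for x using insert that by auto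
  have "\<phi> (finprod U f (insert a X)) = \<phi> (f a \<otimes>\<^bsub>U\<^esub> finprod U f X)"
    using insert U.finprod_commuting(2)[of "insert a X" f X a, OF _ _ _ subset_insertI] by simp
  also have "\<dots> = \<phi> (f a) \<otimes>\<^bsub>V\<^esub> \<phi> (finprod U f X)"
    using insert by (intro h * U.finprod_commuting) auto
  also have "\<dots> = \<phi> (f a) \<otimes>\<^bsub>V\<^esub> finprod V (\<lambda>x. \<phi> (f x)) X" using insert by auto
  also have "\<dots> = finprod V (\<lambda>x. \<phi> (f x)) (insert a X)"
    using insert.hyps insert.prems(2) * by (intro V.finprod_commuting(2)[of "insert a X", symmetric]) (auto simp: h(1) h(2)[symmetric])
  finally show ?case .
qed

lemma h_finsum:
  assumes "finite X" "f \<in> X \<rightarrow> carrier U"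
  shows "\<phi> (finsum U f X) = finsum V (\<lambda>x. \<phi> (f x)) X"
  using assms
proof (induction X)
  case empty
  then show ?case by (simp add: h_zero)
next
  case (insert a X)
  then have "f a \<in> carrier U" "f \<in> X \<rightarrow> carrier U" by auto
  then show ?case using insert h U.finsum_closed by (simp add: Pi_iff)
qed

text \<open>Under a unital hom, the two sides of relation (iv) are mapped to their counterparts.\<close>

lemma h_iv:
  fixes I A S
  defines "Q \<equiv> \<lambda>i. (S i)\<^sup>\<star>\<^bsub>U\<^esub> \<otimes>\<^bsub>U\<^esub> S i" and "Q' \<equiv> \<lambda>i. (\<phi> (S i))\<^sup>\<star>\<^bsub>V\<^esub> \<otimes>\<^bsub>V\<^esub> \<phi> (S i)"
  assumes S: "\<And>i. i \<in> I \<Longrightarrow> S i \<in> carrier U"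
    and com: "\<And>i j. i \<in> I \<Longrightarrow> j \<in> I \<Longrightarrow> Q i \<otimes>\<^bsub>U\<^esub> Q j = Q j \<otimes>\<^bsub>U\<^esub> Q i"
    and XY: "finite X" "X \<subseteq> I" "finite Y" "Y \<subseteq> I" and J: "finite J" "J \<subseteq> I"
  shows "finprod U Q X \<otimes>\<^bsub>U\<^esub> finprod U (\<lambda>y. \<one>\<^bsub>U\<^esub> \<ominus>\<^bsub>U\<^esub> Q y) Y \<in> carrier U" 
    and "finsum U (\<lambda>j. c j \<odot>\<^bsub>U\<^esub> (S j \<otimes>\<^bsub>U\<^esub> (S j)\<^sup>\<star>\<^bsub>U\<^esub>)) J \<in> carrier U" 
    and "\<phi> (finprod U Q X \<otimes>\<^bsub>U\<^esub> finprod U (\<lambda>y. \<one>\<^bsub>U\<^esub> \<ominus>\<^bsub>U\<^esub> Q y) Y) = finprod V Q' X \<otimes>\<^bsub>V\<^esub> finprod V (\<lambda>y. \<one>\<^bsub>V\<^esub> \<ominus>\<^bsub>V\<^esub> Q' y) Y"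
    and "\<phi> (finsum U (\<lambda>j. c j \<odot>\<^bsub>U\<^esub> (S j \<otimes>\<^bsub>U\<^esub> (S j)\<^sup>\<star>\<^bsub>U\<^esub>)) J) = finsum V (\<lambda>j. c j \<odot>\<^bsub>V\<^esub> (\<phi> (S j) \<otimes>\<^bsub>V\<^esub> (\<phi> (S j))\<^sup>\<star>\<^bsub>V\<^esub>)) J"
proof -
  have Qc: "Q i \<in> carrier U" if "i \<in> I" for i unfolding Q_def using S[OF that] by (simp add: U.star_closed)
  have hQ: "\<phi> (Q i) = Q' i" if "i \<in> I" for i unfolding Q_def Q'_def using S[OF that] by (simp add: h U.star_closed)
  let ?q = "\<lambda>y. \<one>\<^bsub>U\<^esub> \<ominus>\<^bsub>U\<^esub> Q y"
  have qc: "?q i \<in> carrier U" if "i \<in> I" for i using Qc that by simp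
  have qcom: "?q i \<otimes>\<^bsub>U\<^esub> ?q j = ?q j \<otimes>\<^bsub>U\<^esub> ?q i" if "i \<in> I" "j \<in> I" for i j
  proof -
    have *: "(\<one>\<^bsub>U\<^esub> \<ominus>\<^bsub>U\<^esub> a) \<otimes>\<^bsub>U\<^esub> b = b \<otimes>\<^bsub>U\<^esub> (\<one>\<^bsub>U\<^esub> \<ominus>\<^bsub>U\<^esub> a)"
      if "a \<in> carrier U" "b \<in> carrier U" "a \<otimes>\<^bsub>U\<^esub> b = b \<otimes>\<^bsub>U\<^esub> a" for a b
      using that by (simp add: a_minus_def U.l_distr U.r_distr U.l_minus U.r_minus)
    show ?thesis
      using *[OF Qc[OF that(1)] qc[OF that(2)] *[OF Qc[OF that(2)] Qc[OF that(1)] com[OF that(2,1)], symmetric]] .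
  qed
  have cQ: "finprod U Q X \<in> carrier U" using XY Qc com by (intro U.finprod_commuting) (auto simp: subset_iff)
  have cq: "finprod U ?q Y \<in> carrier U" using XY qc qcom by (intro U.finprod_commuting) (auto simp: subset_iff)
  show "(finprod U Q X \<otimes>\<^bsub>U\<^esub> finprod U (\<lambda>y. \<one>\<^bsub>U\<^esub> \<ominus>\<^bsub>U\<^esub> Q y) Y) \<in> carrier U" using cQ cq by simp
  have SS: "c j \<odot>\<^bsub>U\<^esub> (S j \<otimes>\<^bsub>U\<^esub> (S j)\<^sup>\<star>\<^bsub>U\<^esub>) \<in> carrier U" if "j \<in> I" for j
    using S[OF that] by (simp add: U.star_closed U.smult_closed)
  then show "(finsum U (\<lambda>j. c j \<odot>\<^bsub>U\<^esub> (S j \<otimes>\<^bsub>U\<^esub> (S j)\<^sup>\<star>\<^bsub>U\<^esub>)) J) \<in> carrier U" using J by (intro U.finsum_closed) auto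
  have "\<phi> (finprod U Q X) = finprod V (\<lambda>x. \<phi> (Q x)) X"
    using XY Qc com by (intro h_finprod) (auto simp: subset_iff)
  moreover have "\<phi> (finprod U ?q Y) = finprod V (\<lambda>x. \<phi> (?q x)) Y"
    using XY qc qcom by (intro h_finprod) (auto simp: subset_iff)
  moreover have "finprod V (\<lambda>x. \<phi> (Q x)) X = finprod V Q' X"
    using hQ XY by (intro V.finprod_cong_local) auto
  moreover have "finprod V (\<lambda>x. \<phi> (?q x)) Y = finprod V (\<lambda>y. \<one>\<^bsub>V\<^esub> \<ominus>\<^bsub>V\<^esub> Q' y) Y"
    using hQ XY Qc by (intro V.finprod_cong_local) (auto simp: h_minus h(4) subset_iff)
  ultimately show "\<phi> (finprod U Q X \<otimes>\<^bsub>U\<^esub> finprod U (\<lambda>y. \<one>\<^bsub>U\<^esub> \<ominus>\<^bsub>U\<^esub> Q y) Y) = finprod V Q' X \<otimes>\<^bsub>V\<^esub> finprod V (\<lambda>y. \<one>\<^bsub>V\<^esub> \<ominus>\<^bsub>V\<^esub> Q' y) Y"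
    using h(2)[OF cQ cq] by simp
  have "\<phi> (finsum U (\<lambda>j. c j \<odot>\<^bsub>U\<^esub> (S j \<otimes>\<^bsub>U\<^esub> (S j)\<^sup>\<star>\<^bsub>U\<^esub>)) J) = finsum V (\<lambda>j. \<phi> (c j \<odot>\<^bsub>U\<^esub> (S j \<otimes>\<^bsub>U\<^esub> (S j)\<^sup>\<star>\<^bsub>U\<^esub>))) J"
    using J SS by (intro h_finsum) auto
  also have "\<dots> = finsum V (\<lambda>j. c j \<odot>\<^bsub>V\<^esub> (\<phi> (S j) \<otimes>\<^bsub>V\<^esub> (\<phi> (S j))\<^sup>\<star>\<^bsub>V\<^esub>)) J"
    using J S by (intro V.finsum_cong') (auto simp: subset_iff h U.star_closed V.star_closed V.smult_closed)
  finally show "\<phi> (finsum U (\<lambda>j. c j \<odot>\<^bsub>U\<^esub> (S j \<otimes>\<^bsub>U\<^esub> (S j)\<^sup>\<star>\<^bsub>U\<^esub>)) J) = finsum V (\<lambda>j. c j \<odot>\<^bsub>V\<^esub> (\<phi> (S j) \<otimes>\<^bsub>V\<^esub> (\<phi> (S j))\<^sup>\<star>\<^bsub>V\<^esub>)) J" .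
qed

end

lemma exel_laca_family_reflect:
  assumes ne: "R \<noteq> {}" and U: "unital_cstar_algebra U" and S: "\<And>i. i \<in> I \<Longrightarrow> S i \<in> carrier U"
    and V: "\<And>r. r \<in> R \<Longrightarrow> unital_cstar_algebra (V r)"
    and hom: "\<And>r. r \<in> R \<Longrightarrow> \<phi> r \<in> unital_cstar_hom U (V r)"
    and inj: "\<And>x y. \<lbrakk>x \<in> carrier U; y \<in> carrier U; \<And>r. r \<in> R \<Longrightarrow> \<phi> r x = \<phi> r y\<rbrakk> \<Longrightarrow> x = y"
    and fam: "\<And>r. r \<in> R \<Longrightarrow> exel_laca_family I A (V r) (\<lambda>i. \<phi> r (S i))"
  shows "exel_laca_family I A U S"
proof -
  interpret U: unital_cstar_algebra U by (rule U)
  note f = fam[unfolded exel_laca_family_def Let_def]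
  have T: "two_cstar U (V r) (\<phi> r)" if "r \<in> R" for r
    using U V[OF that] hom[OF that] by (simp add: two_cstar_def two_cstar_axioms_def)
  note hh = hom_at[OF hom]
  note cl = S U.star_closed U.m_closed U.smult_closed U.zero_closed
  let ?Q = "\<lambda>i. (S i)\<^sup>\<star>\<^bsub>U\<^esub> \<otimes>\<^bsub>U\<^esub> S i"
  have com: "?Q i \<otimes>\<^bsub>U\<^esub> ?Q j = ?Q j \<otimes>\<^bsub>U\<^esub> ?Q i" if "i \<in> I" "j \<in> I" for i j
    by (rule inj) (use f that in \<open>simp_all add: cl hh\<close>)
  show ?thesis unfolding exel_laca_family_def Let_def
  proof (intro conjI ballI allI impI)
    fix i assume i: "i \<in> I"
    show "partial_isometry U (S i)"
      unfolding partial_isometry_def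
      by (intro conjI cl i, rule inj) (use f i in \<open>simp_all add: cl hh partial_isometry_def\<close>)
    fix j assume j: "j \<in> I"
    show "?Q i \<otimes>\<^bsub>U\<^esub> ?Q j = ?Q j \<otimes>\<^bsub>U\<^esub> ?Q i" by (rule com[OF i j])
    show "?Q i \<otimes>\<^bsub>U\<^esub> S j = of_int (A i j) \<odot>\<^bsub>U\<^esub> S j"
      by (rule inj) (use f i j in \<open>simp_all add: cl hh\<close>)
    show "(S i)\<^sup>\<star>\<^bsub>U\<^esub> \<otimes>\<^bsub>U\<^esub> S j = \<zero>\<^bsub>U\<^esub>" if "i \<noteq> j"
      by (rule inj) (use f i j that in \<open>simp_all add: cl hh two_cstar.h_zero[OF T]\<close>)
  next
    fix X Y assume XY: "finite X \<and> X \<subseteq> I \<and> finite Y \<and> Y \<subseteq> I \<and> finite {j \<in> I. matrix_prod A X Y j \<noteq> 0}"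
    let ?J = "{j \<in> I. matrix_prod A X Y j \<noteq> 0}"
    show "(\<Otimes>\<^bsub>U\<^esub>x\<in>X. ?Q x) \<otimes>\<^bsub>U\<^esub> (\<Otimes>\<^bsub>U\<^esub>y\<in>Y. \<one>\<^bsub>U\<^esub> \<ominus>\<^bsub>U\<^esub> ?Q y) =
      (\<Oplus>\<^bsub>U\<^esub>j\<in>?J. of_int (matrix_prod A X Y j) \<odot>\<^bsub>U\<^esub> (S j \<otimes>\<^bsub>U\<^esub> (S j)\<^sup>\<star>\<^bsub>U\<^esub>))"
      (is "?l = ?r")
    proof -
      obtain r0 where r0: "r0 \<in> R" using ne by auto
      have J: "?J \<subseteq> I" by auto
      note iv = two_cstar.h_iv[OF T, where I = I and X = X and Y = Y and J = ?J and S = S, OF _ S com]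
      show ?thesis
      proof (rule inj)
        show "?l \<in> carrier U" by (rule iv(1)[OF r0]) (use XY J in auto)
        show "?r \<in> carrier U" by (rule iv(2)[OF r0]) (use XY J in auto)
        fix r assume r: "r \<in> R"
        have "\<phi> r ?l = (\<Otimes>\<^bsub>V r\<^esub>x\<in>X. (\<phi> r (S x))\<^sup>\<star>\<^bsub>V r\<^esub> \<otimes>\<^bsub>V r\<^esub> \<phi> r (S x)) \<otimes>\<^bsub>V r\<^esub>
           (\<Otimes>\<^bsub>V r\<^esub>y\<in>Y. \<one>\<^bsub>V r\<^esub> \<ominus>\<^bsub>V r\<^esub> (\<phi> r (S y))\<^sup>\<star>\<^bsub>V r\<^esub> \<otimes>\<^bsub>V r\<^esub> \<phi> r (S y))"
          by (rule iv(3)[OF r]) (use XY J in auto)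
        also have "\<dots> = (\<Oplus>\<^bsub>V r\<^esub>j\<in>?J. of_int (matrix_prod A X Y j) \<odot>\<^bsub>V r\<^esub> (\<phi> r (S j) \<otimes>\<^bsub>V r\<^esub> (\<phi> r (S j))\<^sup>\<star>\<^bsub>V r\<^esub>))"
          using f[OF r] XY by blast
        also have "\<dots> = \<phi> r ?r"
          by (rule iv(4)[OF r, symmetric]) (use XY J in auto)
        finally show "\<phi> r ?l = \<phi> r ?r" .
      qed
    qed
  qed
qed

lemma hom_restrict:
  assumes "\<phi> \<in> unital_cstar_hom P V" "D \<subseteq> carrier P"
  shows "\<phi> \<in> unital_cstar_hom (P\<lparr>carrier := D\<rparr>) V"
  using assms unfolding unital_cstar_hom_def ring_hom_def by (auto simp: subset_iff)

section \<open>Existence of the universal algebra\<close>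

lemma (in pre_cstar_algebra) partial_isometry_norm:
  assumes "partial_isometry B v"
  shows "cnorm B v \<le> 1"
proof -
  have v: "v \<in> carrier B" and e: "v \<otimes> v\<^sup>\<star> \<otimes> v = v" using assms by (auto simp: partial_isometry_def)
  let ?p = "v\<^sup>\<star> \<otimes> v"
  have p: "?p \<in> carrier B" using v by (simp add: m_closed star_closed)
  have sa: "?p\<^sup>\<star> = ?p" using v by (simp add: star_mult star_closed star_star)
  have pp: "?p \<otimes> ?p = ?p" using e v by (metis m_assoc m_closed star_closed)
  have "cnorm B ?p = (cnorm B ?p)\<^sup>2" using cnorm_star_mult[OF p] sa pp by simp
  then have "cnorm B ?p = 0 \<or> cnorm B ?p = 1" by (simp add: power2_eq_square)
  then have "(cnorm B v)\<^sup>2 \<le> 1\<^sup>2" using cnorm_star_mult[OF v] by auto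
  then show ?thesis by (rule power2_le_imp_le) simp
qed

definition zero_cstar :: "'a \<Rightarrow> 'a cstar" where
  "zero_cstar z = \<lparr>carrier = {z}, mult = (\<lambda>_ _. z), one = z, zero = z, add = (\<lambda>_ _. z),
     smult = (\<lambda>_ _. z), star = (\<lambda>_. z), cnorm = (\<lambda>_. 0)\<rparr>"

lemma zero_cstar: "unital_cstar_algebra (zero_cstar z)"
proof -
  have "abelian_group (zero_cstar z)" by (rule abelian_groupI) (auto simp: zero_cstar_def)
  then interpret abelian_group "zero_cstar z" .
  interpret pre_cstar_algebra "zero_cstar z" by unfold_locales (auto simp: zero_cstar_def)
  interpret cstar_algebra "zero_cstar z"
    by (rule cstar_algebraI) (auto simp: zero_cstar_def cdist_def)
  show ?thesis by unfold_locales (auto simp: zero_cstar_def)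
qed

lemma zero_cstar_family: "exel_laca_family I A (zero_cstar z) (\<lambda>_. z)"
proof -
  interpret unital_cstar_algebra "zero_cstar z" by (rule zero_cstar)
  have c: "x \<in> carrier (zero_cstar z) \<longleftrightarrow> x = z" for x by (simp add: zero_cstar_def)
  have eq: "x = y" if "x \<in> carrier (zero_cstar z)" "y \<in> carrier (zero_cstar z)" for x y
    using that by (simp add: c)
  have zc: "z \<in> carrier (zero_cstar z)" by (simp add: c)
  have Q: "z\<^sup>\<star>\<^bsub>zero_cstar z\<^esub> \<otimes>\<^bsub>zero_cstar z\<^esub> z \<in> carrier (zero_cstar z)"
    by (simp add: zero_cstar_def)
  show ?thesis
    unfolding exel_laca_family_def Let_def
  proof (intro conjI ballI allI impI)
    show "partial_isometry (zero_cstar z) z" by (simp add: partial_isometry_def zero_cstar_def)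
  qed (rule eq; use Q zc in \<open>auto intro!: finprod_commuting finsum_closed m_closed smult_closed star_closed\<close>)+
qed

lemma (in cstar_algebra) sub_of_sub:
  assumes D: "cstar_subalgebra B D" and E: "cstar_subalgebra (B\<lparr>carrier := D\<rparr>) E"
  shows "cstar_subalgebra B E"
proof -
  interpret A: cstar_algebra "B\<lparr>carrier := D\<rparr>" by (rule sub_cstar_algebra[OF D])
  have DB: "D \<subseteq> carrier B" "closedin (cstar_topology B) D" using D by (auto simp: cstar_subalgebra_def)
  have ED: "E \<subseteq> D" "closedin (cstar_topology (B\<lparr>carrier := D\<rparr>)) E" using E by (auto simp: cstar_subalgebra_def)
  have "closedin (cstar_topology B) E"
    unfolding closedin_cstar_iff
  proof (intro conjI allI impI)
    show "E \<subseteq> carrier B" using DB ED by blast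
    fix \<sigma> :: "nat \<Rightarrow> 'a" and x
    assume a: "range \<sigma> \<subseteq> E \<and> x \<in> carrier B \<and> (\<forall>e>0. \<exists>N. \<forall>n\<ge>N. cdist B (\<sigma> n) x < e)"
    then have "range \<sigma> \<subseteq> D" using ED by blast
    then have xD: "x \<in> D"
      using DB(2)[unfolded closedin_cstar_iff, THEN conjunct2, rule_format, of \<sigma> x] a by simp
    have "cdist (B\<lparr>carrier := D\<rparr>) (\<sigma> n) x = cdist B (\<sigma> n) x" for n
      by (rule sub_cdist[OF D _ xD]) (use \<open>range \<sigma> \<subseteq> D\<close> in auto)
    then show "x \<in> E"
      using ED(2)[unfolded A.closedin_cstar_iff, THEN conjunct2, rule_format, of \<sigma> x] a xD by simp
  qed
  then show ?thesis using E DB ED unfolding cstar_subalgebra_def by auto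
qed

lemma (in cstar_algebra) generated_sub:
  assumes "X \<subseteq> carrier B"
  shows "cstar_generated (B\<lparr>carrier := cstar_generated B X\<rparr>) X = cstar_generated B X"
proof -
  let ?D = "cstar_generated B X"
  have D: "cstar_subalgebra B ?D" by (rule cstar_subalgebra_generated[OF assms])
  interpret A: cstar_algebra "B\<lparr>carrier := ?D\<rparr>" by (rule sub_cstar_algebra[OF D])
  have X: "X \<subseteq> ?D" unfolding cstar_generated_def by (rule hull_subset)
  let ?E = "cstar_generated (B\<lparr>carrier := ?D\<rparr>) X"
  have E: "cstar_subalgebra (B\<lparr>carrier := ?D\<rparr>) ?E"
    by (rule A.cstar_subalgebra_generated) (use X in simp)
  have "X \<subseteq> ?E" unfolding cstar_generated_def by (rule hull_subset)
  then have "?D \<subseteq> ?E"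
    using sub_of_sub[OF D E] unfolding cstar_generated_def[of B] by (intro hull_minimal)
  moreover have "?E \<subseteq> ?D" using E by (simp add: cstar_subalgebra_def)
  ultimately show ?thesis by blast
qed

theorem universal_exel_laca_exists:
  fixes A :: "'i \<Rightarrow> 'i \<Rightarrow> int"
  shows "\<exists>(U :: (test_elem cstar \<times> ('i \<Rightarrow> test_elem) \<Rightarrow> test_elem) cstar) S. universal_exel_laca I A U S"
proof -
  define R where "R = {(B :: test_elem cstar, T :: 'i \<Rightarrow> test_elem). unital_cstar_algebra B \<and> exel_laca_family I A B T}"
  have "(zero_cstar undefined, \<lambda>_. undefined) \<in> R"
    by (simp add: R_def zero_cstar zero_cstar_family)
  then interpret F: cstar_family R fst
    by (intro cstar_family.intro) (auto simp: R_def)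
  interpret P: unital_cstar_algebra F.P by (rule F.P_unital)
  define S where "S i = (\<lambda>r\<in>R. snd r i)" for i
  have Sat: "S i r = snd r i" if "r \<in> R" for i r using that by (simp add: S_def)
  have pi: "partial_isometry (fst r) (snd r i)" if "r \<in> R" "i \<in> I" for r i
    using that by (auto simp: R_def exel_laca_family_def Let_def)
  have SP: "S i \<in> carrier F.P" if "i \<in> I" for i
    unfolding S_def
    by (rule F.carrierI[of _ 1]; use pi that in \<open>auto simp: partial_isometry_def intro: pre_cstar_algebra.partial_isometry_norm[OF F.pre]\<close>)
  let ?X = "insert \<one>\<^bsub>F.P\<^esub> (S ` I)"
  define D where "D = cstar_generated F.P ?X"
  have X: "?X \<subseteq> carrier F.P" using SP by auto
  have D: "cstar_subalgebra F.P D" unfolding D_def by (rule P.cstar_subalgebra_generated[OF X])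
  have XD: "?X \<subseteq> D" unfolding D_def cstar_generated_def by (rule hull_subset)
  have DP: "D \<subseteq> carrier F.P" using D by (simp add: cstar_subalgebra_def)
  define U where "U = F.P\<lparr>carrier := D\<rparr>"
  have U: "unital_cstar_algebra U" unfolding U_def by (rule P.sub_unital[OF D]) (use XD in auto)
  have hom: "(\<lambda>f. f r) \<in> unital_cstar_hom U (fst r)" if "r \<in> R" for r
    unfolding U_def by (rule hom_restrict[OF F.proj_hom[OF that] DP])
  have "exel_laca_family I A U S"
  proof (rule exel_laca_family_reflect[where R = R and V = fst and \<phi> = "\<lambda>r f. f r"])
    show "x = y" if "x \<in> carrier U" "y \<in> carrier U" "\<And>r. r \<in> R \<Longrightarrow> x r = y r" for x y
      using that DP by (intro F.carrier_ext) (auto simp: U_def)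
    show "exel_laca_family I A (fst r) (\<lambda>i. S i r)" if "r \<in> R" for r
      using that Sat[OF that] by (auto simp: R_def)
  qed (use F.ne U F.unital hom XD in \<open>auto simp: U_def\<close>)
  moreover have "cstar_generated U (insert \<one>\<^bsub>U\<^esub> (S ` I)) = carrier U"
    using P.generated_sub[OF X] by (simp add: U_def D_def)
  moreover have "\<exists>\<phi>\<in>unital_cstar_hom U B. \<forall>i\<in>I. \<phi> (S i) = T i"
    if "unital_cstar_algebra B \<and> exel_laca_family I A B T" for B :: "test_elem cstar" and T
  proof -
    have r: "(B, T) \<in> R" using that by (simp add: R_def)
    show ?thesis
      by (rule bexI[of _ "\<lambda>f. f (B, T)"]) (use hom[OF r] Sat[OF r] in auto)
  qed
  ultimately show ?thesis using U unfolding universal_exel_laca_def by blast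
qed

section \<open>The universal property on arbitrary types\<close>

datatype cterm = TGen nat | TAdd cterm cterm | TMul cterm cterm | TScl nat cterm | TAdj cterm

instance cterm :: countable by countable_datatype

primrec cterm_val :: "('a, 'm) cstar_scheme \<Rightarrow> (nat \<Rightarrow> 'a) \<Rightarrow> (nat \<Rightarrow> complex) \<Rightarrow> cterm \<Rightarrow> 'a" where
  "cterm_val B g q (TGen n) = g n"
| "cterm_val B g q (TAdd s t) = cterm_val B g q s \<oplus>\<^bsub>B\<^esub> cterm_val B g q t"
| "cterm_val B g q (TMul s t) = cterm_val B g q s \<otimes>\<^bsub>B\<^esub> cterm_val B g q t"
| "cterm_val B g q (TScl n t) = q n \<odot>\<^bsub>B\<^esub> cterm_val B g q t"
| "cterm_val B g q (TAdj t) = (cterm_val B g q t)\<^sup>\<star>\<^bsub>B\<^esub>"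

lemma complex_dense_seq: obtains q :: "nat \<Rightarrow> complex" where "\<And>c e. e > 0 \<Longrightarrow> \<exists>n. cmod (c - q n) < e"
proof -
  define f :: "rat \<times> rat \<Rightarrow> complex" where "f = (\<lambda>(a, b). Complex (of_rat a) (of_rat b))"
  have d: "\<exists>p. cmod (c - f p) < e" if e: "e > 0" for c e
  proof -
    obtain a where a: "Re c - e/2 < of_rat a" "of_rat a < Re c"
      using of_rat_dense[of "Re c - e/2" "Re c"] e by auto
    obtain b where b: "Im c - e/2 < of_rat b" "of_rat b < Im c"
      using of_rat_dense[of "Im c - e/2" "Im c"] e by auto
    have "cmod (c - f (a, b)) \<le> \<bar>Re c - of_rat a\<bar> + \<bar>Im c - of_rat b\<bar>"
      using cmod_le[of "c - f (a, b)"] by (simp add: f_def)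
    also have "\<dots> < e" using a b by auto
    finally show ?thesis by blast
  qed
  show thesis
  proof (rule that[of "\<lambda>n. f (from_nat n)"])
    fix c and e :: real assume "e > 0"
    then obtain p where "cmod (c - f p) < e" using d by blast
    then show "\<exists>n. cmod (c - f (from_nat n)) < e" by (intro exI[of _ "to_nat p"]) simp
  qed
qed

lemma (in cstar_algebra) generated_approx:
  fixes q :: "nat \<Rightarrow> complex"
  assumes g: "range g \<subseteq> carrier B" and q: "\<And>c e. e > 0 \<Longrightarrow> \<exists>n. cmod (c - q n) < e"
    and x: "x \<in> cstar_generated B (range g)" and e: "e > 0"
  shows "\<exists>t. cterm_val B g q t \<in> carrier B \<and> cdist B (cterm_val B g q t) x < e"
proof -
  let ?v = "cterm_val B g q"
  interpret M: Metric_space "carrier B" "cdist B" by (rule cstar_metric)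
  have v: "?v t \<in> carrier B" for t
    by (induction t) (use g in \<open>auto simp: m_closed smult_closed star_closed\<close>)
  define E where "E = {x \<in> carrier B. \<forall>e>0. \<exists>t. cdist B (?v t) x < e}"
  have Eb: "x \<in> carrier B" "e > 0 \<Longrightarrow> \<exists>t. cdist B (?v t) x < e" if "x \<in> E" for x e
    using that by (auto simp: E_def)
  have EI: "x \<in> E" if "x \<in> carrier B" "\<And>e. e > 0 \<Longrightarrow> \<exists>t. cdist B (?v t) x < e" for x
    using that by (simp add: E_def)
  have E_closed: "x \<in> E" if x: "x \<in> carrier B" and l: "\<And>e. e > 0 \<Longrightarrow> \<exists>y\<in>E. cdist B y x < e" for x
  proof (rule EI[OF x])
    fix e :: real assume "e > 0"
    then obtain y where y: "y \<in> E" "cdist B y x < e/2" using l[of "e/2"] by auto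
    obtain t where t: "cdist B (?v t) y < e/2" using Eb(2)[OF y(1), of "e/2"] \<open>e > 0\<close> by auto
    then show "\<exists>t. cdist B (?v t) x < e"
      using M.triangle[OF v Eb(1)[OF y(1)] x, of t] y by (intro exI[of _ t]) simp
  qed
  have gE: "g n \<in> E" for n
  proof (rule EI)
    have c: "g n \<in> carrier B" using g by auto
    then show "g n \<in> carrier B" .
    show "\<exists>t. cdist B (?v t) (g n) < e" if "e > 0" for e
      using that M.zero[OF c c] by (intro exI[of _ "TGen n"]) simp
  qed
  have d_add: "cdist B (a \<oplus> b) (x \<oplus> y) \<le> cdist B a x + cdist B b y"
    if "a \<in> carrier B" "b \<in> carrier B" "x \<in> carrier B" "y \<in> carrier B" for a b x y
  proof -
    have "(a \<oplus> b) \<oplus> (-1) \<odot> (x \<oplus> y) = (a \<oplus> (-1) \<odot> x) \<oplus> (b \<oplus> (-1) \<odot> y)"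
      using that by (simp add: smult_r_distr smult_closed a_ac)
    then show ?thesis using that cnorm_triangle[of "a \<oplus> (-1) \<odot> x" "b \<oplus> (-1) \<odot> y"]
      by (simp add: cdist_eq smult_closed)
  qed
  have d_mulr: "cdist B (a \<otimes> z) (x \<otimes> z) \<le> cdist B a x * cnorm B z"
    if "a \<in> carrier B" "x \<in> carrier B" "z \<in> carrier B" for a x z
    using that cnorm_mult[of "a \<oplus> (-1) \<odot> x" z]
    by (simp add: cdist_eq smult_closed m_closed l_distr smult_mult_left)
  have d_mull: "cdist B (z \<otimes> a) (z \<otimes> x) \<le> cnorm B z * cdist B a x"
    if "a \<in> carrier B" "x \<in> carrier B" "z \<in> carrier B" for a x z
    using that cnorm_mult[of z "a \<oplus> (-1) \<odot> x"]
    by (simp add: cdist_eq smult_closed m_closed r_distr smult_mult_right)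
  have d_star: "cdist B (a\<^sup>\<star>) (x\<^sup>\<star>) = cdist B a x" if "a \<in> carrier B" "x \<in> carrier B" for a x
    using that cnorm_star[of "a \<oplus> (-1) \<odot> x"]
    by (simp add: cdist_eq smult_closed star_closed star_add star_smult)
  have d_sr: "cdist B (c \<odot> a) (c \<odot> x) = cmod c * cdist B a x" if "a \<in> carrier B" "x \<in> carrier B" for a x c
  proof -
    have "(-1) \<odot> (c \<odot> x) = c \<odot> ((-1) \<odot> x)"
      using smult_assoc1[OF that(2), of "-1" c] smult_assoc1[OF that(2), of c "-1"] by simp
    then show ?thesis using that cnorm_smult[of "a \<oplus> (-1) \<odot> x" c]
      by (simp add: cdist_eq smult_closed smult_r_distr)
  qed
  have d_sl: "cdist B (c \<odot> x) (d \<odot> x) = cmod (c - d) * cnorm B x" if "x \<in> carrier B" for x c d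
  proof -
    have "c \<odot> x \<oplus> (-1) \<odot> (d \<odot> x) = (c - d) \<odot> x"
      using smult_assoc1[OF that, of "-1" d] smult_l_distr[OF that, of c "-d"] by simp
    then show ?thesis using that by (simp add: cdist_eq smult_closed cnorm_smult)
  qed
  have nb: "\<exists>d>0. d * cnorm B y < e" if "y \<in> carrier B" "e > 0" for y e
  proof (intro exI conjI)
    have n: "cnorm B y + 1 > 0" using cnorm_nonneg[OF that(1)] by simp
    then show "e / (cnorm B y + 1) > 0" using that by simp
    show "e / (cnorm B y + 1) * cnorm B y < e" using n that cnorm_nonneg[OF that(1)] by (simp add: field_simps)
  qed
  have vq: "q n \<odot> ?v t \<in> E" for n t
    by (rule EI, simp add: v smult_closed, rule exI[of _ "TScl n t"], simp add: M.zero v smult_closed)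
  have vm: "?v s \<otimes> ?v t \<in> E" for s t
    by (rule EI, simp add: v m_closed, rule exI[of _ "TMul s t"], simp add: M.zero v m_closed)
  have vs: "c \<odot> ?v t \<in> E" for c t
  proof (rule E_closed)
    fix e :: real assume "e > 0"
    then obtain d where d: "d > 0" "d * cnorm B (?v t) < e" using nb[OF v] by blast
    obtain n where n: "cmod (c - q n) < d" using q[OF d(1)] by blast
    have "cdist B (q n \<odot> ?v t) (c \<odot> ?v t) \<le> d * cnorm B (?v t)"
      unfolding d_sl[OF v] using n cnorm_nonneg[OF v] by (intro mult_right_mono) (auto simp: norm_minus_commute)
    then show "\<exists>y\<in>E. cdist B y (c \<odot> ?v t) < e" using vq d by (intro bexI[of _ "q n \<odot> ?v t"]) auto
  qed (simp add: v smult_closed)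
  have vmE: "?v s \<otimes> y \<in> E" if y: "y \<in> E" for s y
  proof (rule E_closed)
    fix e :: real assume "e > 0"
    then obtain d where d: "d > 0" "d * cnorm B (?v s) < e" using nb[OF v] by blast
    obtain t where t: "cdist B (?v t) y < d" using Eb(2)[OF y d(1)] by blast
    have "cdist B (?v s \<otimes> ?v t) (?v s \<otimes> y) \<le> cnorm B (?v s) * cdist B (?v t) y"
      by (rule d_mull) (use v Eb y in auto)
    also have "\<dots> \<le> cnorm B (?v s) * d" using t cnorm_nonneg[OF v] by (intro mult_left_mono) auto
    also have "\<dots> < e" using d by (simp add: mult.commute)
    finally show "\<exists>z\<in>E. cdist B z (?v s \<otimes> y) < e" using vm by blast
  qed (use v Eb y m_closed in auto)
  have "cstar_subalgebra B E"
    unfolding cstar_subalgebra_def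
  proof (intro conjI ballI allI)
    show "E \<subseteq> carrier B" by (auto simp: E_def)
    have "0 \<odot> ?v (TGen 0) \<in> E" by (rule vs)
    then show "\<zero> \<in> E" using smult_0_left[OF v[of "TGen 0"]] by simp
    fix x assume x: "x \<in> E"
    show "x\<^sup>\<star> \<in> E"
    proof (rule EI)
      fix e :: real assume "e > 0"
      then obtain t where "cdist B (?v t) x < e" using Eb(2)[OF x] by blast
      then show "\<exists>t. cdist B (?v t) (x\<^sup>\<star>) < e"
        using d_star[OF v Eb(1)[OF x], of t] by (intro exI[of _ "TAdj t"]) simp
    qed (use Eb x star_closed in auto)
    show "c \<odot> x \<in> E" for c
    proof (rule E_closed)
      fix e :: real assume "e > 0"
      have c: "cmod c + 1 > 0" by (simp add: add_nonneg_pos)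
      obtain t where t: "cdist B (?v t) x < e / (cmod c + 1)"
        using Eb(2)[OF x, of "e / (cmod c + 1)"] \<open>e > 0\<close> c by auto
      have "cdist B (c \<odot> ?v t) (c \<odot> x) = cmod c * cdist B (?v t) x" by (rule d_sr[OF v Eb(1)[OF x]])
      also have "\<dots> \<le> (cmod c + 1) * cdist B (?v t) x" by (intro mult_right_mono) auto
      also have "\<dots> < e" using t c by (simp add: field_simps)
      finally show "\<exists>z\<in>E. cdist B z (c \<odot> x) < e" using vs by blast
    qed (use Eb x smult_closed in auto)
    fix y assume y: "y \<in> E"
    show "x \<oplus> y \<in> E"
    proof (rule EI)
      fix e :: real assume "e > 0"
      then obtain s t where "cdist B (?v s) x < e/2" "cdist B (?v t) y < e/2"
        using Eb(2)[OF x, of "e/2"] Eb(2)[OF y, of "e/2"] by auto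
      then show "\<exists>t. cdist B (?v t) (x \<oplus> y) < e"
        using d_add[OF v v Eb(1)[OF x] Eb(1)[OF y], of s t] by (intro exI[of _ "TAdd s t"]) simp
    qed (use Eb x y in auto)
    show "x \<otimes> y \<in> E"
    proof (rule E_closed)
      fix e :: real assume "e > 0"
      then obtain d where d: "d > 0" "d * cnorm B y < e" using nb[OF Eb(1)[OF y]] by blast
      obtain t where t: "cdist B (?v t) x < d" using Eb(2)[OF x d(1)] by blast
      have "cdist B (?v t \<otimes> y) (x \<otimes> y) \<le> cdist B (?v t) x * cnorm B y"
        by (rule d_mulr) (use v Eb x y in auto)
      also have "\<dots> \<le> d * cnorm B y" using t cnorm_nonneg[OF Eb(1)[OF y]] by (intro mult_right_mono) auto
      finally show "\<exists>z\<in>E. cdist B z (x \<otimes> y) < e" using vmE[OF y, of t] d by (intro bexI[of _ "?v t \<otimes> y"]) auto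
    qed (use Eb x y m_closed in auto)
  next
    show "closedin (cstar_topology B) E"
      unfolding closedin_cstar_iff
    proof (intro conjI allI impI)
      show "E \<subseteq> carrier B" by (auto simp: E_def)
      fix \<sigma> :: "nat \<Rightarrow> 'a" and x
      assume a: "range \<sigma> \<subseteq> E \<and> x \<in> carrier B \<and> (\<forall>e>0. \<exists>N. \<forall>n\<ge>N. cdist B (\<sigma> n) x < e)"
      show "x \<in> E"
      proof (rule E_closed)
        fix e :: real assume "e > 0"
        then obtain N where "\<forall>n\<ge>N. cdist B (\<sigma> n) x < e" using a by auto
        then show "\<exists>y\<in>E. cdist B y x < e" using a by (intro bexI[of _ "\<sigma> N"]) auto
      qed (use a in simp)
    qed
  qed
  then have "x \<in> E" using x hull_minimal[of "range g" E "cstar_subalgebra B"] gE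
    unfolding cstar_generated_def by auto
  then show ?thesis using Eb(2)[OF _ e] v by auto
qed

lemma (in cstar_algebra) generated_embeds:
  assumes "countable X" "X \<subseteq> carrier B" "X \<noteq> {}"
  shows "\<exists>f :: 'a \<Rightarrow> test_elem. inj_on f (cstar_generated B X)"
proof -
  interpret M: Metric_space "carrier B" "cdist B" by (rule cstar_metric)
  define g where "g = from_nat_into X"
  have g: "range g = X" unfolding g_def using assms by (intro range_from_nat_into)
  obtain q :: "nat \<Rightarrow> complex" where q: "\<And>c e. e > 0 \<Longrightarrow> \<exists>n. cmod (c - q n) < e"
    using complex_dense_seq by blast
  let ?v = "cterm_val B g q" and ?D = "cstar_generated B X"
  have "\<exists>t. ?v t \<in> carrier B \<and> cdist B (?v t) x < inverse (real (Suc n))" if "x \<in> ?D" for x n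
    by (rule generated_approx[OF _ q]) (use g assms that in auto)
  then obtain t where t: "\<And>x n. x \<in> ?D \<Longrightarrow> ?v (t x n) \<in> carrier B \<and> cdist B (?v (t x n)) x < inverse (real (Suc n))"
    by metis
  define f :: "'a \<Rightarrow> test_elem" where "f x = (\<lambda>_ n. of_nat (to_nat (t x n)))" for x
  have DB: "?D \<subseteq> carrier B" using cstar_subalgebra_generated[OF assms(2)] by (simp add: cstar_subalgebra_def)
  have "x = y" if "x \<in> ?D" "y \<in> ?D" "f x = f y" for x y
  proof -
    have "of_nat (to_nat (t x n)) = (of_nat (to_nat (t y n)) :: complex)" for n
      using that(3) unfolding f_def by meson
    then have tt: "t x n = t y n" for n by simp
    have xy: "x \<in> carrier B" "y \<in> carrier B" using that DB by auto
    have "cdist B x y \<le> 0 + e" if "e > 0" for e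
    proof -
      obtain n where n: "inverse (real (Suc n)) < e/2" using reals_Archimedean[of "e/2"] \<open>e > 0\<close> by auto
      have "cdist B x y \<le> cdist B x (?v (t x n)) + cdist B (?v (t x n)) y"
        using t \<open>x \<in> ?D\<close> xy by (intro M.triangle) auto
      also have "\<dots> \<le> e"
        using t[OF \<open>x \<in> ?D\<close>, of n] t[OF \<open>y \<in> ?D\<close>, of n] tt[of n] n by (simp add: M.commute)
      finally show ?thesis by simp
    qed
    then have "cdist B x y \<le> 0" by (rule field_le_epsilon)
    then show ?thesis using M.zero[OF xy] M.nonneg[of x y] by linarith
  qed
  then show ?thesis by (intro exI[of _ f] inj_onI)
qed

definition transport :: "('a \<Rightarrow> 'b) \<Rightarrow> ('a, 'm) cstar_scheme \<Rightarrow> 'b cstar" where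
  "transport f B = (let g = inv_into (carrier B) f in \<lparr>
     carrier = f ` carrier B,
     mult = (\<lambda>x y. f (g x \<otimes>\<^bsub>B\<^esub> g y)), one = f \<one>\<^bsub>B\<^esub>, zero = f \<zero>\<^bsub>B\<^esub>,
     add = (\<lambda>x y. f (g x \<oplus>\<^bsub>B\<^esub> g y)), smult = (\<lambda>c x. f (c \<odot>\<^bsub>B\<^esub> g x)),
     star = (\<lambda>x. f ((g x)\<^sup>\<star>\<^bsub>B\<^esub>)), cnorm = (\<lambda>x. cnorm B (g x))\<rparr>)"

lemma (in unital_cstar_algebra) transport:
  assumes inj: "inj_on f (carrier B)"
  shows "unital_cstar_algebra (transport f B)"
    and "inv_into (carrier B) f \<in> unital_cstar_hom (transport f B) B"
proof -
  let ?g = "inv_into (carrier B) f" and ?C = "transport f B"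
  have gf: "x \<in> carrier B \<Longrightarrow> ?g (f x) = x" for x using inj by simp
  have fg: "y \<in> carrier ?C \<Longrightarrow> f (?g y) = y" and gc: "y \<in> carrier ?C \<Longrightarrow> ?g y \<in> carrier B" for y
    by (auto simp: transport_def Let_def f_inv_into_f inv_into_into)
  have fc: "x \<in> carrier B \<Longrightarrow> f x \<in> carrier ?C" for x by (simp add: transport_def Let_def)
  have op: "x \<otimes>\<^bsub>?C\<^esub> y = f (?g x \<otimes> ?g y)" "\<one>\<^bsub>?C\<^esub> = f \<one>" "\<zero>\<^bsub>?C\<^esub> = f \<zero>" "x \<oplus>\<^bsub>?C\<^esub> y = f (?g x \<oplus> ?g y)"
    "c \<odot>\<^bsub>?C\<^esub> x = f (c \<odot> ?g x)" "x\<^sup>\<star>\<^bsub>?C\<^esub> = f ((?g x)\<^sup>\<star>)" "cnorm ?C x = cnorm B (?g x)" for x y c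
    by (simp_all add: transport_def Let_def)
  have f_eq: "x \<in> carrier B \<Longrightarrow> y \<in> carrier B \<Longrightarrow> f x = f y \<longleftrightarrow> x = y" for x y
    using inj by (auto dest: inj_onD)
  note cl = m_closed smult_closed star_closed
  have "abelian_group ?C"
  proof (rule abelian_groupI)
    fix x assume x: "x \<in> carrier ?C"
    show "\<exists>y\<in>carrier ?C. y \<oplus>\<^bsub>?C\<^esub> x = \<zero>\<^bsub>?C\<^esub>"
      by (rule bexI[of _ "f (\<ominus> ?g x)"]) (simp_all add: op gf gc x fc l_neg)
    show "\<zero>\<^bsub>?C\<^esub> \<oplus>\<^bsub>?C\<^esub> x = x" by (simp add: op gf gc x fg)
    fix y assume y: "y \<in> carrier ?C"
    show "x \<oplus>\<^bsub>?C\<^esub> y \<in> carrier ?C" by (simp add: op fc gc x y)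
    show "x \<oplus>\<^bsub>?C\<^esub> y = y \<oplus>\<^bsub>?C\<^esub> x" using a_comm[OF gc[OF x] gc[OF y]] by (simp add: op)
    fix z assume z: "z \<in> carrier ?C"
    show "x \<oplus>\<^bsub>?C\<^esub> y \<oplus>\<^bsub>?C\<^esub> z = x \<oplus>\<^bsub>?C\<^esub> (y \<oplus>\<^bsub>?C\<^esub> z)" by (simp add: op gf gc x y z a_assoc)
  qed (simp add: op fc)
  then interpret C: abelian_group ?C .
  interpret C: pre_cstar_algebra ?C
    by unfold_locales
      (simp_all add: op gf gc fc fg cl m_assoc l_distr r_distr smult_l_distr smult_r_distr smult_assoc1 smult_one
        smult_mult_left smult_mult_right star_star star_add star_mult star_smult cnorm_nonneg
        cnorm_triangle cnorm_smult cnorm_mult cnorm_star_mult,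
       metis cnorm_eq_0_iff fg gc gf zero_closed)
  have cd: "cdist ?C x y = cdist B (?g x) (?g y)" if "x \<in> carrier ?C" "y \<in> carrier ?C" for x y
    using that by (simp add: cdist_eq C.cdist_eq gc op gf cl)
  have cst: "cstar_algebra ?C"
  proof (rule C.cstar_algebraI)
    fix \<sigma> :: "nat \<Rightarrow> 'b"
    assume "range \<sigma> \<subseteq> carrier ?C" and cau: "\<forall>e>0. \<exists>N. \<forall>n\<ge>N. \<forall>m\<ge>N. cdist ?C (\<sigma> n) (\<sigma> m) < e"
    then have s: "\<sigma> n \<in> carrier ?C" for n by auto
    have 1: "range (\<lambda>n. ?g (\<sigma> n)) \<subseteq> carrier B" using gc s by auto
    have 2: "\<forall>e>0. \<exists>N. \<forall>n\<ge>N. \<forall>m\<ge>N. cdist B (?g (\<sigma> n)) (?g (\<sigma> m)) < e"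
      using cau by (simp add: cd s)
    obtain x where x: "x \<in> carrier B" "\<And>e. e > 0 \<Longrightarrow> \<exists>N. \<forall>n\<ge>N. cdist B (?g (\<sigma> n)) x < e"
      by (rule cauchy_limit[OF 1 2]) simp
    show "\<exists>x\<in>carrier ?C. \<forall>e>0. \<exists>N. \<forall>n\<ge>N. cdist ?C (\<sigma> n) x < e"
      using x(2) by (intro bexI[OF _ fc[OF x(1)]]) (simp add: cd s fc x(1) gf)
  qed
  have "monoid ?C" by (rule monoidI) (simp_all add: op gf gc fc fg m_assoc)
  then show "unital_cstar_algebra ?C"
    by (intro unital_cstar_algebra.intro cst ringI C.abelian_group_axioms) (auto simp: C.l_distr C.r_distr)
  show "?g \<in> unital_cstar_hom ?C B"
    unfolding unital_cstar_hom_def ring_hom_def by (auto simp: gc op gf cl)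
qed

lemma exel_laca_family_cong:
  fixes B (structure)
  assumes B: "unital_cstar_algebra B" and e: "\<And>i. i \<in> I \<Longrightarrow> S i = T i" and T: "exel_laca_family I A B T"
  shows "exel_laca_family I A B S"
proof -
  interpret unital_cstar_algebra B by (rule B)
  have TB: "T i \<in> carrier B" if "i \<in> I" for i
    using T that by (auto simp: exel_laca_family_def Let_def partial_isometry_def)
  note t = T[unfolded exel_laca_family_def Let_def]
  show ?thesis
    unfolding exel_laca_family_def Let_def
  proof (intro conjI allI impI)
    fix X Y assume XY: "finite X \<and> X \<subseteq> I \<and> finite Y \<and> Y \<subseteq> I \<and> finite {j \<in> I. matrix_prod A X Y j \<noteq> 0}"
    have "(\<Otimes>x\<in>X. (S x)\<^sup>\<star> \<otimes> S x) = (\<Otimes>x\<in>X. (T x)\<^sup>\<star> \<otimes> T x)"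
      by (rule finprod_cong_local) (use XY e in auto)
    moreover have "(\<Otimes>y\<in>Y. \<one> \<ominus> (S y)\<^sup>\<star> \<otimes> S y) = (\<Otimes>y\<in>Y. \<one> \<ominus> (T y)\<^sup>\<star> \<otimes> T y)"
      by (rule finprod_cong_local) (use XY e in auto)
    moreover have "(\<Oplus>j\<in>{j \<in> I. matrix_prod A X Y j \<noteq> 0}. of_int (matrix_prod A X Y j) \<odot> (S j \<otimes> (S j)\<^sup>\<star>))
      = (\<Oplus>j\<in>{j \<in> I. matrix_prod A X Y j \<noteq> 0}. of_int (matrix_prod A X Y j) \<odot> (T j \<otimes> (T j)\<^sup>\<star>))"
      by (rule finsum_cong') (use e TB in \<open>auto simp: smult_closed star_closed\<close>)
    ultimately show "(\<Otimes>x\<in>X. (S x)\<^sup>\<star> \<otimes> S x) \<otimes> (\<Otimes>y\<in>Y. \<one> \<ominus> (S y)\<^sup>\<star> \<otimes> S y) =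
      (\<Oplus>j\<in>{j \<in> I. matrix_prod A X Y j \<noteq> 0}. of_int (matrix_prod A X Y j) \<odot> (S j \<otimes> (S j)\<^sup>\<star>))"
      using t XY by simp
  qed (use t e in simp_all)
qed

theorem universal_exel_laca_hom:
  fixes B :: "('b, 'n) cstar_scheme"
  assumes I: "countable I" and univ: "universal_exel_laca I A U S"
    and B: "unital_cstar_algebra B" and T: "exel_laca_family I A B T"
  shows "\<exists>\<phi>\<in>unital_cstar_hom U B. \<forall>i\<in>I. \<phi> (S i) = T i"
proof -
  interpret B: unital_cstar_algebra B by (rule B)
  have TB: "T i \<in> carrier B" if "i \<in> I" for i
    using T that by (auto simp: exel_laca_family_def Let_def partial_isometry_def)
  let ?X = "insert \<one>\<^bsub>B\<^esub> (T ` I)"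
  define D where "D = cstar_generated B ?X"
  have X: "?X \<subseteq> carrier B" using TB by auto
  have D: "cstar_subalgebra B D" unfolding D_def by (rule B.cstar_subalgebra_generated[OF X])
  have XD: "?X \<subseteq> D" unfolding D_def cstar_generated_def by (rule hull_subset)
  have DB: "D \<subseteq> carrier B" using D by (simp add: cstar_subalgebra_def)
  let ?C = "B\<lparr>carrier := D\<rparr>"
  have C: "unital_cstar_algebra ?C" by (rule B.sub_unital[OF D]) (use XD in auto)
  interpret C: unital_cstar_algebra ?C by (rule C)
  have idB: "(\<lambda>x. x) \<in> unital_cstar_hom ?C B"
    by (rule hom_restrict[OF _ DB]) (auto simp: unital_cstar_hom_def ring_hom_def)
  obtain f :: "'b \<Rightarrow> test_elem" where f: "inj_on f D"
    using B.generated_embeds[of ?X] X I unfolding D_def by auto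
  then have f': "inj_on f (carrier ?C)" by simp
  let ?V = "transport f ?C" and ?g = "inv_into D f"
  have V: "unital_cstar_algebra ?V" by (rule C.transport(1)[OF f'])
  have g: "?g \<in> unital_cstar_hom ?V ?C" using C.transport(2)[OF f'] by simp
  then have gB: "?g \<in> unital_cstar_hom ?V B"
    using DB unfolding unital_cstar_hom_def ring_hom_def by auto
  have cV: "carrier ?V = f ` D" by (simp add: transport_def Let_def)
  have gf: "?g (f (T i)) = T i" if "i \<in> I" for i using f XD that by auto
  have "exel_laca_family I A B (\<lambda>i. ?g (f (T i)))"
    by (rule exel_laca_family_cong[OF B _ T]) (simp add: gf)
  then have "exel_laca_family I A ?V (\<lambda>i. f (T i))"
  proof (intro exel_laca_family_reflect[where R = "{()}" and V = "\<lambda>_. B" and \<phi> = "\<lambda>_. ?g"])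
    show "f (T i) \<in> carrier ?V" if "i \<in> I" for i using XD that by (auto simp: cV)
    show "x = y" if "x \<in> carrier ?V" "y \<in> carrier ?V" "\<And>r. r \<in> {()} \<Longrightarrow> ?g x = ?g y" for x y
      using that by (auto simp: cV f_inv_into_f intro: inv_into_injective)
  qed (use V B gB in auto)
  then obtain \<phi> where \<phi>: "\<phi> \<in> unital_cstar_hom U ?V" "\<And>i. i \<in> I \<Longrightarrow> \<phi> (S i) = f (T i)"
    using univ V unfolding universal_exel_laca_def by blast
  have "?g \<circ> \<phi> \<in> unital_cstar_hom U B"
    using hom_at[OF \<phi>(1)] hom_at[OF gB] unfolding unital_cstar_hom_def ring_hom_def by auto
  then show ?thesis using \<phi>(2) gf by (intro bexI[of _ "?g \<circ> \<phi>"]) auto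
qed

end

theory Submission
  imports Defs "HOL-Analysis.Analysis"
begin

text \<open>
  If the graph has no cycles, then finitely many of the \<open>S i\<close> generate a finite-dimensional *-algebra: up
  to zero, every word in them and their adjoints has the form \<open>S\<^sub>\<alpha> Q S\<^sub>\<beta>\<^sup>\<star>\<close> with paths \<open>\<alpha>\<close>, \<open>\<beta>\<close> in a finite
  acyclic graph and \<open>Q\<close> a product of some of the projections \<open>S\<^sub>i\<^sup>\<star> S\<^sub>i\<close>.

  For a cycle \<open>\<alpha>\<close>, represent the algebra on \<open>\<ell>\<^sup>2\<close> of the infinite paths that are tail equivalent to
  \<open>\<alpha>\<alpha>\<alpha>\<dots>\<close>, with a lag recorded. There \<open>S\<^sub>\<alpha>\<close> acts on part of the basis as a bilateral shift, and cutting the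
  tree of paths at one edge gives a projection \<open>P\<close> that commutes with the algebra up to compact operators.
  The compression by \<open>P\<close> of the isometry \<open>V = S\<^sub>\<alpha> + 1 - S\<^sub>\<alpha>\<^sup>\<star> S\<^sub>\<alpha>\<close> is then a non-surjective isometry. In an AF algebra
  \<open>V\<close> is close to an element \<open>y\<close> that is algebraic over the complex numbers; moving \<open>\<lambda>\<close> from infinity to \<open>0\<close>
  while avoiding the finitely many eigenvalues shows that the compression of \<open>y - \<lambda>\<close> stays an invertible
  plus a compact operator, so the compression of \<open>V\<close> would be invertible by the Fredholm alternative.
\<close>

section \<open>The Hilbert space \<open>\<ell>\<^sup>2\<close>\<close>

text \<open>Cycles obstruct finite-dimensional approximation in two ways: with an exit, a cycle
  yields a projection equivalent to a proper subprojection; without one, it yields unitaries of a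
  circle algebra. The index argument covers both at once, since it only needs that \<open>V\<close>
  is an isometry and that the adjoint of its compression kills a vector. The lag makes the cut
  possible: without it, the tails of the periodic path return to that path after one turn, and a set
  of paths closed under prepending vertices contains all of them or none. The algebra generated by
  the \<open>S i\<close> need not contain the unit, so the word of the cycle and its initial
  projection are approximated separately, and the unit is added afterwards. All that is kept of
  finite dimension is a polynomial vanishing at \<open>y\<close>. This polynomial may have the root
  0, the very point to be reached by the deformation; but \<open>y\<close> is close to an isometry
  and so left invertible, and the offending power of \<open>y\<close> can be cancelled.\<close>

typedef ell2 = "{f :: nat \<Rightarrow> complex. summable (\<lambda>n. (norm (f n))\<^sup>2)}"
  by (rule exI[of _ "\<lambda>_. 0"]) simp

setup_lifting type_definition_ell2

lift_definition coord :: "ell2 \<Rightarrow> nat \<Rightarrow> complex" is "\<lambda>f. f" .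

lemma ell2_eqI: "(\<And>n. coord x n = coord y n) \<Longrightarrow> x = y"
  by transfer auto

lemma summable_coord: "summable (\<lambda>n. (norm (coord x n))\<^sup>2)"
  by transfer simp

lift_definition delta :: "nat \<Rightarrow> ell2" is "\<lambda>m n. if n = m then 1 else 0"
proof -
  fix m :: nat
  show "summable (\<lambda>n. (norm (if n = m then 1 else 0 :: complex))\<^sup>2)"
    by (rule summable_finite[of "{m}"]) auto
qed

lemma coord_delta: "coord (delta m) n = (if n = m then 1 else 0)"
  by transfer simp

lemma square_summable_add:
  assumes "summable (\<lambda>n. (norm (f n))\<^sup>2)" "summable (\<lambda>n. (norm (g n))\<^sup>2)"
  shows "summable (\<lambda>n. (norm (f n + g n :: complex))\<^sup>2)"
proof (rule summable_comparison_test_ev)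
  show "summable (\<lambda>n. 2 * (norm (f n))\<^sup>2 + 2 * (norm (g n))\<^sup>2)"
    using assms by (intro summable_add summable_mult)
  show "\<forall>\<^sub>F n in sequentially. norm ((norm (f n + g n))\<^sup>2) \<le> 2 * (norm (f n))\<^sup>2 + 2 * (norm (g n))\<^sup>2"
  proof (intro always_eventually allI)
    fix n
    have "(norm (f n + g n))\<^sup>2 \<le> (norm (f n) + norm (g n))\<^sup>2"
      by (intro power_mono norm_triangle_ineq) simp
    also have "\<dots> \<le> 2 * (norm (f n))\<^sup>2 + 2 * (norm (g n))\<^sup>2"
      using sum_squares_bound[of "norm (f n)" "norm (g n)"] by (simp add: power2_sum)
    finally show "norm ((norm (f n + g n))\<^sup>2) \<le> 2 * (norm (f n))\<^sup>2 + 2 * (norm (g n))\<^sup>2" by simp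
  qed
qed

lemma square_summable_scaleR:
  assumes "summable (\<lambda>n. (norm (f n))\<^sup>2)"
  shows "summable (\<lambda>n. (norm (r *\<^sub>R f n :: complex))\<^sup>2)"
  using summable_mult[OF assms, of "r\<^sup>2"] by (simp add: power_mult_distrib)

text \<open>The class records only a real inner product, here the real part of the complex one, with
  the same norm. The complex structure returns as the map \<open>imul\<close>, and complex linearity
  as commuting with it.\<close>

instantiation ell2 :: real_inner
begin

lift_definition zero_ell2 :: ell2 is "\<lambda>_. 0" by simp
lift_definition plus_ell2 :: "ell2 \<Rightarrow> ell2 \<Rightarrow> ell2" is "\<lambda>f g n. f n + g n"
  by (rule square_summable_add)
lift_definition uminus_ell2 :: "ell2 \<Rightarrow> ell2" is "\<lambda>f n. - f n" by simp
lift_definition minus_ell2 :: "ell2 \<Rightarrow> ell2 \<Rightarrow> ell2" is "\<lambda>f g n. f n - g n"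
  using square_summable_add[of _ "\<lambda>n. - _ n"] by auto
lift_definition scaleR_ell2 :: "real \<Rightarrow> ell2 \<Rightarrow> ell2" is "\<lambda>r f n. r *\<^sub>R f n"
  by (rule square_summable_scaleR)
definition inner_ell2 :: "ell2 \<Rightarrow> ell2 \<Rightarrow> real" where
  "inner_ell2 x y = (\<Sum>n. coord x n \<bullet> coord y n)"
definition norm_ell2 :: "ell2 \<Rightarrow> real" where "norm_ell2 x = sqrt (x \<bullet> x)"
definition dist_ell2 :: "ell2 \<Rightarrow> ell2 \<Rightarrow> real" where "dist_ell2 x y = norm (x - y)"
definition sgn_ell2 :: "ell2 \<Rightarrow> ell2" where "sgn_ell2 x = inverse (norm x) *\<^sub>R x"
definition uniformity_ell2 :: "(ell2 \<times> ell2) filter"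
  where "uniformity_ell2 = (INF e\<in>{0<..}. principal {(x, y). dist x y < e})"
definition open_ell2 :: "ell2 set \<Rightarrow> bool"
  where "open_ell2 U = (\<forall>x\<in>U. \<forall>\<^sub>F (x', y) in uniformity. x' = x \<longrightarrow> y \<in> U)"

lemma coord_simps: "coord 0 n = 0" "coord (x + y) n = coord x n + coord y n"
  "coord (- x) n = - coord x n" "coord (x - y) n = coord x n - coord y n"
  "coord (r *\<^sub>R x) n = r *\<^sub>R coord x n"
  by (transfer, simp)+

lemma summable_norm_inner_coord: "summable (\<lambda>n. norm (coord x n \<bullet> coord y n))"
proof (rule summable_comparison_test_ev)
  show "summable (\<lambda>n. (norm (coord x n))\<^sup>2 + (norm (coord y n))\<^sup>2)"
    by (intro summable_add summable_coord)
  show "\<forall>\<^sub>F n in sequentially. norm (norm (coord x n \<bullet> coord y n)) \<le> (norm (coord x n))\<^sup>2 + (norm (coord y n))\<^sup>2"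
  proof (intro always_eventually allI)
    fix n
    have "norm (coord x n \<bullet> coord y n) \<le> norm (coord x n) * norm (coord y n)"
      using Cauchy_Schwarz_ineq2 by simp
    also have "\<dots> \<le> (norm (coord x n))\<^sup>2 + (norm (coord y n))\<^sup>2"
      using sum_squares_bound[of "norm (coord x n)" "norm (coord y n)"]
        mult_nonneg_nonneg[OF norm_ge_zero[of "coord x n"] norm_ge_zero[of "coord y n"]] by linarith
    finally show "norm (norm (coord x n \<bullet> coord y n)) \<le> (norm (coord x n))\<^sup>2 + (norm (coord y n))\<^sup>2" by simp
  qed
qed

lemmas summable_inner_coord = summable_norm_cancel[OF summable_norm_inner_coord]

instance
proof
  fix x y z :: ell2 and r s :: real
  show "x - y = x + - y" "x + y + z = x + (y + z)" "x + y = y + x" "0 + x = x" "- x + x = 0"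
    "r *\<^sub>R (x + y) = r *\<^sub>R x + r *\<^sub>R y" "(r + s) *\<^sub>R x = r *\<^sub>R x + s *\<^sub>R x"
    "r *\<^sub>R s *\<^sub>R x = (r * s) *\<^sub>R x" "1 *\<^sub>R x = x"
    by (rule ell2_eqI; simp add: coord_simps algebra_simps)+
  show "dist x y = norm (x - y)" "sgn x = inverse (norm x) *\<^sub>R x" "norm x = sqrt (x \<bullet> x)"
    by (simp_all add: dist_ell2_def sgn_ell2_def norm_ell2_def)
  show "uniformity = (INF e\<in>{0<..}. principal {(x, y :: ell2). dist x y < e})"
    by (rule uniformity_ell2_def)
  show "open U \<longleftrightarrow> (\<forall>x\<in>U. \<forall>\<^sub>F (x', y) in uniformity. x' = x \<longrightarrow> y \<in> U)" for U :: "ell2 set"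
    by (rule open_ell2_def)
  show "x \<bullet> y = y \<bullet> x" by (simp add: inner_ell2_def inner_commute)
  show "(x + y) \<bullet> z = x \<bullet> z + y \<bullet> z"
    by (simp add: inner_ell2_def coord_simps inner_add_left suminf_add[OF summable_inner_coord summable_inner_coord])
  show "r *\<^sub>R x \<bullet> y = r * (x \<bullet> y)"
    by (simp add: inner_ell2_def coord_simps suminf_mult[OF summable_inner_coord])
  show "0 \<le> x \<bullet> x" unfolding inner_ell2_def by (intro suminf_nonneg summable_inner_coord) simp
  have "x \<bullet> x = 0 \<longleftrightarrow> (\<forall>n. coord x n = 0)"
    unfolding inner_ell2_def by (subst suminf_eq_zero_iff[OF summable_inner_coord]) auto
  then show "x \<bullet> x = 0 \<longleftrightarrow> x = 0" by (auto intro: ell2_eqI simp: coord_simps)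
qed

end

lemma norm_ell2_power2: "(norm x)\<^sup>2 = (\<Sum>n. (norm (coord x n))\<^sup>2)"
  by (simp add: power2_norm_eq_inner inner_ell2_def)

lemma norm_coord_le: "norm (coord x n) \<le> norm x"
proof -
  have "(\<Sum>k\<in>{n}. (norm (coord x k))\<^sup>2) \<le> (\<Sum>k. (norm (coord x k))\<^sup>2)"
    by (rule sum_le_suminf[OF summable_coord]) auto
  then have "(norm (coord x n))\<^sup>2 \<le> (norm x)\<^sup>2" by (simp add: norm_ell2_power2)
  then show ?thesis by (rule power2_le_imp_le) simp
qed

instance ell2 :: banach
proof
  fix X :: "nat \<Rightarrow> ell2" assume X: "Cauchy X"
  have "Cauchy (\<lambda>k. coord (X k) n)" for n
  proof (rule CauchyI)
    fix e :: real assume "e > 0"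
    then obtain M where M: "\<And>k l. k \<ge> M \<Longrightarrow> l \<ge> M \<Longrightarrow> norm (X k - X l) < e" using CauchyD[OF X] by blast
    show "\<exists>M. \<forall>k\<ge>M. \<forall>l\<ge>M. norm (coord (X k) n - coord (X l) n) < e"
      using M norm_coord_le[of "X _ - X _" n] unfolding coord_simps by (intro exI[of _ M]) (meson le_less_trans)
  qed
  then have "\<forall>n. \<exists>l. (\<lambda>k. coord (X k) n) \<longlonglongrightarrow> l" by (simp add: Cauchy_convergent_iff convergent_def)
  then obtain l where l: "\<And>n. (\<lambda>k. coord (X k) n) \<longlonglongrightarrow> l n" by metis
  \<comment> \<open>Only finitely many coordinates enter, so the limit in \<open>j\<close> is taken
    term by term. The bound is free of \<open>m\<close>, which gives both square summability of the
    limit and convergence in norm.\<close>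
  have part: "(\<Sum>n<m. (norm (coord (X k) n - l n))\<^sup>2) \<le> e\<^sup>2"
    if M: "\<And>k l. k \<ge> M \<Longrightarrow> l \<ge> M \<Longrightarrow> norm (X k - X l) < e" and k: "k \<ge> M" for M k e m
  proof (rule LIMSEQ_le_const2)
    show "(\<lambda>j. \<Sum>n<m. (norm (coord (X k) n - coord (X j) n))\<^sup>2) \<longlonglongrightarrow> (\<Sum>n<m. (norm (coord (X k) n - l n))\<^sup>2)"
      by (intro tendsto_intros l)
    have "(\<Sum>n<m. (norm (coord (X k) n - coord (X j) n))\<^sup>2) \<le> e\<^sup>2" if "j \<ge> M" for j
    proof -
      have "(\<Sum>n<m. (norm (coord (X k - X j) n))\<^sup>2) \<le> (norm (X k - X j))\<^sup>2"
        unfolding norm_ell2_power2 by (rule sum_le_suminf[OF summable_coord]) auto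
      also have "\<dots> \<le> e\<^sup>2" using M[OF k that] by (intro power_mono) auto
      finally show ?thesis by (simp add: coord_simps)
    qed
    then show "\<exists>N. \<forall>j\<ge>N. (\<Sum>n<m. (norm (coord (X k) n - coord (X j) n))\<^sup>2) \<le> e\<^sup>2" by blast
  qed
  have sd: "summable (\<lambda>n. (norm (coord (X k) n - l n))\<^sup>2)" if "\<And>k l. k \<ge> M \<Longrightarrow> l \<ge> M \<Longrightarrow> norm (X k - X l) < e" "k \<ge> M" for M k e
    by (rule bounded_imp_summable[where B = "e\<^sup>2"]) (use part[OF that] in \<open>auto simp: lessThan_Suc_atMost[symmetric] simp del: sum.lessThan_Suc\<close>)
  obtain M1 where M1: "\<And>k l. k \<ge> M1 \<Longrightarrow> l \<ge> M1 \<Longrightarrow> norm (X k - X l) < 1" using CauchyD[OF X, of 1] by auto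
  have "summable (\<lambda>n. (norm (coord (X M1) n - l n))\<^sup>2)" by (rule sd[OF M1]) auto
  then have "summable (\<lambda>n. (norm (l n - coord (X M1) n))\<^sup>2)" by (simp add: norm_minus_commute)
  from square_summable_add[OF this summable_coord[of "X M1"]] have "summable (\<lambda>n. (norm (l n))\<^sup>2)" by simp
  then obtain L where L: "\<And>n. coord L n = l n"
    by (metis (mono_tags, lifting) Abs_ell2_inverse coord.rep_eq mem_Collect_eq)
  have "X \<longlonglongrightarrow> L"
  proof (rule LIMSEQ_I)
    fix e :: real assume e: "e > 0"
    then obtain M where M: "\<And>k l. k \<ge> M \<Longrightarrow> l \<ge> M \<Longrightarrow> norm (X k - X l) < e/2" using CauchyD[OF X, of "e/2"] by auto
    have "norm (X k - L) < e" if k: "k \<ge> M" for k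
    proof -
      have "(norm (X k - L))\<^sup>2 \<le> (e/2)\<^sup>2"
        unfolding norm_ell2_power2
        by (rule suminf_le_const[OF summable_coord]) (use part[OF M k] in \<open>simp add: coord_simps L\<close>)
      then have "norm (X k - L) \<le> e/2" by (rule power2_le_imp_le) (use e in simp)
      then show ?thesis using e by linarith
    qed
    then show "\<exists>no. \<forall>n\<ge>no. norm (X n - L) < e" by blast
  qed
  then show "convergent X" by (auto simp: convergent_def)
qed

text \<open>An unordered sum can be reindexed along any injection, as the adjoint of a partial shift
  requires.\<close>

lemma inner_ell2_infsum: "x \<bullet> y = (\<Sum>\<^sub>\<infinity>n. coord x n \<bullet> coord y n)"
  using norm_summable_imp_has_sum[OF summable_norm_inner_coord summable_sums[OF summable_inner_coord], of x y]
  by (simp add: inner_ell2_def infsumI)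

section \<open>Multiplication by the imaginary unit, and partial shifts of coordinates\<close>

lift_definition imul :: "ell2 \<Rightarrow> ell2" is "\<lambda>f n. \<i> * f n"
  by (simp add: norm_mult)

lemma coord_imul: "coord (imul x) n = \<i> * coord x n"
  by transfer simp

lemma inner_imul: "imul x \<bullet> y = - (x \<bullet> imul y)"
proof -
  have "coord (imul x) n \<bullet> coord y n = - (coord x n \<bullet> coord (imul y) n)" for n
    by (simp add: coord_imul inner_complex_def)
  then show ?thesis unfolding inner_ell2_def by (simp add: suminf_minus[OF summable_inner_coord])
qed

lemma imul_simps: "imul (imul x) = - x" "imul (x + y) = imul x + imul y" "imul (r *\<^sub>R x) = r *\<^sub>R imul x"
  "imul 0 = 0" "imul (- x) = - imul x" "imul (x - y) = imul x - imul y"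
  by (rule ell2_eqI; simp add: coord_imul coord_simps algebra_simps)+

lemma norm_imul: "norm (imul x) = norm x"
  by (simp add: norm_eq_sqrt_inner inner_imul imul_simps)

lift_definition imul_blinfun :: "ell2 \<Rightarrow>\<^sub>L ell2" is imul
  by (rule bounded_linear_intro[of _ 1]) (simp_all add: imul_simps norm_imul)

text \<open>Composition with \<tau> on \<open>D\<close>, extended by zero. The guard makes the
  operation total: for a map that is not injective the result could fail to be square summable, and
  the value is 0 by convention.\<close>

lift_definition pshift_vec :: "nat set \<Rightarrow> (nat \<Rightarrow> nat) \<Rightarrow> ell2 \<Rightarrow> ell2"
  is "\<lambda>D \<tau> f w. if inj_on \<tau> D \<and> w \<in> D then f (\<tau> w) else 0"
proof -
  fix D and \<tau> :: "nat \<Rightarrow> nat" and f :: "nat \<Rightarrow> complex"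
  assume f: "summable (\<lambda>n. (norm (f n))\<^sup>2)"
  let ?g = "\<lambda>w. if inj_on \<tau> D \<and> w \<in> D then f (\<tau> w) else 0"
  show "summable (\<lambda>n. (norm (?g n))\<^sup>2)"
  proof (rule bounded_imp_summable)
    fix n
    show "(\<Sum>w\<le>n. (norm (?g w))\<^sup>2) \<le> (\<Sum>z. (norm (f z))\<^sup>2)"
    proof (cases "inj_on \<tau> D")
      case True
      have "(\<Sum>w\<le>n. (norm (?g w))\<^sup>2) = (\<Sum>w\<in>{..n} \<inter> D. (norm (f (\<tau> w)))\<^sup>2)"
        using True by (intro sum.mono_neutral_cong_right) auto
      also have "\<dots> = (\<Sum>z\<in>\<tau> ` ({..n} \<inter> D). (norm (f z))\<^sup>2)"
        using True by (subst sum.reindex) (simp_all add: inj_on_Int)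
      also have "\<dots> \<le> (\<Sum>z. (norm (f z))\<^sup>2)"
        by (intro sum_le_suminf f) auto
      finally show ?thesis .
    next
      case False
      then show ?thesis using suminf_nonneg[OF f] by simp
    qed
  qed auto
qed

lemma coord_pshift_vec: "inj_on \<tau> D \<Longrightarrow> coord (pshift_vec D \<tau> x) w = (if w \<in> D then coord x (\<tau> w) else 0)"
  by transfer simp

lemma coord_pshift_vec': "coord (pshift_vec D \<tau> x) w = (if inj_on \<tau> D \<and> w \<in> D then coord x (\<tau> w) else 0)"
  by transfer simp

text \<open>Substituting \<open>z = \<tau> w\<close> moves the shift to the other factor, where it
  becomes composition with the inverse map.\<close>

lemma inner_pshift_vec:
  assumes "inj_on \<tau> D"
  shows "pshift_vec D \<tau> x \<bullet> y = x \<bullet> pshift_vec (\<tau> ` D) (inv_into D \<tau>) y"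
proof -
  have "pshift_vec D \<tau> x \<bullet> y = (\<Sum>\<^sub>\<infinity>w\<in>D. coord x (\<tau> w) \<bullet> coord y w)"
    unfolding inner_ell2_infsum using assms by (intro infsum_cong_neutral) (auto simp: coord_pshift_vec)
  also have "\<dots> = (\<Sum>\<^sub>\<infinity>w\<in>D. ((\<lambda>z. coord x z \<bullet> coord y (inv_into D \<tau> z)) \<circ> \<tau>) w)"
    using assms by (intro infsum_cong) auto
  also have "\<dots> = (\<Sum>\<^sub>\<infinity>z\<in>\<tau> ` D. coord x z \<bullet> coord y (inv_into D \<tau> z))"
    by (rule infsum_reindex[OF assms, symmetric])
  also have "\<dots> = x \<bullet> pshift_vec (\<tau> ` D) (inv_into D \<tau>) y"
    unfolding inner_ell2_infsum
    by (intro infsum_cong_neutral) (auto simp: coord_pshift_vec inj_on_inv_into)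
  finally show ?thesis .
qed

lemma norm_pshift_vec_le: "norm (pshift_vec D \<tau> x) \<le> norm x"
proof (cases "inj_on \<tau> D")
  case True
  let ?y = "pshift_vec D \<tau> x" and ?z = "pshift_vec (\<tau> ` D) (inv_into D \<tau>) (pshift_vec D \<tau> x)"
  have "coord ?z n = (if n \<in> \<tau> ` D then coord x n else 0)" for n
    using True by (auto simp: coord_pshift_vec inj_on_inv_into)
  then have "norm (coord ?z n) \<le> norm (coord x n)" for n by simp
  then have "(norm ?z)\<^sup>2 \<le> (norm x)\<^sup>2"
    unfolding norm_ell2_power2 by (intro suminf_le summable_coord) (simp add: power_mono)
  then have z: "norm ?z \<le> norm x" by (rule power2_le_imp_le) simp
  have "(norm ?y)\<^sup>2 = x \<bullet> ?z"
    by (simp add: power2_norm_eq_inner inner_pshift_vec[OF True])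
  also have "\<dots> \<le> norm x * norm x"
    using Cauchy_Schwarz_ineq2[of x ?z] mult_left_mono[OF z norm_ge_zero[of x]] by linarith
  finally have "(norm ?y)\<^sup>2 \<le> (norm x)\<^sup>2" by (simp add: power2_eq_square)
  then show ?thesis by (rule power2_le_imp_le) simp
next
  case False
  then have "pshift_vec D \<tau> x = 0" by (intro ell2_eqI) (simp add: coord_pshift_vec' coord_simps)
  then show ?thesis by simp
qed

lift_definition pshift_blinfun :: "nat set \<Rightarrow> (nat \<Rightarrow> nat) \<Rightarrow> ell2 \<Rightarrow>\<^sub>L ell2" is pshift_vec
  by (rule bounded_linear_intro[of _ 1])
    (auto intro!: ell2_eqI simp: coord_pshift_vec' coord_simps norm_pshift_vec_le)

section \<open>The algebra of bounded operators on \<open>\<ell>\<^sup>2\<close>\<close>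

text \<open>A relation rather than a function, so that adjoints can be discussed before any of them
  is known to exist.\<close>

definition adjoint_pair :: "(ell2 \<Rightarrow>\<^sub>L ell2) \<Rightarrow> (ell2 \<Rightarrow>\<^sub>L ell2) \<Rightarrow> bool" where
  "adjoint_pair T T' \<longleftrightarrow> (\<forall>x y. T x \<bullet> y = x \<bullet> T' y)"

definition clinear_op :: "(ell2 \<Rightarrow>\<^sub>L ell2) \<Rightarrow> bool" where
  "clinear_op T \<longleftrightarrow> (\<forall>x. T (imul x) = imul (T x))"

lemma adjoint_pairD: "adjoint_pair T T' \<Longrightarrow> T x \<bullet> y = x \<bullet> T' y"
  by (simp add: adjoint_pair_def)

lemma adjoint_pair_sym: "adjoint_pair T T' \<Longrightarrow> adjoint_pair T' T"
  by (metis adjoint_pair_def inner_commute)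

lemma adjoint_pair_unique:
  assumes "adjoint_pair T T1" "adjoint_pair T T2" shows "T1 = T2"
proof (rule blinfun_eqI)
  fix y
  have "x \<bullet> (T1 y - T2 y) = 0" for x
    using adjoint_pairD[OF assms(1), of x y] adjoint_pairD[OF assms(2), of x y] by (simp add: inner_diff_right)
  from this[of "T1 y - T2 y"] show "T1 y = T2 y" by simp
qed

lemma clinear_op_adjoint:
  assumes "adjoint_pair T T'" "clinear_op T" shows "clinear_op T'"
  unfolding clinear_op_def
proof
  fix y
  have "x \<bullet> (T' (imul y) - imul (T' y)) = 0" for x
  proof -
    have "x \<bullet> T' (imul y) = T x \<bullet> imul y" by (rule adjoint_pairD[OF assms(1), symmetric])
    also have "\<dots> = - (T (imul x) \<bullet> y)" using assms(2) inner_imul[of "T x" y] unfolding clinear_op_def by simp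
    also have "\<dots> = - (imul x \<bullet> T' y)" unfolding adjoint_pairD[OF assms(1)] ..
    also have "\<dots> = x \<bullet> imul (T' y)" unfolding inner_imul by simp
    finally show ?thesis by (simp add: inner_diff_right)
  qed
  from this[of "T' (imul y) - imul (T' y)"] show "T' (imul y) = imul (T' y)" by simp
qed

lemma norm_adjoint_le: assumes "adjoint_pair T T'" shows "norm T' \<le> norm T"
proof (rule norm_blinfun_bound)
  fix y
  have "norm (T' y) * norm (T' y) = T (T' y) \<bullet> y"
    using adjoint_pairD[OF assms, of "T' y" y] by (simp add: dot_square_norm power2_eq_square)
  also have "\<dots> \<le> norm T * norm (T' y) * norm y"
    using Cauchy_Schwarz_ineq2[of "T (T' y)" y] mult_right_mono[OF norm_blinfun[of T "T' y"] norm_ge_zero[of y]] by linarith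
  finally have "norm (T' y) * norm (T' y) \<le> norm T * norm y * norm (T' y)" by (simp add: mult_ac)
  then show "norm (T' y) \<le> norm T * norm y"
    by (cases "norm (T' y) = 0") auto
qed simp

lemma norm_adjoint: assumes "adjoint_pair T T'" shows "norm T' = norm T"
  using norm_adjoint_le[OF assms] norm_adjoint_le[OF adjoint_pair_sym[OF assms]] by simp

lemma adjoint_pair_add: "adjoint_pair T T' \<Longrightarrow> adjoint_pair R R' \<Longrightarrow> adjoint_pair (T + R) (T' + R')"
  by (simp add: adjoint_pair_def blinfun.add_left inner_add_left inner_add_right)

lemma adjoint_pair_diff: "adjoint_pair T T' \<Longrightarrow> adjoint_pair R R' \<Longrightarrow> adjoint_pair (T - R) (T' - R')"
  by (simp add: adjoint_pair_def blinfun.diff_left inner_diff_left inner_diff_right)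

lemma adjoint_pair_minus: "adjoint_pair T T' \<Longrightarrow> adjoint_pair (- T) (- T')"
  by (simp add: adjoint_pair_def blinfun.minus_left)

lemma adjoint_pair_scaleR: "adjoint_pair T T' \<Longrightarrow> adjoint_pair (r *\<^sub>R T) (r *\<^sub>R T')"
  by (simp add: adjoint_pair_def blinfun.scaleR_left)

lemma adjoint_pair_compose: "adjoint_pair T T' \<Longrightarrow> adjoint_pair R R' \<Longrightarrow> adjoint_pair (T o\<^sub>L R) (R' o\<^sub>L T')"
  by (simp add: adjoint_pair_def)

lemma adjoint_pair_id: "adjoint_pair id_blinfun id_blinfun"
  by (simp add: adjoint_pair_def)

lemma adjoint_pair_imul: "adjoint_pair imul_blinfun (- imul_blinfun)"
  by (simp add: adjoint_pair_def imul_blinfun.rep_eq inner_imul blinfun.minus_left)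

lemma adjoint_pair_pshift:
  "inj_on \<tau> D \<Longrightarrow> adjoint_pair (pshift_blinfun D \<tau>) (pshift_blinfun (\<tau> ` D) (inv_into D \<tau>))"
  by (simp add: adjoint_pair_def pshift_blinfun.rep_eq inner_pshift_vec)

lemma pshift_blinfun_not_inj: "\<not> inj_on \<tau> D \<Longrightarrow> pshift_blinfun D \<tau> = 0"
  by (intro blinfun_eqI ell2_eqI) (simp add: pshift_blinfun.rep_eq coord_pshift_vec' coord_simps)

text \<open>Demanding an adjoint as part of membership makes \<open>adj\<close> total without the
  Riesz representation theorem. In return, completeness has to produce an adjoint of the
  limit.\<close>

typedef bop = "{T. clinear_op T \<and> (\<exists>T'. adjoint_pair T T')}"
  by (rule exI[of _ id_blinfun]) (auto simp: clinear_op_def intro: adjoint_pair_id)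

setup_lifting type_definition_bop

instantiation bop :: real_normed_algebra_1
begin

lift_definition zero_bop :: bop is 0
  by (auto simp: clinear_op_def imul_simps adjoint_pair_def intro: exI[of _ 0])
lift_definition one_bop :: bop is id_blinfun
  by (auto simp: clinear_op_def intro: adjoint_pair_id)
lift_definition plus_bop :: "bop \<Rightarrow> bop \<Rightarrow> bop" is "(+)"
  by (auto simp: clinear_op_def imul_simps blinfun.add_left intro: adjoint_pair_add)
lift_definition uminus_bop :: "bop \<Rightarrow> bop" is uminus
  by (auto simp: clinear_op_def imul_simps blinfun.minus_left intro: adjoint_pair_minus)
lift_definition minus_bop :: "bop \<Rightarrow> bop \<Rightarrow> bop" is "(-)"
  by (auto simp: clinear_op_def imul_simps blinfun.diff_left intro: adjoint_pair_diff)
lift_definition scaleR_bop :: "real \<Rightarrow> bop \<Rightarrow> bop" is scaleR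
  by (auto simp: clinear_op_def imul_simps blinfun.scaleR_left intro: adjoint_pair_scaleR)
lift_definition times_bop :: "bop \<Rightarrow> bop \<Rightarrow> bop" is "(o\<^sub>L)"
  by (auto simp: clinear_op_def intro: adjoint_pair_compose)
lift_definition norm_bop :: "bop \<Rightarrow> real" is norm .
definition dist_bop :: "bop \<Rightarrow> bop \<Rightarrow> real" where "dist_bop x y = norm (x - y)"
definition sgn_bop :: "bop \<Rightarrow> bop" where "sgn_bop x = inverse (norm x) *\<^sub>R x"
definition uniformity_bop :: "(bop \<times> bop) filter"
  where "uniformity_bop = (INF e\<in>{0<..}. principal {(x, y). dist x y < e})"
definition open_bop :: "bop set \<Rightarrow> bool"
  where "open_bop U = (\<forall>x\<in>U. \<forall>\<^sub>F (x', y) in uniformity. x' = x \<longrightarrow> y \<in> U)"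

lemmas rep_simps = Rep_bop_inject[symmetric] zero_bop.rep_eq one_bop.rep_eq plus_bop.rep_eq uminus_bop.rep_eq
  minus_bop.rep_eq scaleR_bop.rep_eq times_bop.rep_eq norm_bop.rep_eq

instance
proof
  fix x y z :: bop and r s :: real
  show "x - y = x + - y" "x + y + z = x + (y + z)" "x + y = y + x" "0 + x = x" "- x + x = 0"
    "r *\<^sub>R (x + y) = r *\<^sub>R x + r *\<^sub>R y" "(r + s) *\<^sub>R x = r *\<^sub>R x + s *\<^sub>R x"
    "r *\<^sub>R s *\<^sub>R x = (r * s) *\<^sub>R x" "1 *\<^sub>R x = x"
    by (simp_all add: rep_simps algebra_simps)
  show "x * y * z = x * (y * z)" "(x + y) * z = x * z + y * z" "x * (y + z) = x * y + x * z"
    "1 * x = x" "x * 1 = x" "r *\<^sub>R x * y = r *\<^sub>R (x * y)" "x * r *\<^sub>R y = r *\<^sub>R (x * y)"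
    unfolding rep_simps
    by (rule blinfun_eqI, simp add: blinfun.add_left blinfun.add_right blinfun.scaleR_left blinfun.scaleR_right)+
  define f where "f = delta 0"
  have f: "f \<noteq> 0" using coord_delta[of 0 0] by (auto simp: f_def coord_simps)
  have "norm f \<le> norm (id_blinfun :: ell2 \<Rightarrow>\<^sub>L ell2) * norm f" using norm_blinfun[of id_blinfun f] by simp
  then have "norm (id_blinfun :: ell2 \<Rightarrow>\<^sub>L ell2) = 1"
    using f norm_blinfun_id_le[where 'a = ell2] by simp
  then show 1: "norm (1 :: bop) = 1" by (simp add: rep_simps)
  have "norm (0 :: bop) = 0" by (simp add: rep_simps)
  with 1 show "(0 :: bop) \<noteq> 1" by auto
  show "dist x y = norm (x - y)" "sgn x = inverse (norm x) *\<^sub>R x"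
    by (simp_all add: dist_bop_def sgn_bop_def)
  show "uniformity = (INF e\<in>{0<..}. principal {(x, y :: bop). dist x y < e})"
    by (rule uniformity_bop_def)
  show "open U \<longleftrightarrow> (\<forall>x\<in>U. \<forall>\<^sub>F (x', y) in uniformity. x' = x \<longrightarrow> y \<in> U)" for U :: "bop set"
    by (rule open_bop_def)
  show "norm x = 0 \<longleftrightarrow> x = 0" "norm (x + y) \<le> norm x + norm y" "norm (r *\<^sub>R x) = \<bar>r\<bar> * norm x"
    by (simp_all add: rep_simps norm_triangle_ineq)
  show "norm (x * y) \<le> norm x * norm y"
    unfolding rep_simps by (rule norm_blinfun_compose)
qed

end

definition app :: "bop \<Rightarrow> ell2 \<Rightarrow>\<^sub>L ell2" where "app = Rep_bop"

lift_definition adj :: "bop \<Rightarrow> bop" is "\<lambda>T. THE T'. adjoint_pair T T'"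
proof -
  fix T :: "ell2 \<Rightarrow>\<^sub>L ell2" assume T: "clinear_op T \<and> (\<exists>T'. adjoint_pair T T')"
  then obtain T' where T': "adjoint_pair T T'" by blast
  then have "(THE T'. adjoint_pair T T') = T'" by (rule the_equality) (rule adjoint_pair_unique[OF _ T'])
  then show "clinear_op (THE T'. adjoint_pair T T') \<and> (\<exists>T''. adjoint_pair (THE T'. adjoint_pair T T') T'')"
    using clinear_op_adjoint[OF T'] adjoint_pair_sym[OF T'] T by auto
qed

lemma adj_pair: "adjoint_pair (Rep_bop T) (Rep_bop (adj T))"
proof -
  obtain T' where T': "adjoint_pair (Rep_bop T) T'" using Rep_bop[of T] by auto
  then have "(THE T'. adjoint_pair (Rep_bop T) T') = T'" by (rule the_equality) (rule adjoint_pair_unique[OF _ T'])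
  then show ?thesis using T' by (simp add: adj.rep_eq)
qed

lemma app_adj: "app T x \<bullet> y = x \<bullet> app (adj T) y"
  using adj_pair[of T] by (simp add: adjoint_pair_def app_def)

lemma bop_eqI: assumes "\<And>x. app S x = app T x" shows "S = T"
proof -
  have "Rep_bop S = Rep_bop T" by (rule blinfun_eqI) (rule assms[unfolded app_def])
  then show ?thesis by (simp add: Rep_bop_inject)
qed

lemma adj_eqI: assumes "\<And>x y. app T x \<bullet> y = x \<bullet> app T' y" shows "adj T = T'"
proof -
  have "adjoint_pair (Rep_bop T) (Rep_bop T')" using assms by (simp add: adjoint_pair_def app_def)
  from adjoint_pair_unique[OF adj_pair this] show ?thesis by (simp add: Rep_bop_inject)
qed

lemma app_simps [simp]: "app 0 x = 0" "app 1 x = x" "app (S + T) x = app S x + app T x" "app (- T) x = - app T x"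
  "app (S - T) x = app S x - app T x" "app (r *\<^sub>R T) x = r *\<^sub>R app T x" "app (S * T) x = app S (app T x)"
  by (simp_all add: app_def zero_bop.rep_eq one_bop.rep_eq plus_bop.rep_eq uminus_bop.rep_eq minus_bop.rep_eq
    scaleR_bop.rep_eq times_bop.rep_eq blinfun.add_left blinfun.diff_left blinfun.minus_left blinfun.scaleR_left)

lemmas app_vec_simps [simp] = blinfun.zero_right blinfun.add_right blinfun.diff_right blinfun.minus_right blinfun.scaleR_right

lemma app_imul [simp]: "app T (imul x) = imul (app T x)"
  using Rep_bop[of T] by (simp add: clinear_op_def app_def)

lemma norm_app_le: "norm (app T x) \<le> norm T * norm x"
  by (simp add: app_def norm_bop.rep_eq norm_blinfun)

lemma norm_bop_bound: "0 \<le> b \<Longrightarrow> (\<And>x. norm (app T x) \<le> b * norm x) \<Longrightarrow> norm T \<le> b"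
  unfolding app_def norm_bop.rep_eq by (rule norm_blinfun_bound)

lemma adj_simps: "adj (adj T) = T" "adj (S + T) = adj S + adj T" "adj (S * T) = adj T * adj S" "adj (r *\<^sub>R T) = r *\<^sub>R adj T"
  "adj 1 = 1" "adj (S - T) = adj S - adj T"
proof -
  show "adj (adj T) = T"
  proof (rule adj_eqI)
    show "app (adj T) x \<bullet> y = x \<bullet> app T y" for x y using app_adj[of T y x] by (simp add: inner_commute)
  qed
  show "adj (S + T) = adj S + adj T" "adj (S * T) = adj T * adj S" "adj (r *\<^sub>R T) = r *\<^sub>R adj T"
    "adj 1 = 1" "adj (S - T) = adj S - adj T"
    by (rule adj_eqI, simp add: app_adj inner_add_left inner_add_right inner_diff_left inner_diff_right)+
qed

lemma norm_adj: "norm (adj T) = norm T"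
  using norm_adjoint[OF adj_pair] by (simp add: norm_bop.rep_eq)

lemma norm_adj_mult: "norm (adj T * T) = (norm T)\<^sup>2"
proof (rule antisym)
  show "norm (adj T * T) \<le> (norm T)\<^sup>2"
    using norm_mult_ineq[of "adj T" T] by (simp add: norm_adj power2_eq_square)
  have "norm T \<le> sqrt (norm (adj T * T))"
  proof (rule norm_bop_bound)
    fix x
    have "(norm (app T x))\<^sup>2 = x \<bullet> app (adj T * T) x"
      by (simp add: power2_norm_eq_inner app_adj)
    also have "\<dots> \<le> norm x * (norm (adj T * T) * norm x)"
      using Cauchy_Schwarz_ineq2[of x "app (adj T * T) x"] mult_left_mono[OF norm_app_le[of "adj T * T" x] norm_ge_zero[of x]]
      by linarith
    also have "\<dots> = (sqrt (norm (adj T * T)) * norm x)\<^sup>2" by (simp add: power_mult_distrib power2_eq_square mult_ac)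
    finally show "norm (app T x) \<le> sqrt (norm (adj T * T)) * norm x" by (rule power2_le_imp_le) simp
  qed simp
  then show "(norm T)\<^sup>2 \<le> norm (adj T * T)"
    using power_mono[OF _ norm_ge_zero, of T "sqrt (norm (adj T * T))" 2] by simp
qed

text \<open>Taking adjoints is isometric, so the adjoints of a Cauchy sequence converge as well, and
  their limit is the adjoint of the limit.\<close>

instance bop :: banach
proof
  fix X :: "nat \<Rightarrow> bop" assume X: "Cauchy X"
  have XR: "norm (Rep_bop (X k) - Rep_bop (X l)) = norm (X k - X l)" for k l
    by (simp add: norm_bop.rep_eq minus_bop.rep_eq)
  have XA: "norm (Rep_bop (adj (X k)) - Rep_bop (adj (X l))) = norm (X k - X l)" for k l
    using norm_adj[of "X k - X l"] by (simp add: norm_bop.rep_eq minus_bop.rep_eq adj_simps)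
  have "Cauchy (\<lambda>k. Rep_bop (X k))" using X unfolding Cauchy_iff XR .
  then obtain L where L: "(\<lambda>k. Rep_bop (X k)) \<longlonglongrightarrow> L" using Cauchy_convergent convergent_def by blast
  have "Cauchy (\<lambda>k. Rep_bop (adj (X k)))" using X unfolding Cauchy_iff XA .
  then obtain L' where L': "(\<lambda>k. Rep_bop (adj (X k))) \<longlonglongrightarrow> L'" using Cauchy_convergent convergent_def by blast
  have Lx: "(\<lambda>k. Rep_bop (X k) x) \<longlonglongrightarrow> L x" and L'x: "(\<lambda>k. Rep_bop (adj (X k)) x) \<longlonglongrightarrow> L' x" for x
    by (intro tendsto_intros L L')+
  have "adjoint_pair L L'"
    unfolding adjoint_pair_def
  proof (intro allI)
    fix x y
    have "(\<lambda>k. Rep_bop (X k) x \<bullet> y) \<longlonglongrightarrow> L x \<bullet> y" "(\<lambda>k. x \<bullet> Rep_bop (adj (X k)) y) \<longlonglongrightarrow> x \<bullet> L' y"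
      by (intro tendsto_intros Lx L'x)+
    moreover have "Rep_bop (X k) x \<bullet> y = x \<bullet> Rep_bop (adj (X k)) y" for k using adj_pair by (simp add: adjoint_pair_def)
    ultimately show "L x \<bullet> y = x \<bullet> L' y" using LIMSEQ_unique by simp
  qed
  moreover have "clinear_op L"
    unfolding clinear_op_def
  proof
    fix x
    have "(\<lambda>k. imul_blinfun (Rep_bop (X k) x)) \<longlonglongrightarrow> imul_blinfun (L x)" by (intro tendsto_intros Lx)
    moreover have "imul_blinfun (Rep_bop (X k) x) = Rep_bop (X k) (imul x)" for k
      using Rep_bop[of "X k"] by (simp add: clinear_op_def imul_blinfun.rep_eq)
    ultimately show "L (imul x) = imul (L x)"
      using LIMSEQ_unique[OF Lx[of "imul x"]] by (simp add: imul_blinfun.rep_eq)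
  qed
  ultimately obtain M where M: "Rep_bop M = L" using Abs_bop_inverse[of L] by auto
  have "X \<longlonglongrightarrow> M"
    using L unfolding LIMSEQ_iff by (simp add: norm_bop.rep_eq minus_bop.rep_eq M)
  then show "convergent X" by (auto simp: convergent_def)
qed

section \<open>Scalars, partial shifts and coordinate projections as operators\<close>

lift_definition jop :: bop is imul_blinfun
  using adjoint_pair_imul by (auto simp: clinear_op_def imul_blinfun.rep_eq)

lift_definition pshift :: "nat set \<Rightarrow> (nat \<Rightarrow> nat) \<Rightarrow> bop" is pshift_blinfun
proof
  fix D and \<tau> :: "nat \<Rightarrow> nat"
  show "clinear_op (pshift_blinfun D \<tau>)"
    by (auto simp: clinear_op_def pshift_blinfun.rep_eq coord_pshift_vec' coord_imul intro!: ell2_eqI)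
  show "\<exists>T'. adjoint_pair (pshift_blinfun D \<tau>) T'"
  proof (cases "inj_on \<tau> D")
    case False
    then have "adjoint_pair (pshift_blinfun D \<tau>) 0" by (simp add: pshift_blinfun_not_inj adjoint_pair_def)
    then show ?thesis ..
  next
    case True
    show ?thesis by (rule exI, rule adjoint_pair_pshift[OF True])
  qed
qed

lemma coord_pshift: "inj_on \<tau> D \<Longrightarrow> coord (app (pshift D \<tau>) x) w = (if w \<in> D then coord x (\<tau> w) else 0)"
  by (simp add: app_def pshift.rep_eq pshift_blinfun.rep_eq coord_pshift_vec)

lemma adj_pshift: "inj_on \<tau> D \<Longrightarrow> adj (pshift D \<tau>) = pshift (\<tau> ` D) (inv_into D \<tau>)"
  by (rule adj_eqI) (simp add: app_def pshift.rep_eq pshift_blinfun.rep_eq inner_pshift_vec)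

lemma app_jop [simp]: "app jop x = imul x"
  by (simp add: app_def jop.rep_eq imul_blinfun.rep_eq)

lemma norm_pshift_le: "norm (pshift D \<tau>) \<le> 1"
  by (rule norm_bop_bound) (simp_all add: app_def pshift.rep_eq pshift_blinfun.rep_eq norm_pshift_vec_le)

definition cscalar :: "complex \<Rightarrow> bop" where "cscalar c = Re c *\<^sub>R 1 + Im c *\<^sub>R jop"

lemma coord_cscalar: "coord (app (cscalar c) x) n = c * coord x n"
  by (simp add: cscalar_def coord_simps coord_imul complex_eq_iff)

lemma cscalar_simps: "cscalar (c + d) = cscalar c + cscalar d" "cscalar (c * d) = cscalar c * cscalar d"
  "cscalar 0 = 0" "cscalar 1 = 1" "cscalar (- c) = - cscalar c" "cscalar (c - d) = cscalar c - cscalar d"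
  by (intro bop_eqI ell2_eqI; simp add: coord_cscalar coord_simps algebra_simps)+

lemma cscalar_commute: "cscalar c * T = T * cscalar c"
  by (rule bop_eqI) (simp add: cscalar_def)

lemma adj_cscalar: "adj (cscalar c) = cscalar (cnj c)"
  by (rule adj_eqI) (simp add: cscalar_def inner_add_left inner_diff_right inner_imul)

text \<open>The bound from above, applied once more with \<open>inverse c\<close>, supplies the
  bound from below.\<close>

lemma norm_cscalar_mult: "norm (cscalar c * T) = cmod c * norm T"
proof -
  have n: "norm (app (cscalar c) x) = cmod c * norm x" for c x
  proof -
    have "(norm (app (cscalar c) x))\<^sup>2 = (cmod c * norm x)\<^sup>2"
      by (simp add: norm_ell2_power2 coord_cscalar norm_mult power_mult_distrib suminf_mult summable_coord)
    then show ?thesis by (simp add: power2_eq_iff_nonneg)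
  qed
  have le: "norm (cscalar c * T) \<le> cmod c * norm T" for c T
  proof (rule norm_bop_bound)
    show "norm (app (cscalar c * T) x) \<le> cmod c * norm T * norm x" for x
      using mult_left_mono[OF norm_app_le[of T x] norm_ge_zero[of c]] by (simp add: n mult.assoc)
  qed simp
  show ?thesis
  proof (cases "c = 0")
    case False
    have "T = cscalar (inverse c) * (cscalar c * T)"
      using False by (simp add: mult.assoc[symmetric] cscalar_simps(2)[symmetric] cscalar_simps(4))
    then have "norm T \<le> inverse (cmod c) * norm (cscalar c * T)"
      using le[of "inverse c" "cscalar c * T"] by (simp add: norm_inverse)
    then show ?thesis using le[of c T] False by (simp add: field_simps)
  qed (simp add: cscalar_simps)
qed

definition proj :: "nat set \<Rightarrow> bop" where "proj E = pshift E (\<lambda>w. w)"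

lemma coord_proj: "coord (app (proj E) x) w = (if w \<in> E then coord x w else 0)"
  by (simp add: proj_def coord_pshift)

lemma proj_simps: "proj E * proj F = proj (E \<inter> F)" "1 - proj E = proj (- E)" "proj UNIV = 1" "adj (proj E) = proj E"
proof -
  show "proj E * proj F = proj (E \<inter> F)" "1 - proj E = proj (- E)" "proj UNIV = 1"
    by (intro bop_eqI ell2_eqI; simp add: coord_proj coord_simps)+
  have "adj (proj E) = pshift ((\<lambda>w. w) ` E) (inv_into E (\<lambda>w. w))"
    unfolding proj_def by (rule adj_pshift) simp
  also have "\<dots> = proj E"
    by (intro bop_eqI ell2_eqI) (auto simp: proj_def coord_pshift inj_on_inv_into inv_into_f_f[of "\<lambda>w. w", simplified])
  finally show "adj (proj E) = proj E" .
qed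

lemma norm_proj_le: "norm (proj E) \<le> 1"
  unfolding proj_def by (rule norm_pshift_le)

section \<open>An index obstruction\<close>

text \<open>The Neumann series of \<open>a = 1 - w\<close> satisfies
  \<open>?h = 1 + a * ?h = 1 + ?h * a\<close>, hence is a two-sided inverse.\<close>

lemma inverse_near_one:
  fixes w :: "'r :: {real_normed_algebra_1, banach}"
  assumes "norm (w - 1) < 1"
  obtains h where "w * h = 1" "h * w = 1"
proof
  define a where "a = 1 - w"
  have "norm a < 1" using assms by (simp add: a_def norm_minus_commute)
  then have s: "summable (\<lambda>n. a ^ n)" by (rule complete_algebra_summable_geometric)
  let ?h = "\<Sum>n. a ^ n"
  have 1: "?h = 1 + (\<Sum>n. a ^ Suc n)" using suminf_split_initial_segment[OF s, of 1] by simp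
  have "(\<Sum>n. a ^ Suc n) = a * ?h" using suminf_mult[OF s, of a] by simp
  then show "w * ?h = 1" using 1 by (simp add: a_def algebra_simps)
  have "(\<Sum>n. a ^ Suc n) = ?h * a" using suminf_mult2[OF s, of a] by (simp add: power_commutes)
  then show "?h * w = 1" using 1 by (simp add: a_def algebra_simps)
qed

text \<open>Of the compact operators, the index argument uses only that they form a two-sided ideal
  and that a left inverse of \<open>1 + k\<close>, with \<open>k\<close> in the ideal, is also a
  right inverse. Stating it for such a \<open>K\<close>, with a central copy \<open>sc\<close> of
  the complex numbers, separates the algebra from the operator theory.\<close>

locale toeplitz =
  fixes P :: "'r :: {real_normed_algebra_1, banach}" and K :: "'r set" and sc :: "complex \<Rightarrow> 'r"
  assumes PP: "P * P = P" and norm_P: "norm P \<le> 1"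
    and K_zero: "0 \<in> K" and K_add: "k \<in> K \<Longrightarrow> l \<in> K \<Longrightarrow> k + l \<in> K"
    and K_left: "k \<in> K \<Longrightarrow> a * k \<in> K" and K_right: "k \<in> K \<Longrightarrow> k * a \<in> K"
    and fredholm_alternative: "k \<in> K \<Longrightarrow> x * (1 + k) = 1 \<Longrightarrow> (1 + k) * x = 1"
    and sc_hom: "sc 0 = 0" "sc 1 = 1" "sc (c + d) = sc c + sc d" "sc (c * d) = sc c * sc d"
    and sc_commute: "sc c * a = a * sc c" and norm_sc: "norm (sc c) = cmod c"
begin

text \<open>The identity is put on the complement of \<open>P\<close>, so that the compression is an
  element of the whole algebra with \<open>T 1 = 1\<close> and can be inverted there.\<close>

definition T :: "'r \<Rightarrow> 'r" where "T a = P * a * P + (1 - P)"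

text \<open>Only one off-diagonal corner is required to lie in \<open>K\<close>, since no other
  corner of the right factor appears in \<open>T_mult\<close>. In exchange, smoothness of an adjoint
  has to be shown separately.\<close>

definition smooth :: "'r set" where "smooth = {a. (1 - P) * a * P \<in> K}"

text \<open>Stands for a Fredholm element of index zero; describing it as invertible plus a member
  of \<open>K\<close> avoids kernels and cokernels.\<close>

definition index_zero :: "'r \<Rightarrow> bool" where
  "index_zero a \<longleftrightarrow> (\<exists>g h k. g * h = 1 \<and> h * g = 1 \<and> k \<in> K \<and> a = g + k)"

lemma sc_minus: "sc (- c) = - sc c"
  using sc_hom(3)[of c "- c"] sc_hom(1) by (simp add: eq_neg_iff_add_eq_0 add.commute)

lemma sc_diff: "sc (c - d) = sc c - sc d"
  using sc_hom(3)[of c "- d"] by (simp add: sc_minus)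

lemma P_compl: "P * (1 - P) = 0" "(1 - P) * P = 0" "(1 - P) * (1 - P) = 1 - P"
  by (simp_all add: algebra_simps PP)

lemma PPx: "P * (P * x) = P * x"
  using PP by (simp add: mult.assoc[symmetric])

text \<open>The error contains a corner of the right factor only, which is why the factors close to
  1 are placed on the right below.\<close>

lemma T_mult: "T (a * b) - T a * T b = P * a * ((1 - P) * b * P)"
  by (simp add: T_def algebra_simps PP PPx)

lemma norm_T_diff: "norm (P * a * P) \<le> norm a"
proof -
  have "norm (P * a * P) \<le> norm P * norm a * norm P"
    by (meson norm_ge_zero norm_mult_ineq mult_right_mono order_trans)
  also have "\<dots> \<le> 1 * norm a * 1" using norm_P by (intro mult_mono) auto
  finally show ?thesis by simp
qed

lemma T_one: "T 1 = 1" by (simp add: T_def PP)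

lemma T_diff: "T a - T b = P * (a - b) * P" by (simp add: T_def algebra_simps)

lemma T_inverse: assumes "norm (w - 1) < 1" obtains h where "T w * h = 1" "h * T w = 1"
proof -
  have "norm (T w - 1) \<le> norm (w - 1)" using norm_T_diff[of "w - 1"] T_diff[of w 1] by (simp add: T_one)
  then show thesis using inverse_near_one[of "T w"] assms that by fastforce
qed

lemma smooth_closed:
  "a \<in> smooth \<Longrightarrow> b \<in> smooth \<Longrightarrow> a + b \<in> smooth" "a \<in> smooth \<Longrightarrow> b \<in> smooth \<Longrightarrow> a * b \<in> smooth"
  "sc c \<in> smooth" "1 \<in> smooth"
proof -
  have sc: "sc c \<in> smooth" for c
  proof -
    have "(1 - P) * sc c * P = sc c * ((1 - P) * P)" by (simp add: sc_commute mult.assoc)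
    then show ?thesis using K_zero by (simp add: smooth_def P_compl)
  qed
  then show "sc c \<in> smooth" .
  show "1 \<in> smooth" using sc[of 1] by (simp only: sc_hom)
  assume a: "a \<in> smooth" and b: "b \<in> smooth"
  have "(1 - P) * (a + b) * P = (1 - P) * a * P + (1 - P) * b * P" by (simp add: algebra_simps)
  then show "a + b \<in> smooth" using a b K_add by (simp add: smooth_def)
  have "(1 - P) * (a * b) * P = ((1 - P) * a * P) * (b * P) + ((1 - P) * a) * ((1 - P) * b * P)"
    by (simp add: algebra_simps)
  moreover have "((1 - P) * a * P) * (b * P) \<in> K" by (rule K_right) (use a in \<open>simp add: smooth_def\<close>)
  moreover have "((1 - P) * a) * ((1 - P) * b * P) \<in> K" by (rule K_left) (use b in \<open>simp add: smooth_def\<close>)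
  ultimately show "a * b \<in> smooth" using K_add by (simp add: smooth_def)
qed

lemma smooth_diff: "a \<in> smooth \<Longrightarrow> b \<in> smooth \<Longrightarrow> a - b \<in> smooth"
  using smooth_closed(1)[OF _ smooth_closed(2)[OF smooth_closed(3)[of "- 1"]], of a b] by (simp add: sc_minus sc_hom)

lemma smooth_power: "a \<in> smooth \<Longrightarrow> a ^ n \<in> smooth"
  by (induction n) (auto intro: smooth_closed)

lemma smooth_sum: "(\<And>i. i \<in> J \<Longrightarrow> f i \<in> smooth) \<Longrightarrow> sum f J \<in> smooth"
  using smooth_closed(3)[of 0] by (induction J rule: infinite_finite_induct) (auto intro: smooth_closed simp: sc_hom)

text \<open>An invertible factor can be undone, and a change by a member of the ideal is absorbed;
  so the property passes in both directions.\<close>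

lemma index_zero_mult_iff:
  assumes g: "g * h = 1" "h * g = 1" and k: "b - a * g \<in> K"
  shows "index_zero a \<longleftrightarrow> index_zero b"
proof
  have minus: "- l \<in> K" if "l \<in> K" for l using K_left[OF that, of "- 1"] by simp
  show "index_zero b" if "index_zero a"
  proof -
    obtain g' h' l where a: "g' * h' = 1" "h' * g' = 1" "l \<in> K" "a = g' + l" using \<open>index_zero a\<close> by (auto simp: index_zero_def)
    have "(g' * g) * (h * h') = g' * (g * h) * h'" "(h * h') * (g' * g) = h * (h' * g') * g" by (simp_all only: mult.assoc)
    then have "(g' * g) * (h * h') = 1" "(h * h') * (g' * g) = 1" using a g by simp_all
    moreover have "b = g' * g + (l * g + (b - a * g))" by (simp add: a algebra_simps)
    moreover have "l * g + (b - a * g) \<in> K" using K_add K_right a(3) k by blast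
    ultimately show ?thesis unfolding index_zero_def by blast
  qed
  show "index_zero a" if "index_zero b"
  proof -
    obtain g' h' l where b: "g' * h' = 1" "h' * g' = 1" "l \<in> K" "b = g' + l" using \<open>index_zero b\<close> by (auto simp: index_zero_def)
    have "(g' * h) * (g * h') = g' * (h * g) * h'" "(g * h') * (g' * h) = g * (h' * g') * h" by (simp_all only: mult.assoc)
    then have "(g' * h) * (g * h') = 1" "(g * h') * (g' * h) = 1" using b g by simp_all
    moreover have "a = g' * h + (l * h + - (b - a * g) * h)"
      using g by (simp add: b(4) algebra_simps)
    moreover have "l * h + - (b - a * g) * h \<in> K" using K_add K_right b(3) minus[OF k] by blast
    ultimately show ?thesis unfolding index_zero_def by blast
  qed
qed

text \<open>Dividing a polynomial that vanishes at \<open>y\<close> by \<open>y - sc l\<close>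
  leaves as remainder its value at \<open>l\<close>, a nonzero scalar. The right inverse so obtained
  is a polynomial in \<open>y\<close>, and that is what keeps it in \<open>smooth\<close>.\<close>

lemma resolvent:
  assumes y: "y \<in> smooth" and c: "(\<Sum>k\<le>N. sc (c k) * y ^ k) = 0" and l: "(\<Sum>k\<le>N. c k * l ^ k) \<noteq> 0"
  obtains g where "g \<in> smooth" "(y - sc l) * g = 1"
proof -
  have "\<exists>g\<in>smooth. y ^ k - sc (l ^ k) = (y - sc l) * g" for k
  proof (induction k)
    case 0 then show ?case using smooth_closed(3)[of 0] by (intro bexI[of _ 0]) (simp_all add: sc_hom)
  next
    case (Suc k)
    then obtain g where g: "g \<in> smooth" "y ^ k - sc (l ^ k) = (y - sc l) * g" by blast
    have "y ^ Suc k - sc (l ^ Suc k) = (y - sc l) * y ^ k + sc l * (y ^ k - sc (l ^ k))"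
      by (simp add: sc_hom algebra_simps)
    also have "\<dots> = (y - sc l) * (y ^ k + g * sc l)"
      unfolding g(2) sc_commute by (simp add: distrib_left mult.assoc)
    finally show ?case using g(1) y by (intro bexI[of _ "y ^ k + g * sc l"]) (auto intro: smooth_closed smooth_power)
  qed
  then obtain q where q: "\<And>k. q k \<in> smooth" "\<And>k. y ^ k - sc (l ^ k) = (y - sc l) * q k" by metis
  let ?m = "\<Sum>k\<le>N. c k * l ^ k" and ?g = "\<Sum>k\<le>N. q k * sc (c k)"
  have sc_sum: "sc (sum f J) = (\<Sum>k\<in>J. sc (f k))" for f and J :: "nat set"
    by (induction J rule: infinite_finite_induct) (simp_all add: sc_hom)
  have "(y - sc l) * ?g = (\<Sum>k\<le>N. ((y - sc l) * q k) * sc (c k))"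
    by (simp only: sum_distrib_left mult.assoc)
  also have "\<dots> = (\<Sum>k\<le>N. sc (c k) * y ^ k) - sc ?m"
    unfolding q(2)[symmetric] sc_sum sum_subtractf[symmetric]
    by (intro sum.cong refl) (simp add: sc_commute[of "c _", symmetric] sc_hom algebra_simps)
  finally have e: "(y - sc l) * ?g = - sc ?m" using c by simp
  have "(y - sc l) * (?g * sc (- inverse ?m)) = 1"
    unfolding mult.assoc[symmetric] e using l by (simp add: sc_minus sc_hom(4)[symmetric] sc_hom(2))
  then show thesis by (rule that[rotated]) (intro smooth_closed(2,3) smooth_sum q(1))
qed

lemma index_zero_resolvent_const:
  assumes y: "y \<in> smooth" and c: "(\<Sum>k\<le>N. sc (c k) * y ^ k) = 0"
    and l: "(\<Sum>k\<le>N. c k * l ^ k) \<noteq> 0" "(\<Sum>k\<le>N. c k * m ^ k) \<noteq> 0"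
  shows "index_zero (T (y - sc l)) \<longleftrightarrow> index_zero (T (y - sc m))"
proof -
  let ?\<Omega> = "- {l. (\<Sum>k\<le>N. c k * l ^ k) = 0}"
  have "\<exists>k\<le>N. c k \<noteq> 0" using l(1) by (metis (no_types, lifting) atMost_iff mult_zero_left sum.neutral)
  then have "finite {l. (\<Sum>k\<le>N. c k * l ^ k) = 0}" using polyfun_roots_finite[of c] by blast
  then have "connected ?\<Omega>"
    by (intro path_connected_imp_connected path_connected_complement_countable) (auto intro: countable_finite)
  then show ?thesis
  proof (rule connected_local_const)
    show "l \<in> ?\<Omega>" "m \<in> ?\<Omega>" using l by auto
    show "\<forall>a\<in>?\<Omega>. \<forall>\<^sub>F b in at a within ?\<Omega>. index_zero (T (y - sc a)) = index_zero (T (y - sc b))"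
    proof
      fix a assume "a \<in> ?\<Omega>"
      then obtain z where z: "z \<in> smooth" "(y - sc a) * z = 1" using resolvent[OF y c] by auto
      have "index_zero (T (y - sc a)) = index_zero (T (y - sc b))" if b: "dist b a < inverse (norm z + 1)" for b
      proof -
        \<comment> \<open>Chosen so that \<open>(y - sc a) * w = y - sc b\<close>. The bound on
          \<open>b\<close> puts \<open>w\<close> at distance less than 1 from the identity; the
          \<open>+ 1\<close> in it spares the question whether \<open>norm z\<close> is
          zero.\<close>
        define w where "w = 1 - sc (b - a) * z"
        have n: "norm z + 1 > 0" by (simp add: add_nonneg_pos)
        have "norm (w - 1) \<le> cmod (b - a) * norm z" using norm_mult_ineq[of "sc (b - a)" z] by (simp add: w_def norm_sc)
        also have "\<dots> \<le> inverse (norm z + 1) * norm z" using b by (intro mult_right_mono) (auto simp: dist_norm)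
        also have "\<dots> < 1" using n by (simp add: field_simps)
        finally obtain h where h: "T w * h = 1" "h * T w = 1" using T_inverse by blast
        have ws: "w \<in> smooth" unfolding w_def by (intro smooth_diff smooth_closed z)
        have "(y - sc a) * w = (y - sc a) - sc (b - a) * ((y - sc a) * z)"
          unfolding w_def sc_commute[of "b - a"] by (simp add: right_diff_distrib mult.assoc)
        then have "y - sc b = (y - sc a) * w" using z(2) by (simp add: sc_diff)
        then have "T (y - sc b) - T (y - sc a) * T w \<in> K"
          using T_mult[of "y - sc a" w] ws K_left by (simp add: smooth_def)
        then show ?thesis by (rule index_zero_mult_iff[OF h])
      qed
      moreover have "inverse (norm z + 1) > 0" by (simp add: add_nonneg_pos)
      ultimately show "\<forall>\<^sub>F b in at a within ?\<Omega>. index_zero (T (y - sc a)) = index_zero (T (y - sc b))"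
        unfolding eventually_at by blast
    qed
  qed
qed

text \<open>Factor \<open>y - sc l\<close> as \<open>sc (- l)\<close> times an element close to 1.
  Scalars commute with \<open>P\<close>, so \<open>T\<close> is exactly multiplicative on this
  product, and the compressions of both factors are invertible.\<close>

lemma index_zero_large:
  assumes "norm y < cmod l" shows "index_zero (T (y - sc l))"
proof -
  have l: "l \<noteq> 0" using assms norm_ge_zero[of y] by auto
  define w where "w = 1 - sc (inverse l) * y"
  have "norm (w - 1) \<le> inverse (cmod l) * norm y"
    using norm_mult_ineq[of "sc (inverse l)" y] by (simp add: w_def norm_sc norm_inverse)
  also have "\<dots> < 1" using assms l by (simp add: field_simps)
  finally obtain h where h: "T w * h = 1" "h * T w = 1" using T_inverse by blast
  have "y - sc l = sc (- l) * w"
    using l by (simp add: w_def algebra_simps sc_minus mult.assoc[symmetric] sc_hom(4)[symmetric] sc_hom(2))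
  moreover have "P * sc (- l) * ((1 - P) * w * P) = 0"
    unfolding sc_commute[of "- l", symmetric] mult.assoc[symmetric] by (simp add: mult.assoc[of _ P "1 - P"] P_compl)
  ultimately have e: "T (y - sc l) = T (sc (- l)) * T w" using T_mult[of "sc (- l)" w] by simp
  have Ts: "T (sc d) = sc d * P + (1 - P)" for d by (simp only: T_def sc_commute[of d P, symmetric] mult.assoc PP)
  have Tm: "T (sc d) * T (sc (inverse d)) = 1" if "d \<noteq> 0" for d
  proof -
    have "sc d * P * (sc (inverse d) * P) = (sc d * sc (inverse d)) * (P * P)"
      unfolding sc_commute[of "inverse d" P] by (simp only: mult.assoc[symmetric] sc_commute[of "inverse d" "sc d * P * P", symmetric])
        (simp only: mult.assoc sc_commute[of "inverse d" "sc d", symmetric])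
    then have "sc d * P * (sc (inverse d) * P) = P" using that by (simp add: sc_hom(4)[symmetric] sc_hom(2) PP)
    moreover have "sc d * P * (1 - P) = 0" by (simp only: mult.assoc P_compl mult_zero_right)
    moreover have "(1 - P) * (sc (inverse d) * P) = 0"
      by (simp only: sc_commute[of _ P] mult.assoc[symmetric] P_compl mult_zero_left)
    ultimately show ?thesis unfolding Ts by (simp add: distrib_left distrib_right P_compl)
  qed
  have "T (sc (- l)) * T w * (h * T (sc (inverse (- l)))) = T (sc (- l)) * (T w * h) * T (sc (inverse (- l)))"
    "(h * T (sc (inverse (- l)))) * (T (sc (- l)) * T w) = h * (T (sc (inverse (- l))) * T (sc (- l))) * T w"
    by (simp_all only: mult.assoc)
  then have "T (y - sc l) * (h * T (sc (inverse (- l)))) = 1" "(h * T (sc (inverse (- l)))) * T (y - sc l) = 1"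
    using h Tm[of "- l"] Tm[of "inverse (- l)"] l by (simp_all add: e)
  then show ?thesis unfolding index_zero_def using K_zero by (metis add_0_right)
qed

theorem compression_of_isometry_invertible:
  assumes s: "s' * s = 1" "norm s' \<le> 1" "(1 - P) * s * P = 0"
    and y: "y \<in> smooth" "norm (y - s) < 1"
    and c: "(\<Sum>k\<le>N. sc (c k) * y ^ k) = 0" "i \<le> N" "c i \<noteq> 0"
  shows "T s * T s' = 1"
proof -
  have "norm (s' * (y - s)) \<le> norm s' * norm (y - s)" by (rule norm_mult_ineq)
  also have "\<dots> \<le> norm (y - s)" using s(2) mult_right_mono[of "norm s'" 1 "norm (y - s)"] by simp
  finally have "norm (s' * y - 1) < 1" using y s(1) by (simp add: right_diff_distrib)
  \<comment> \<open>\<open>h * s'\<close> is a left inverse of \<open>y\<close>; it will cancel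
    powers of \<open>y\<close> from the left.\<close>
  then obtain h where h: "h * (s' * y) = 1" by (rule inverse_near_one)
  \<comment> \<open>The order of the root 0. After division by \<open>y ^ m\<close> the constant
    term is \<open>c m\<close>, which is nonzero, so 0 is no longer a root and the deformation may
    end there.\<close>
  define m where "m = (LEAST k. c k \<noteq> 0)"
  have m: "c m \<noteq> 0" "m \<le> i" and m': "\<And>k. k < m \<Longrightarrow> c k = 0"
    unfolding m_def using LeastI[of "\<lambda>k. c k \<noteq> 0", OF c(3)] Least_le[of "\<lambda>k. c k \<noteq> 0", OF c(3)] not_less_Least
    by auto
  define d where "d = (\<lambda>k. c (k + m))"
  have "(\<Sum>k\<le>N. sc (c k) * y ^ k) = (\<Sum>k\<in>{m..N}. sc (c k) * y ^ k)"
    by (rule sum.mono_neutral_right) (auto simp: m' sc_hom not_le)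
  also have "{m..N} = (\<lambda>k. k + m) ` {..N - m}"
    using m(2) c(2) by (simp add: atMost_atLeast0 image_add_atLeastAtMost')
  also have "(\<Sum>k\<in>(\<lambda>k. k + m) ` {..N - m}. sc (c k) * y ^ k) = y ^ m * (\<Sum>k\<le>N - m. sc (d k) * y ^ k)"
    by (subst sum.reindex) (auto simp: d_def sum_distrib_left mult.assoc[symmetric] sc_commute[of _ "y ^ m", symmetric]
      power_add[symmetric] add.commute mult.assoc intro!: sum.cong)
  finally have 0: "y ^ m * (\<Sum>k\<le>N - m. sc (d k) * y ^ k) = 0" using c(1) by simp
  have "(h * s') ^ k * y ^ k = 1" for k
  proof (induction k)
    case (Suc k)
    have "(h * s') ^ Suc k * y ^ Suc k = (h * s') ^ k * ((h * s') * y) * y ^ k"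
      by (simp only: power_Suc2[of "h * s'"] power_Suc[of y] mult.assoc)
    then show ?case using Suc h by (simp add: mult.assoc)
  qed simp
  then have "(\<Sum>k\<le>N - m. sc (d k) * y ^ k) = (h * s') ^ m * (y ^ m * (\<Sum>k\<le>N - m. sc (d k) * y ^ k))"
    by (simp only: mult.assoc[symmetric] mult_1)
  then have d: "(\<Sum>k\<le>N - m. sc (d k) * y ^ k) = 0" by (simp only: 0 mult_zero_right)
  have d0: "(\<Sum>k\<le>N - m. d k * 0 ^ k) \<noteq> 0"
  proof -
    have "(\<Sum>k\<le>N - m. d k * 0 ^ k) = (\<Sum>k\<in>{0}. d k * 0 ^ k)" by (rule sum.mono_neutral_right) auto
    then show ?thesis using m(1) by (simp add: d_def)
  qed
  \<comment> \<open>Finitely many roots leave room for a real \<open>r\<close> above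
    \<open>norm y\<close> that is not one of them; this is where the deformation starts.\<close>
  have "finite {l. (\<Sum>k\<le>N - m. d k * l ^ k) = 0}"
    using polyfun_roots_finite[of d 0 "N - m"] m(1) by (simp add: d_def)
  moreover have "infinite (complex_of_real ` {norm y<..})" by (simp add: finite_image_iff inj_on_def infinite_Ioi)
  ultimately have "\<not> complex_of_real ` {norm y<..} \<subseteq> {l. (\<Sum>k\<le>N - m. d k * l ^ k) = 0}" using finite_subset by blast
  then obtain r where r: "norm y < r" "(\<Sum>k\<le>N - m. d k * complex_of_real r ^ k) \<noteq> 0" by auto
  have "index_zero (T (y - sc (complex_of_real r)))" using r norm_ge_zero[of y] by (intro index_zero_large) auto
  then have "index_zero (T (y - sc 0))"
    using index_zero_resolvent_const[OF y(1) d r(2) d0] by blast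
  then obtain g g' k where g: "g * g' = 1" "g' * g = 1" "k \<in> K" "T y = g + k"
    by (auto simp: index_zero_def sc_hom)
  \<comment> \<open>The error term of \<open>T_mult\<close> vanishes exactly, because
    \<open>(1 - P) * s * P = 0\<close>.\<close>
  have Ts: "T s' * T s = 1" using T_mult[of s' s] s by (simp add: T_one)
  have "T s' * T y - 1 = T s' * (P * (y - s) * P)" 
    by (simp only: T_diff[of y s, symmetric] right_diff_distrib[of "T s'"] Ts)
  also have "\<dots> = P * (s' * P * (y - s)) * P" by (simp add: T_def algebra_simps PP PPx)
  finally have "norm (T s' * T y - 1) \<le> norm (s' * P * (y - s))" using norm_T_diff by simp
  also have "\<dots> \<le> norm s' * norm P * norm (y - s)"
    by (meson norm_ge_zero norm_mult_ineq mult_right_mono order_trans)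
  also have "\<dots> \<le> 1 * 1 * norm (y - s)" using s(2) norm_P by (intro mult_mono) auto
  finally obtain u where u: "T s' * T y * u = 1" "u * (T s' * T y) = 1"
    using inverse_near_one[of "T s' * T y"] y(2) by auto
  have Ty: "T y = g * (1 + g' * k)" using g by (simp add: distrib_left mult.assoc[symmetric])
  \<comment> \<open>The left inverse of \<open>T y\<close> becomes one of \<open>1 + g' * k\<close>,
    which the alternative for \<open>K\<close> turns into a two-sided inverse.\<close>
  have "(u * T s' * g) * (1 + g' * k) = 1" using u(2) unfolding Ty by (simp add: mult.assoc)
  then have "(1 + g' * k) * (u * T s' * g) = 1" using fredholm_alternative K_left g(3) by blast
  then have "T y * (u * T s') * g * g' = g * g'" unfolding Ty by (simp add: mult.assoc)
  then have R: "T y * u * T s' = 1" using g(1) by (simp add: mult.assoc)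
  \<comment> \<open>Multiplying \<open>R\<close> by \<open>T s\<close> from the right identifies
    \<open>T s\<close> with \<open>T y * u\<close>, so \<open>R\<close> is already the
    claim.\<close>
  then have "T s = T y * u * (T s' * T s)" by (simp add: mult.assoc[symmetric])
  then show ?thesis using R Ts by simp
qed

end

section \<open>Compact operators\<close>

text \<open>Real spans are enough: finite complex dimension and finite real dimension are the same
  condition.\<close>

definition finite_rank :: "bop \<Rightarrow> bool" where
  "finite_rank R \<longleftrightarrow> (\<exists>B. finite B \<and> range (app R) \<subseteq> span B)"

definition compact_ops :: "bop set" where
  "compact_ops = {T. \<forall>e>0. \<exists>R. finite_rank R \<and> norm (T - R) < e}"

lemma linear_app: "linear (app T)"
  by (intro bounded_linear.linear blinfun.bounded_linear_right)

lemma finite_rank_add: assumes "finite_rank R" "finite_rank S" shows "finite_rank (R + S)"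
proof -
  obtain B C where "finite B" "range (app R) \<subseteq> span B" "finite C" "range (app S) \<subseteq> span C"
    using assms by (auto simp: finite_rank_def)
  moreover have "span B \<subseteq> span (B \<union> C)" "span C \<subseteq> span (B \<union> C)" by (auto intro: span_mono[THEN subsetD])
  ultimately show ?thesis
    unfolding finite_rank_def by (intro exI[of _ "B \<union> C"]) (auto intro!: span_add)
qed

lemma finite_rank_left: assumes "finite_rank R" shows "finite_rank (T * R)"
proof -
  obtain B where B: "finite B" "range (app R) \<subseteq> span B" using assms by (auto simp: finite_rank_def)
  have "range (app (T * R)) \<subseteq> app T ` span B" using B by auto
  also have "\<dots> = span (app T ` B)" by (rule linear_span_image[OF linear_app, symmetric])
  finally show ?thesis unfolding finite_rank_def using B by blast
qed

lemma finite_rank_right: "finite_rank R \<Longrightarrow> finite_rank (R * T)"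
  unfolding finite_rank_def by auto

lemma finite_rank_imp_compact: "finite_rank R \<Longrightarrow> R \<in> compact_ops"
  unfolding compact_ops_def by (auto intro!: exI[of _ R])

text \<open>The one surviving complex coordinate occupies two real directions, hence two spanning
  vectors.\<close>

lemma finite_rank_delta:
  assumes "\<And>x w. w \<noteq> m \<Longrightarrow> coord (app R x) w = 0" shows "finite_rank R"
proof -
  have "app R x \<in> span {delta m, imul (delta m)}" for x
  proof -
    let ?c = "coord (app R x) m"
    have "app R x = Re ?c *\<^sub>R delta m + Im ?c *\<^sub>R imul (delta m)"
      by (rule ell2_eqI) (auto simp: assms coord_simps coord_imul coord_delta complex_eq_iff)
    then show ?thesis by (metis insertI1 insertI2 span_add span_base span_scale)
  qed
  then show ?thesis unfolding finite_rank_def by (intro exI[of _ "{delta m, imul (delta m)}"]) auto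
qed

lemma compact_ops_closed:
  assumes "\<And>e. e > 0 \<Longrightarrow> \<exists>S\<in>compact_ops. norm (T - S) < e" shows "T \<in> compact_ops"
  unfolding compact_ops_def
proof (intro CollectI allI impI)
  fix e :: real assume "e > 0"
  then obtain S where S: "S \<in> compact_ops" "norm (T - S) < e/2" using assms[of "e/2"] by auto
  then obtain R where R: "finite_rank R" "norm (S - R) < e/2" using \<open>e > 0\<close> unfolding compact_ops_def by (auto dest: spec[of _ "e/2"])
  have "norm (T - R) < e" using norm_triangle_ineq[of "T - S" "S - R"] S R by simp
  then show "\<exists>R. finite_rank R \<and> norm (T - R) < e" using R by blast
qed

lemma compact_ops_add: assumes "S \<in> compact_ops" "T \<in> compact_ops" shows "S + T \<in> compact_ops"
  unfolding compact_ops_def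
proof (intro CollectI allI impI)
  fix e :: real assume "e > 0"
  then obtain R R' where R: "finite_rank R" "norm (S - R) < e/2" "finite_rank R'" "norm (T - R') < e/2"
    using assms unfolding compact_ops_def by (fastforce dest: spec[of _ "e/2"])
  have "norm (S + T - (R + R')) < e"
    using norm_triangle_ineq[of "S - R" "T - R'"] R by (simp add: algebra_simps)
  then show "\<exists>R. finite_rank R \<and> norm (S + T - R) < e" using finite_rank_add R by blast
qed

lemma compact_ops_mult: assumes "S \<in> compact_ops" shows "T * S \<in> compact_ops" "S * T \<in> compact_ops"
proof -
  have n: "norm T + 1 > 0" by (simp add: add_nonneg_pos)
  have "\<exists>R. finite_rank R \<and> norm (S - R) * (norm T + 1) < e" if "e > 0" for e
  proof -
    have "e / (norm T + 1) > 0" using n that by simp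
    then obtain R where "finite_rank R" "norm (S - R) < e / (norm T + 1)"
      using assms unfolding compact_ops_def by blast
    then show ?thesis using n by (auto simp: field_simps)
  qed
  then have *: "\<exists>R. finite_rank R \<and> norm (S - R) * norm T < e" if "e > 0" for e
    using that by (smt (verit) mult_left_mono norm_ge_zero)
  have "\<exists>R. finite_rank R \<and> norm (T * S - R) < e" if e: "e > 0" for e
  proof -
    obtain R where R: "finite_rank R" "norm (S - R) * norm T < e" using *[OF e] by blast
    have "norm (T * S - T * R) < e"
      using norm_mult_ineq[of T "S - R"] R by (simp add: right_diff_distrib mult.commute)
    then show ?thesis using finite_rank_left R by blast
  qed
  then show "T * S \<in> compact_ops" by (simp add: compact_ops_def)
  have "\<exists>R. finite_rank R \<and> norm (S * T - R) < e" if e: "e > 0" for e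
  proof -
    obtain R where R: "finite_rank R" "norm (S - R) * norm T < e" using *[OF e] by blast
    have "norm (S * T - R * T) < e"
      using norm_mult_ineq[of "S - R" T] R by (simp add: left_diff_distrib)
    then show ?thesis using finite_rank_right R by blast
  qed
  then show "S * T \<in> compact_ops" by (simp add: compact_ops_def)
qed

text \<open>\<open>1 + R\<close> maps the span of \<open>B\<close>, which contains the range of
  \<open>R\<close>, injectively into itself, hence onto itself. The image of any \<open>y\<close>
  differs from \<open>y\<close> by \<open>R y\<close>, and this can be corrected inside the
  span.\<close>

lemma surj_finite_rank_perturbation:
  assumes R: "finite_rank R" and inj: "inj (app (1 + R))"
  shows "surj (app (1 + R))"
proof -
  obtain B0 where B0: "finite B0" "range (app R) \<subseteq> span B0" using R by (auto simp: finite_rank_def)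
  obtain B where B: "B \<subseteq> B0" "independent B" "B0 \<subseteq> span B" by (rule real_vector.maximal_independent_subset)
  have fB: "finite B" using B B0 finite_subset by blast
  have RB: "app R x \<in> span B" for x
    using B0(2) span_mono[OF B(3)] by (auto simp: span_span)
  let ?f = "app (1 + R)"
  have fs: "?f ` B \<subseteq> span B" using span_add[OF span_base RB] by auto
  have i: "independent (?f ` B)"
    by (rule linear_independent_injective_image[OF linear_app B(2)]) (use inj in \<open>auto intro: inj_on_subset[OF inj]\<close>)
  have c: "card (?f ` B) = card B" by (rule card_image) (rule inj_on_subset[OF inj], simp)
  \<comment> \<open>Otherwise \<open>b\<close> and the images of \<open>B\<close> would be
    \<open>card B + 1\<close> independent vectors in the span of \<open>B\<close>.\<close>
  have "b \<in> span (?f ` B)" if b: "b \<in> B" for b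
  proof (rule ccontr)
    assume n: "b \<notin> span (?f ` B)"
    then have "independent (insert b (?f ` B))" using i by (simp add: independent_insertI)
    moreover have "insert b (?f ` B) \<subseteq> span B" using fs b by (auto intro: span_base)
    ultimately have "card (insert b (?f ` B)) \<le> card B" using real_vector.independent_span_bound[OF fB] by blast
    moreover have "b \<notin> ?f ` B" using n span_base[of b "?f ` B"] by metis
    ultimately show False using fB c by simp
  qed
  then have "B \<subseteq> span (?f ` B)" by blast
  then have "span B \<subseteq> span (?f ` B)" by (rule span_minimal) (rule subspace_span)
  then have sB: "span B \<subseteq> ?f ` span B" unfolding linear_span_image[OF linear_app] .
  have "y \<in> range ?f" for y
  proof -
    have "- app R y \<in> span B" using RB by (rule span_neg)
    then obtain m where m: "- app R y = ?f m" using sB by blast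
    have "y = ?f (y + m)" using m by (simp add: algebra_simps) (metis add.assoc add.left_inverse add.right_neutral m)
    then show ?thesis by blast
  qed
  then show ?thesis by blast
qed

text \<open>Up to an error of norm less than 1, \<open>K\<close> has finite rank. Factoring out the
  invertible \<open>G\<close> leaves \<open>1 + R'\<close> with \<open>R'\<close> of finite rank;
  the left inverse makes it injective, hence surjective.\<close>

lemma fredholm_alternative:
  assumes K: "K \<in> compact_ops" and x: "x * (1 + K) = 1" shows "(1 + K) * x = 1"
proof -
  obtain R where R: "finite_rank R" "norm (K - R) < 1" using K unfolding compact_ops_def by (auto dest: spec[of _ 1])
  define G where "G = 1 + (K - R)"
  obtain h where h: "G * h = 1" "h * G = 1" by (rule inverse_near_one[of G]) (use R in \<open>simp add: G_def\<close>)
  define R' where "R' = h * R"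
  have R': "finite_rank R'" unfolding R'_def by (rule finite_rank_left[OF R(1)])
  have KG: "1 + K = G * (1 + R')"
    using h by (simp add: R'_def distrib_left mult.assoc[symmetric]) (simp add: G_def)
  have L: "(x * G) * (1 + R') = 1" using x KG by (simp add: mult.assoc)
  have app_L: "app (x * G) (app (1 + R') v) = v" for v using arg_cong[OF L, of "\<lambda>T. app T v"] by simp
  then have "inj (app (1 + R'))" by (metis injI)
  then have surj: "surj (app (1 + R'))" by (rule surj_finite_rank_perturbation[OF R'])
  have "(1 + R') * (x * G) = 1"
  proof (rule bop_eqI)
    fix v
    obtain u where u: "v = app (1 + R') u" using surj by (metis surjD)
    have "app ((1 + R') * (x * G)) v = app (1 + R') (app (x * G) v)" by (rule app_simps(7))
    then show "app ((1 + R') * (x * G)) v = app 1 v" unfolding u app_L by simp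
  qed
  then have "G * ((1 + R') * (x * G)) * h = 1" using h by simp
  then show ?thesis unfolding KG using h by (simp add: mult.assoc)
qed

section \<open>Bounded operators as a C*-algebra\<close>

definition bop_cstar :: "bop cstar" where
  "bop_cstar = \<lparr>carrier = UNIV, monoid.mult = (*), one = 1, zero = 0, add = (+), module.smult = (\<lambda>c x. cscalar c * x),
     star = adj, cnorm = norm\<rparr>"

lemma bop_cstar_simps [simp]:
  "carrier bop_cstar = UNIV" "x \<otimes>\<^bsub>bop_cstar\<^esub> y = x * y" "\<one>\<^bsub>bop_cstar\<^esub> = 1" "\<zero>\<^bsub>bop_cstar\<^esub> = 0" "x \<oplus>\<^bsub>bop_cstar\<^esub> y = x + y"
  "c \<odot>\<^bsub>bop_cstar\<^esub> x = cscalar c * x" "x\<^sup>\<star>\<^bsub>bop_cstar\<^esub> = adj x" "cnorm bop_cstar x = norm x"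
  by (simp_all add: bop_cstar_def)

lemma bop_unital_cstar: "unital_cstar_algebra bop_cstar"
proof -
  have "abelian_group bop_cstar"
  proof (rule abelian_groupI)
    show "\<exists>y\<in>carrier bop_cstar. y \<oplus>\<^bsub>bop_cstar\<^esub> x = \<zero>\<^bsub>bop_cstar\<^esub>" for x
      by (rule bexI[of _ "- x"]) auto
  qed (auto simp: add.assoc add.commute)
  then interpret abelian_group bop_cstar .
  interpret pre_cstar_algebra bop_cstar
  proof
    fix c and x y :: bop
    show "x \<otimes>\<^bsub>bop_cstar\<^esub> (c \<odot>\<^bsub>bop_cstar\<^esub> y) = c \<odot>\<^bsub>bop_cstar\<^esub> (x \<otimes>\<^bsub>bop_cstar\<^esub> y)"
      using cscalar_commute[of c x] by (simp add: mult.assoc[symmetric])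
    show "(c \<odot>\<^bsub>bop_cstar\<^esub> x)\<^sup>\<star>\<^bsub>bop_cstar\<^esub> = cnj c \<odot>\<^bsub>bop_cstar\<^esub> x\<^sup>\<star>\<^bsub>bop_cstar\<^esub>"
      by (simp add: adj_simps adj_cscalar cscalar_commute)
  qed (auto simp: algebra_simps adj_simps cscalar_simps norm_cscalar_mult norm_adj_mult norm_triangle_ineq norm_mult_ineq)
  have d: "cdist bop_cstar x y = dist x y" for x y
    by (simp add: cdist_eq cscalar_simps(5)[of 1] cscalar_simps(4) dist_norm)
  interpret cstar_algebra bop_cstar
  proof (rule cstar_algebraI)
    fix \<sigma> :: "nat \<Rightarrow> bop" assume "\<forall>e>0. \<exists>N. \<forall>n\<ge>N. \<forall>m\<ge>N. cdist bop_cstar (\<sigma> n) (\<sigma> m) < e"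
    then have "Cauchy \<sigma>" by (intro metric_CauchyI) (simp add: d)
    then obtain L where "\<sigma> \<longlonglongrightarrow> L" using Cauchy_convergent convergent_def by blast
    then show "\<exists>x\<in>carrier bop_cstar. \<forall>e>0. \<exists>N. \<forall>n\<ge>N. cdist bop_cstar (\<sigma> n) x < e"
      by (auto simp: d lim_sequentially)
  qed
  have "monoid bop_cstar" by (rule monoidI) (simp_all add: mult.assoc)
  then show ?thesis
    by (intro unital_cstar_algebra.intro ringI cstar_algebra_axioms abelian_group_axioms) (auto simp: algebra_simps)
qed

lemma cscalar_of_real: "cscalar (complex_of_real r) = r *\<^sub>R 1"
  by (simp add: cscalar_def)

text \<open>
  If \<open>a\<close> had smaller norm than \<open>T = \<phi> a\<close>, then \<open>1 - a\<^sup>\<star>a / \<parallel>T\<parallel>\<^sup>2\<close> would be invertible by a Neumann series,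
  whereas \<open>\<parallel>T\<parallel>\<^sup>2\<close> is an approximate eigenvalue of \<open>T\<^sup>\<star>T\<close>.
\<close>

lemma hom_bop_contractive:
  assumes U: "unital_cstar_algebra U" and \<phi>: "\<phi> \<in> unital_cstar_hom U bop_cstar" and a: "a \<in> carrier U"
  shows "norm (\<phi> a) \<le> cnorm U a"
proof (rule ccontr)
  interpret U: unital_cstar_algebra U by (rule U)
  interpret M: Metric_space "carrier U" "cdist U" by (rule U.cstar_metric)
  assume "\<not> norm (\<phi> a) \<le> cnorm U a"
  define t where "t = norm (\<phi> a)"
  have t: "cnorm U a < t" "t > 0" using \<open>\<not> _\<close> U.cnorm_nonneg[OF a] by (auto simp: t_def)
  define k where "k = complex_of_real (inverse (t\<^sup>2)) \<odot>\<^bsub>U\<^esub> (a\<^sup>\<star>\<^bsub>U\<^esub> \<otimes>\<^bsub>U\<^esub> a)"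
  have k: "k \<in> carrier U" using a by (simp add: k_def U.smult_closed U.star_closed)
  have "cnorm U k = inverse (t\<^sup>2) * (cnorm U a)\<^sup>2"
    using a U.cnorm_star_mult[OF a] by (simp add: k_def U.cnorm_smult U.star_closed norm_inverse norm_power)
  also have "\<dots> < 1"
    using t U.cnorm_nonneg[OF a] power_strict_mono[of "cnorm U a" t 2] by (simp add: field_simps)
  finally have k1: "cnorm U k < 1" .
  \<comment> \<open>The fixed point is a left inverse of \<open>1 - k\<close>. Banach's theorem
    stands in for the summation of the Neumann series, the contraction constant being the norm of
    \<open>k\<close>.\<close>
  obtain z where z: "z \<in> carrier U" "\<one>\<^bsub>U\<^esub> \<oplus>\<^bsub>U\<^esub> z \<otimes>\<^bsub>U\<^esub> k = z"
  proof (rule M.Banach_fixedpoint_thm[OF U.complete _ _ k1])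
    show "carrier U \<noteq> {}" using U.zero_closed by blast
    show "(\<lambda>z. \<one>\<^bsub>U\<^esub> \<oplus>\<^bsub>U\<^esub> z \<otimes>\<^bsub>U\<^esub> k) \<in> carrier U \<rightarrow> carrier U" using k by simp
    fix x y assume xy: "x \<in> carrier U" "y \<in> carrier U"
    have "(\<one>\<^bsub>U\<^esub> \<oplus>\<^bsub>U\<^esub> x \<otimes>\<^bsub>U\<^esub> k) \<ominus>\<^bsub>U\<^esub> (\<one>\<^bsub>U\<^esub> \<oplus>\<^bsub>U\<^esub> y \<otimes>\<^bsub>U\<^esub> k) = (x \<ominus>\<^bsub>U\<^esub> y) \<otimes>\<^bsub>U\<^esub> k"
    proof -
      have "\<one>\<^bsub>U\<^esub> \<oplus>\<^bsub>U\<^esub> (u \<oplus>\<^bsub>U\<^esub> (\<ominus>\<^bsub>U\<^esub> \<one>\<^bsub>U\<^esub> \<oplus>\<^bsub>U\<^esub> v)) = u \<oplus>\<^bsub>U\<^esub> v"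
        if "u \<in> carrier U" "v \<in> carrier U" for u v
        using that U.a_lcomm[of "\<one>\<^bsub>U\<^esub>" u "\<ominus>\<^bsub>U\<^esub> \<one>\<^bsub>U\<^esub> \<oplus>\<^bsub>U\<^esub> v"] U.r_neg2[of "\<one>\<^bsub>U\<^esub>" v] by simp
      then show ?thesis
        using xy k by (simp add: a_minus_def U.l_distr U.l_minus U.minus_add U.a_assoc)
    qed
    then show "cdist U (\<one>\<^bsub>U\<^esub> \<oplus>\<^bsub>U\<^esub> x \<otimes>\<^bsub>U\<^esub> k) (\<one>\<^bsub>U\<^esub> \<oplus>\<^bsub>U\<^esub> y \<otimes>\<^bsub>U\<^esub> k) \<le> cnorm U k * cdist U x y"
      using xy k U.cnorm_mult[of "x \<ominus>\<^bsub>U\<^esub> y" k] by (simp add: cdist_def mult.commute)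
  qed auto
  define T where "T = \<phi> a"
  have tT: "norm T = t" by (simp add: T_def t_def)
  define Z where "Z = \<phi> z"
  note h = hom_at[OF \<phi>, simplified]
  have "\<phi> (\<one>\<^bsub>U\<^esub> \<oplus>\<^bsub>U\<^esub> z \<otimes>\<^bsub>U\<^esub> k) = 1 + Z * (cscalar (complex_of_real (inverse (t\<^sup>2))) * (adj T * T))"
    using z(1) a by (simp add: h U.star_closed U.smult_closed T_def Z_def k_def)
  then have Z: "Z = 1 + inverse (t\<^sup>2) *\<^sub>R (Z * (adj T * T))" 
    unfolding cscalar_of_real z(2) Z_def by simp
  \<comment> \<open>The factor \<open>2 * (norm Z)\<^sup>2\<close> comes from the estimate in
    \<open>bound\<close>; adding 1 gives \<open>C \<ge> 1\<close>, so that
    \<open>1 - inverse C\<close> is at least 0 and less than 1.\<close>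
  define C where "C = 2 * (norm Z)\<^sup>2 + 1"
  have C: "C \<ge> 1" by (simp add: C_def)
  have bound: "(norm (app T x))\<^sup>2 \<le> t\<^sup>2 * (1 - inverse C) * (norm x)\<^sup>2" for x
  proof -
    let ?w = "app (adj T) (app T x)" and ?r = "inverse (t\<^sup>2)"
    have "app Z x = x + ?r *\<^sub>R app Z ?w" using arg_cong[OF Z, of "\<lambda>S. app S x"] by simp
    then have "x = app Z (x - ?r *\<^sub>R ?w)" by (simp add: algebra_simps)
    then have "norm x \<le> norm Z * norm (x - ?r *\<^sub>R ?w)" using norm_app_le by metis
    then have "(norm x)\<^sup>2 \<le> (norm Z * norm (x - ?r *\<^sub>R ?w))\<^sup>2" by (intro power_mono) auto
    also have "\<dots> = (norm Z)\<^sup>2 * (norm (x - ?r *\<^sub>R ?w))\<^sup>2" by (simp add: power_mult_distrib)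
    also have "(norm (x - ?r *\<^sub>R ?w))\<^sup>2 \<le> 2 * (norm x)\<^sup>2 - 2 * ?r * (norm (app T x))\<^sup>2"
    proof -
      have "(norm (x - ?r *\<^sub>R ?w))\<^sup>2 = (norm x)\<^sup>2 - 2 * ?r * (x \<bullet> ?w) + ?r\<^sup>2 * (norm ?w)\<^sup>2"
        unfolding power2_norm_eq_inner
        by (simp add: inner_diff_left inner_diff_right inner_commute power2_eq_square algebra_simps)
      moreover have "x \<bullet> ?w = (norm (app T x))\<^sup>2" by (simp add: power2_norm_eq_inner app_adj)
      moreover have "?r\<^sup>2 * (norm ?w)\<^sup>2 \<le> (norm x)\<^sup>2"
      proof -
        have "norm ?w \<le> t * (t * norm x)"
          using norm_app_le[of "adj T" "app T x"] mult_left_mono[OF norm_app_le[of T x] norm_ge_zero[of T]]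
          unfolding norm_adj tT by linarith
        then have "?r * norm ?w \<le> norm x" using t by (simp add: field_simps power2_eq_square)
        then have "(?r * norm ?w)\<^sup>2 \<le> (norm x)\<^sup>2" by (intro power_mono) auto
        then show ?thesis by (simp add: power_mult_distrib)
      qed
      ultimately show ?thesis by simp
    qed
    finally have "(norm x)\<^sup>2 \<le> (norm Z)\<^sup>2 * (2 * (norm x)\<^sup>2 - 2 * ?r * (norm (app T x))\<^sup>2)"
      by (simp add: mult_left_mono)
    moreover have "(norm x)\<^sup>2 - ?r * (norm (app T x))\<^sup>2 \<ge> 0"
    proof -
      have "(norm (app T x))\<^sup>2 \<le> (t * norm x)\<^sup>2" using norm_app_le[of T x] by (intro power_mono) (auto simp: T_def t_def)
      then show ?thesis using t by (simp add: field_simps power_mult_distrib)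
    qed
    ultimately have "(norm x)\<^sup>2 \<le> C * ((norm x)\<^sup>2 - ?r * (norm (app T x))\<^sup>2)"
      unfolding C_def by (simp add: algebra_simps)
    then have "inverse C * (norm x)\<^sup>2 \<le> (norm x)\<^sup>2 - ?r * (norm (app T x))\<^sup>2"
      using C by (simp add: field_simps)
    then have "?r * (norm (app T x))\<^sup>2 \<le> (1 - inverse C) * (norm x)\<^sup>2" by (simp add: algebra_simps)
    then show ?thesis using t by (simp add: field_simps)
  qed
  have "inverse C \<le> 1" "inverse C > 0" using C by (auto simp: field_simps)
  then have q: "0 \<le> t\<^sup>2 * (1 - inverse C)" "t\<^sup>2 * (1 - inverse C) < t\<^sup>2" using t by (auto simp: algebra_simps)
  have "norm T \<le> sqrt (t\<^sup>2 * (1 - inverse C))"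
  proof (rule norm_bop_bound)
    fix x
    have "(norm (app T x))\<^sup>2 \<le> (sqrt (t\<^sup>2 * (1 - inverse C)) * norm x)\<^sup>2" using bound[of x] q by (simp only: power_mult_distrib real_sqrt_pow2)
    then show "norm (app T x) \<le> sqrt (t\<^sup>2 * (1 - inverse C)) * norm x" by (rule power2_le_imp_le) (use q in simp)
  qed (use q in simp)
  also have "\<dots> < sqrt (t\<^sup>2)" using q by (simp only: real_sqrt_less_iff)
  finally show False using t by (simp add: T_def t_def)
qed

lemma bop_finsum: "finite J \<Longrightarrow> finsum bop_cstar f J = sum f J"
proof (induction J rule: finite_induct)
  interpret unital_cstar_algebra bop_cstar by (rule bop_unital_cstar)
  { case empty show ?case using finsum_empty[of f] by simp
  next
    case (insert j J) then show ?case using finsum_insert[of J j f] by simp }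
qed

lemma bop_finprod_proj: "finite X \<Longrightarrow> finprod bop_cstar (\<lambda>x. proj (E x)) X = proj (\<Inter>x\<in>X. E x)"
proof (induction X rule: finite_induct)
  interpret unital_cstar_algebra bop_cstar by (rule bop_unital_cstar)
  { case empty then show ?case by (simp add: finprod_def proj_simps)
  next
    case (insert a X)
    have "finprod bop_cstar (\<lambda>x. proj (E x)) (insert a X) = proj (E a) * finprod bop_cstar (\<lambda>x. proj (E x)) X"
      using finprod_commuting(2)[of "insert a X" "\<lambda>x. proj (E x)" X a] insert by (auto simp: proj_simps Int_commute)
    then show ?case using insert by (simp add: proj_simps) }
qed

section \<open>The operators of a branching system\<close>

text \<open>A node stands for an infinite path: \<open>lab\<close> is its first vertex,
  \<open>pred\<close> the path without it. By \<open>branch\<close> every admissible vertex can be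
  put in front, and by \<open>node_eqI\<close> in one way only. All natural numbers are nodes, so
  nodes are the coordinates of \<open>ell2\<close>.\<close>

locale branching =
  fixes I :: "'i set" and A :: "'i \<Rightarrow> 'i \<Rightarrow> int" and lab :: "nat \<Rightarrow> 'i" and pred :: "nat \<Rightarrow> nat"
  assumes A01: "\<And>i j. i \<in> I \<Longrightarrow> j \<in> I \<Longrightarrow> A i j \<in> {0, 1}"
    and lab_in: "lab w \<in> I" and edge: "A (lab w) (lab (pred w)) = 1"
    and branch: "i \<in> I \<Longrightarrow> A i (lab z) = 1 \<Longrightarrow> \<exists>w. lab w = i \<and> pred w = z"
    and node_eqI: "lab v = lab w \<Longrightarrow> pred v = pred w \<Longrightarrow> v = w"
begin

text \<open>Prepends \<open>i\<close>: \<open>delta z\<close> goes to \<open>delta w\<close> for the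
  node \<open>w\<close> with label \<open>i\<close> and tail \<open>z\<close>, or to 0 if there is
  none. In coordinates this is composition with \<open>pred\<close>.\<close>

definition op :: "'i \<Rightarrow> bop" where "op i = pshift {w. lab w = i} pred"

lemma inj_pred: "inj_on pred {w. lab w = i}"
  by (rule inj_onI, rule node_eqI) auto

lemma coord_op: "coord (app (op i) x) w = (if lab w = i then coord x (pred w) else 0)"
  by (simp add: op_def coord_pshift inj_pred)

lemma coord_adj_op_pred: "lab w = i \<Longrightarrow> coord (app (adj (op i)) x) (pred w) = coord x w"
  using inj_pred[of i] by (simp add: op_def adj_pshift coord_pshift inj_on_inv_into)

lemma coord_adj_op_0: "i \<in> I \<Longrightarrow> A i (lab z) \<noteq> 1 \<Longrightarrow> coord (app (adj (op i)) x) z = 0"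
  using inj_pred[of i] edge by (auto simp: op_def adj_pshift coord_pshift inj_on_inv_into)

lemma coord_adj_op_cases:
  assumes "i \<in> I"
  obtains "coord (app (adj (op i)) x) z = 0" "A i (lab z) \<noteq> 1"
  | w where "lab w = i" "pred w = z" "coord (app (adj (op i)) x) z = coord x w" "A i (lab z) = 1"
  using coord_adj_op_0[OF assms] coord_adj_op_pred branch[OF assms] by metis

lemma adj_op_op: assumes "i \<in> I" shows "adj (op i) * op i = proj {z. A i (lab z) = 1}"
proof (intro bop_eqI ell2_eqI)
  fix x z
  show "coord (app (adj (op i) * op i) x) z = coord (app (proj {z. A i (lab z) = 1}) x) z"
    by (rule coord_adj_op_cases[OF assms, of "app (op i) x" z]) (auto simp: coord_proj coord_op)
qed

lemma op_adj_op: "op i * adj (op i) = proj {w. lab w = i}"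
  by (intro bop_eqI ell2_eqI) (simp add: coord_proj coord_op coord_adj_op_pred)

lemma matrix_prod_lab:
  assumes "X \<subseteq> I" "Y \<subseteq> I" "finite X" "finite Y"
  shows "matrix_prod A X Y (lab z) = (if (\<forall>x\<in>X. A x (lab z) = 1) \<and> (\<forall>y\<in>Y. A y (lab z) \<noteq> 1) then 1 else 0)"
proof -
  have "(\<Prod>x\<in>X. A x (lab z)) = (if \<forall>x\<in>X. A x (lab z) = 1 then 1 else 0)"
    using assms(3,1) A01[OF _ lab_in, of _ z] by (auto simp: subset_iff intro!: prod.neutral prod_zero)
  moreover have "(\<Prod>y\<in>Y. 1 - A y (lab z)) = (if \<forall>y\<in>Y. A y (lab z) \<noteq> 1 then 1 else 0)"
    using assms(4,2) A01[OF _ lab_in, of _ z] by (fastforce simp: subset_iff intro!: prod.neutral prod_zero)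
  ultimately show ?thesis by (simp add: matrix_prod_def)
qed

text \<open>The initial and final projections are all diagonal, given by conditions on the label, so
  the relations can be checked coordinate by coordinate.\<close>

theorem op_family: "exel_laca_family I A bop_cstar op"
  unfolding exel_laca_family_def Let_def
proof (intro conjI ballI allI impI)
  interpret unital_cstar_algebra bop_cstar by (rule bop_unital_cstar)
  fix i assume i: "i \<in> I"
  show "partial_isometry bop_cstar (op i)"
    by (simp add: partial_isometry_def op_adj_op) (intro bop_eqI ell2_eqI, simp add: coord_op coord_proj)
  fix j assume j: "j \<in> I"
  show "(op i)\<^sup>\<star>\<^bsub>bop_cstar\<^esub> \<otimes>\<^bsub>bop_cstar\<^esub> op i \<otimes>\<^bsub>bop_cstar\<^esub> ((op j)\<^sup>\<star>\<^bsub>bop_cstar\<^esub> \<otimes>\<^bsub>bop_cstar\<^esub> op j) =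
      (op j)\<^sup>\<star>\<^bsub>bop_cstar\<^esub> \<otimes>\<^bsub>bop_cstar\<^esub> op j \<otimes>\<^bsub>bop_cstar\<^esub> ((op i)\<^sup>\<star>\<^bsub>bop_cstar\<^esub> \<otimes>\<^bsub>bop_cstar\<^esub> op i)"
    using i j by (simp add: adj_op_op proj_simps Int_commute)
  show "(op i)\<^sup>\<star>\<^bsub>bop_cstar\<^esub> \<otimes>\<^bsub>bop_cstar\<^esub> op j = \<zero>\<^bsub>bop_cstar\<^esub>" if "i \<noteq> j"
  proof (simp, intro bop_eqI ell2_eqI)
    fix x z
    show "coord (app (adj (op i) * op j) x) z = coord (app 0 x) z"
      by (rule coord_adj_op_cases[OF i, of "app (op j) x" z]) (use that in \<open>auto simp: coord_op coord_simps\<close>)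
  qed
  show "(op i)\<^sup>\<star>\<^bsub>bop_cstar\<^esub> \<otimes>\<^bsub>bop_cstar\<^esub> op i \<otimes>\<^bsub>bop_cstar\<^esub> op j = of_int (A i j) \<odot>\<^bsub>bop_cstar\<^esub> op j"
    using i A01[OF i j]
    by (simp add: adj_op_op) (auto intro!: bop_eqI ell2_eqI simp: coord_proj coord_op coord_cscalar coord_simps)
next
  interpret unital_cstar_algebra bop_cstar by (rule bop_unital_cstar)
  fix X Y let ?J = "{j \<in> I. matrix_prod A X Y j \<noteq> 0}" and ?E = "\<lambda>i. {z. A i (lab z) = 1}"
  assume XY: "finite X \<and> X \<subseteq> I \<and> finite Y \<and> Y \<subseteq> I \<and> finite ?J"
  have "(\<Otimes>\<^bsub>bop_cstar\<^esub>x\<in>X. (op x)\<^sup>\<star>\<^bsub>bop_cstar\<^esub> \<otimes>\<^bsub>bop_cstar\<^esub> op x) = proj (\<Inter>x\<in>X. ?E x)"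
    using XY by (subst bop_finprod_proj[symmetric]) (auto intro!: finprod_cong_local adj_op_op)
  moreover have m: "\<one>\<^bsub>bop_cstar\<^esub> \<ominus>\<^bsub>bop_cstar\<^esub> x = 1 - x" for x
    using a_inv_eq[of x] by (simp add: a_minus_def cscalar_simps(5)[of 1] cscalar_simps(4))
  moreover have "(\<Otimes>\<^bsub>bop_cstar\<^esub>y\<in>Y. 1 - (op y)\<^sup>\<star>\<^bsub>bop_cstar\<^esub> \<otimes>\<^bsub>bop_cstar\<^esub> op y) = proj (\<Inter>y\<in>Y. - ?E y)"
    using XY by (subst bop_finprod_proj[symmetric]) (auto intro!: finprod_cong_local simp: adj_op_op proj_simps subset_iff)
  ultimately have L: "(\<Otimes>\<^bsub>bop_cstar\<^esub>x\<in>X. (op x)\<^sup>\<star>\<^bsub>bop_cstar\<^esub> \<otimes>\<^bsub>bop_cstar\<^esub> op x) \<otimes>\<^bsub>bop_cstar\<^esub>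
      (\<Otimes>\<^bsub>bop_cstar\<^esub>y\<in>Y. \<one>\<^bsub>bop_cstar\<^esub> \<ominus>\<^bsub>bop_cstar\<^esub> (op y)\<^sup>\<star>\<^bsub>bop_cstar\<^esub> \<otimes>\<^bsub>bop_cstar\<^esub> op y)
      = proj ((\<Inter>x\<in>X. ?E x) \<inter> (\<Inter>y\<in>Y. - ?E y))"
    by (simp add: proj_simps)
  have R: "(\<Oplus>\<^bsub>bop_cstar\<^esub>j\<in>?J. of_int (matrix_prod A X Y j) \<odot>\<^bsub>bop_cstar\<^esub> (op j \<otimes>\<^bsub>bop_cstar\<^esub> (op j)\<^sup>\<star>\<^bsub>bop_cstar\<^esub>))
     = (\<Sum>j\<in>?J. cscalar (of_int (matrix_prod A X Y j)) * proj {w. lab w = j})"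
    using XY by (simp add: bop_finsum op_adj_op)
  have "proj ((\<Inter>x\<in>X. ?E x) \<inter> (\<Inter>y\<in>Y. - ?E y)) = (\<Sum>j\<in>?J. cscalar (of_int (matrix_prod A X Y j)) * proj {w. lab w = j})"
  proof (intro bop_eqI ell2_eqI)
    fix x z
    have s: "coord (app (sum f J) x) z = (\<Sum>j\<in>J. coord (app (f j) x) z)" if "finite J" for f and J :: "'i set"
      using that by (induction J rule: finite_induct) (simp_all add: coord_simps)
    have "coord (app (\<Sum>j\<in>?J. cscalar (of_int (matrix_prod A X Y j)) * proj {w. lab w = j}) x) z
        = (\<Sum>j\<in>?J. of_int (matrix_prod A X Y j) * (if lab z = j then coord x z else 0))"
      using XY by (simp add: s coord_cscalar coord_proj)
    also have "\<dots> = (\<Sum>j\<in>?J. if j = lab z then of_int (matrix_prod A X Y (lab z)) * coord x z else 0)"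
      by (intro sum.cong) auto
    \<comment> \<open>A node has one label, so only \<open>j = lab z\<close> contributes; if that
      index is missing from \<open>?J\<close>, its coefficient is 0 anyway.\<close>
    also have "\<dots> = of_int (matrix_prod A X Y (lab z)) * coord x z"
      using XY lab_in[of z] by (simp add: sum.delta)
    also have "\<dots> = coord (app (proj ((\<Inter>x\<in>X. ?E x) \<inter> (\<Inter>y\<in>Y. - ?E y))) x) z"
      using XY by (simp add: matrix_prod_lab coord_proj)
    finally show "coord (app (proj ((\<Inter>x\<in>X. ?E x) \<inter> (\<Inter>y\<in>Y. - ?E y))) x) z
      = coord (app (\<Sum>j\<in>?J. cscalar (of_int (matrix_prod A X Y j)) * proj {w. lab w = j}) x) z" ..
  qed
  then show "(\<Otimes>\<^bsub>bop_cstar\<^esub>x\<in>X. (op x)\<^sup>\<star>\<^bsub>bop_cstar\<^esub> \<otimes>\<^bsub>bop_cstar\<^esub> op x) \<otimes>\<^bsub>bop_cstar\<^esub>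
      (\<Otimes>\<^bsub>bop_cstar\<^esub>y\<in>Y. \<one>\<^bsub>bop_cstar\<^esub> \<ominus>\<^bsub>bop_cstar\<^esub> (op y)\<^sup>\<star>\<^bsub>bop_cstar\<^esub> \<otimes>\<^bsub>bop_cstar\<^esub> op y)
      = (\<Oplus>\<^bsub>bop_cstar\<^esub>j\<in>?J. of_int (matrix_prod A X Y j) \<odot>\<^bsub>bop_cstar\<^esub> (op j \<otimes>\<^bsub>bop_cstar\<^esub> (op j)\<^sup>\<star>\<^bsub>bop_cstar\<^esub>))"
    unfolding L R .
qed

end

text \<open>Exactly one edge from a node to its tail, that of \<open>w0\<close>, joins
  \<open>W\<close> to its complement. Hence the off-diagonal corners of the generators and their
  adjoints have complex rank at most one.\<close>

locale cut_branching = branching +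
  fixes W :: "nat set" and w0 :: nat
  assumes W_up: "pred w \<in> W \<Longrightarrow> w \<in> W" and W_down: "w \<in> W \<Longrightarrow> w \<noteq> w0 \<Longrightarrow> pred w \<in> W"
    and w0: "w0 \<in> W" "pred w0 \<notin> W"
begin

sublocale toeplitz "proj W" compact_ops cscalar
proof
  have "finite_rank 0" unfolding finite_rank_def by (intro exI[of _ "{}"]) auto
  then show "0 \<in> compact_ops" by (rule finite_rank_imp_compact)
  show "norm (cscalar c) = cmod c" for c using norm_cscalar_mult[of c 1] by simp
  show "cscalar c * a = a * cscalar c" for c a by (rule cscalar_commute)
  show "(1 + k) * x = 1" if "k \<in> compact_ops" "x * (1 + k) = 1" for k x
    using that by (rule fredholm_alternative)
qed (simp_all add: proj_simps norm_proj_le compact_ops_add compact_ops_mult cscalar_simps)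

lemma op_invariant: "(1 - proj W) * op i * proj W = 0"
  by (intro bop_eqI ell2_eqI) (auto simp: proj_simps coord_proj coord_op coord_simps dest: W_up)

lemma op_smooth: "op i \<in> smooth"
  using K_zero by (simp add: smooth_def op_invariant)

text \<open>Removing the first vertex leads out of \<open>W\<close> only from \<open>w0\<close>, so
  the corner can produce nothing but multiples of \<open>delta (pred w0)\<close>.\<close>

lemma adj_op_smooth: assumes "i \<in> I" shows "adj (op i) \<in> smooth"
proof -
  have "coord (app ((1 - proj W) * adj (op i) * proj W) x) z = 0" if z: "z \<noteq> pred w0" for x z
  proof (rule coord_adj_op_cases[OF assms, of "app (proj W) x" z])
    fix w assume "lab w = i" "pred w = z" and e: "coord (app (adj (op i)) (app (proj W) x)) z = coord (app (proj W) x) w"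
    then have "z \<in> W \<or> w \<notin> W" using z W_down by blast
    then show ?thesis by (auto simp: proj_simps coord_proj e)
  qed (simp add: proj_simps coord_proj)
  then show ?thesis unfolding smooth_def by (intro CollectI finite_rank_imp_compact finite_rank_delta)
qed

lemma smooth_limit:
  assumes "\<And>e. e > 0 \<Longrightarrow> \<exists>b\<in>smooth. norm (a - b) < e" shows "a \<in> smooth"
  unfolding smooth_def
proof (intro CollectI compact_ops_closed)
  fix e :: real assume "e > 0"
  then obtain b where b: "b \<in> smooth" "norm (a - b) < e" using assms by blast
  have "(1 - proj W) * a * proj W - (1 - proj W) * b * proj W = proj (- W) * (a - b) * proj W"
    by (simp add: proj_simps algebra_simps)
  moreover have "norm (proj (- W) * (a - b) * proj W) \<le> norm (proj (- W)) * norm (a - b) * norm (proj W)"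
    by (meson norm_ge_zero norm_mult_ineq mult_right_mono order_trans)
  moreover have "norm (proj (- W)) * norm (a - b) * norm (proj W) \<le> 1 * norm (a - b) * 1"
    using norm_proj_le by (intro mult_mono) auto
  ultimately have "norm ((1 - proj W) * a * proj W - (1 - proj W) * b * proj W) < e" using b by simp
  then show "\<exists>S\<in>compact_ops. norm ((1 - proj W) * a * proj W - S) < e" using b by (auto simp: smooth_def)
qed

end

text \<open>The \<open>card G + 1\<close> powers with exponents up to \<open>card G\<close> lie in
  the span of \<open>card G\<close> vectors, so they satisfy a nontrivial relation.\<close>

lemma algebraic_of_finite_span:
  assumes G: "finite G" and y: "\<And>k. \<exists>c. y ^ k = (\<Sum>g\<in>G. cscalar (c g) * g)"
  obtains c N i where "(\<Sum>k\<le>N. cscalar (c k) * y ^ k) = 0" "i \<le> N" "c i \<noteq> 0"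
proof -
  interpret cs: vector_space "\<lambda>c (x :: bop). cscalar c * x"
    by unfold_locales (simp_all add: cscalar_simps algebra_simps)
  have sp: "y ^ k \<in> cs.span G" for k
  proof -
    obtain c where "y ^ k = (\<Sum>g\<in>G. cscalar (c g) * g)" using y by blast
    then show ?thesis by (simp only:) (intro cs.span_sum cs.span_scale cs.span_base)
  qed
  let ?N = "card G" and ?V = "(\<lambda>k. y ^ k) ` {..card G}"
  show thesis
  proof (cases "inj_on (\<lambda>k. y ^ k) {..?N}")
    case True
    have "\<not> cs.independent ?V"
    proof
      assume "cs.independent ?V"
      moreover have "?V \<subseteq> cs.span G" using sp by auto
      ultimately have "card ?V \<le> card G" using cs.independent_span_bound[OF G] by blast
      then show False using card_image[OF True] by simp
    qed
    then obtain u v where u: "(\<Sum>v\<in>?V. cscalar (u v) * v) = 0" "v \<in> ?V" "u v \<noteq> 0"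
      using cs.dependent_finite[of ?V] by auto
    then obtain i where "i \<le> ?N" "u (y ^ i) \<noteq> 0" by auto
    moreover have "(\<Sum>k\<le>?N. cscalar (u (y ^ k)) * y ^ k) = 0"
      using u(1) by (simp add: sum.reindex[OF True])
    ultimately show thesis using that[where N = ?N and c = "\<lambda>k. u (y ^ k)" and i = i] by simp
  next
    \<comment> \<open>When powers coincide, the set of powers is too small for counting dimensions,
      but the difference of two equal powers is itself a relation.\<close>
    case False
    then obtain i j where ij: "i \<le> ?N" "j \<le> ?N" "i \<noteq> j" "y ^ i = y ^ j" by (auto simp: inj_on_def)
    let ?c = "\<lambda>k. of_bool (k = i) - of_bool (k = j) :: complex"
    have "(\<Sum>k\<le>?N. cscalar (?c k) * y ^ k) = (\<Sum>k\<le>?N. (if k = i then y ^ k else 0) - (if k = j then y ^ k else 0))"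
      by (intro sum.cong refl) (auto simp: cscalar_simps)
    also have "\<dots> = y ^ i - y ^ j" using ij by (simp add: sum_subtractf)
    finally show thesis using that[where N = ?N and c = ?c and i = i] ij by simp
  qed
qed

section \<open>Exel--Laca families\<close>

locale exel_laca = unital_cstar_algebra U for U :: "('u, 'm) cstar_scheme" (structure) +
  fixes I :: "'i set" and A :: "'i \<Rightarrow> 'i \<Rightarrow> int" and S :: "'i \<Rightarrow> 'u"
  assumes family: "exel_laca_family I A U S"
    and A01: "\<And>i j. i \<in> I \<Longrightarrow> j \<in> I \<Longrightarrow> A i j \<in> {0, 1}"
begin

definition Q :: "'i \<Rightarrow> 'u" where "Q i = (S i)\<^sup>\<star> \<otimes> S i"

definition word :: "'i list \<Rightarrow> 'u" where "word \<alpha> = foldr (\<lambda>i x. S i \<otimes> x) \<alpha> \<one>"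

definition graph_path :: "'i list \<Rightarrow> bool" where
  "graph_path \<alpha> \<longleftrightarrow> set \<alpha> \<subseteq> I \<and> successively (\<lambda>i j. A i j = 1) \<alpha>"

lemma S_closed: "i \<in> I \<Longrightarrow> S i \<in> carrier U"
  using family by (auto simp: exel_laca_family_def Let_def partial_isometry_def)

lemma Q_closed: "i \<in> I \<Longrightarrow> Q i \<in> carrier U"
  by (simp add: Q_def S_closed star_closed)

lemma Q_commute: "i \<in> I \<Longrightarrow> j \<in> I \<Longrightarrow> Q i \<otimes> Q j = Q j \<otimes> Q i"
  using family by (simp add: exel_laca_family_def Let_def Q_def)

lemma S_Q: "i \<in> I \<Longrightarrow> S i \<otimes> Q i = S i"
  using family S_closed by (auto simp: exel_laca_family_def Let_def partial_isometry_def Q_def m_assoc star_closed)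

lemma star_one: "\<one>\<^sup>\<star> = \<one>"
  using star_mult[of "\<one>\<^sup>\<star>" \<one>] star_star[of \<one>] star_closed[of \<one>] by simp

lemma Q_star: "i \<in> I \<Longrightarrow> (Q i)\<^sup>\<star> = Q i"
  by (simp add: Q_def star_mult S_closed star_closed star_star)

lemma Q_idem: "i \<in> I \<Longrightarrow> Q i \<otimes> Q i = Q i"
  using S_Q[of i] unfolding Q_def by (simp add: m_assoc S_closed star_closed)

lemma star_S_S: "i \<in> I \<Longrightarrow> j \<in> I \<Longrightarrow> i \<noteq> j \<Longrightarrow> (S i)\<^sup>\<star> \<otimes> S j = \<zero>"
  using family by (simp add: exel_laca_family_def Let_def)

lemma Q_S: "i \<in> I \<Longrightarrow> j \<in> I \<Longrightarrow> Q i \<otimes> S j = (if A i j = 1 then S j else \<zero>)"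
proof -
  assume i: "i \<in> I" and j: "j \<in> I"
  then have "Q i \<otimes> S j = of_int (A i j) \<odot> S j"
    using family by (simp add: exel_laca_family_def Let_def Q_def)
  then show ?thesis using A01[OF i j] S_closed[OF j] by (auto simp: smult_one smult_0_left)
qed

lemma S_S_zero: "i \<in> I \<Longrightarrow> j \<in> I \<Longrightarrow> A i j \<noteq> 1 \<Longrightarrow> S i \<otimes> S j = \<zero>"
  using S_Q[of i] Q_S[of i j] m_assoc[of "S i" "Q i" "S j"] S_closed Q_closed by simp

lemma word_simps [simp]: "word [] = \<one>" "word (i # \<alpha>) = S i \<otimes> word \<alpha>"
  by (simp_all add: word_def)

lemma word_closed: "set \<alpha> \<subseteq> I \<Longrightarrow> word \<alpha> \<in> carrier U"
  by (induction \<alpha>) (auto simp: S_closed)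

lemma Q_word:
  assumes "i \<in> I" "j \<in> I" "set \<alpha> \<subseteq> I"
  shows "Q i \<otimes> word (j # \<alpha>) = (if A i j = 1 then word (j # \<alpha>) else \<zero>)"
  using Q_S[OF assms(1,2)] m_assoc[of "Q i" "S j" "word \<alpha>"] assms Q_closed S_closed word_closed by auto

text \<open>The innermost pair forms \<open>Q i\<close>, which fixes the next vertex of the path;
  repeating this leaves the projection of the last vertex.\<close>

lemma word_star_word: "graph_path (i # \<alpha>) \<Longrightarrow> (word (i # \<alpha>))\<^sup>\<star> \<otimes> word (i # \<alpha>) = Q (last (i # \<alpha>))"
proof (induction \<alpha> arbitrary: i)
  case Nil
  then show ?case by (simp add: graph_path_def Q_def S_closed)
next
  case (Cons j \<beta>)
  let ?w = "word (j # \<beta>)"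
  have I: "i \<in> I" "j \<in> I" "set \<beta> \<subseteq> I" "A i j = 1" "graph_path (j # \<beta>)" using Cons.prems by (auto simp: graph_path_def)
  have w: "?w \<in> carrier U" using I by (simp add: word_closed S_closed)
  have "(word (i # j # \<beta>))\<^sup>\<star> \<otimes> word (i # j # \<beta>) = (?w\<^sup>\<star> \<otimes> (S i)\<^sup>\<star>) \<otimes> (S i \<otimes> ?w)"
    using I w by (simp del: word_simps(2) add: word_simps(2)[of i "j # \<beta>"] star_mult S_closed)
  also have "\<dots> = ?w\<^sup>\<star> \<otimes> (Q i \<otimes> ?w)"
    using I w by (simp del: word_simps add: Q_def m_assoc star_closed S_closed)
  also have "\<dots> = ?w\<^sup>\<star> \<otimes> ?w" using Q_word[OF I(1,2,3)] I(4) by simp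
  also have "\<dots> = Q (last (j # \<beta>))" by (rule Cons.IH[OF I(5)])
  finally show ?case by simp
qed

lemma generated_closed:
  defines "D \<equiv> cstar_generated U (S ` I)"
  shows "cstar_subalgebra U D" "S ` I \<subseteq> D" "D \<subseteq> carrier U" "\<zero> \<in> D"
    "x \<in> D \<Longrightarrow> y \<in> D \<Longrightarrow> x \<oplus> y \<in> D" "x \<in> D \<Longrightarrow> y \<in> D \<Longrightarrow> x \<otimes> y \<in> D"
    "x \<in> D \<Longrightarrow> x\<^sup>\<star> \<in> D" "x \<in> D \<Longrightarrow> c \<odot> x \<in> D"
proof -
  show "cstar_subalgebra U D" unfolding D_def by (rule cstar_subalgebra_generated) (use S_closed in auto)
  then show "D \<subseteq> carrier U" "\<zero> \<in> D"
    "x \<in> D \<Longrightarrow> y \<in> D \<Longrightarrow> x \<oplus> y \<in> D" "x \<in> D \<Longrightarrow> y \<in> D \<Longrightarrow> x \<otimes> y \<in> D"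
    "x \<in> D \<Longrightarrow> x\<^sup>\<star> \<in> D" "x \<in> D \<Longrightarrow> c \<odot> x \<in> D"
    unfolding cstar_subalgebra_def by auto
  show "S ` I \<subseteq> D" unfolding D_def cstar_generated_def by (rule hull_subset)
qed

lemma word_generated: "set \<alpha> \<subseteq> I \<Longrightarrow> \<alpha> \<noteq> [] \<Longrightarrow> word \<alpha> \<in> cstar_generated U (S ` I)"
proof (induction \<alpha>)
  case (Cons i \<alpha>)
  then show ?case using generated_closed(2,6) S_closed by (cases \<alpha>) auto
qed simp

end

section \<open>From finite-dimensional approximation to the index obstruction\<close>

lemma sum_finsum_hom:
  assumes "abelian_group B" and f: "f \<in> X \<rightarrow> carrier B" and X: "finite X"
    and add: "\<And>x y. x \<in> carrier B \<Longrightarrow> y \<in> carrier B \<Longrightarrow> \<phi> (x \<oplus>\<^bsub>B\<^esub> y) = \<phi> x + \<phi> y" and zero: "\<phi> \<zero>\<^bsub>B\<^esub> = 0"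
  shows "\<phi> (finsum B f X) = (\<Sum>x\<in>X. \<phi> (f x))"
proof -
  interpret abelian_group B by (rule assms(1))
  show ?thesis using X f
  proof (induction X)
    case (insert x X)
    have "f \<in> X \<rightarrow> carrier B" "f x \<in> carrier B" using insert.prems by auto
    then show ?case using insert.IH insert.hyps by (simp add: add finsum_closed)
  qed (simp add: zero)
qed

text \<open>The approximating algebras need not contain the unit of \<open>U\<close>. So
  \<open>s\<close> and \<open>p\<close> are approximated within one of them, and the powers of
  \<open>1 + (\<phi> x - \<phi> r)\<close> lie in the span of its image and 1, which still has
  finite dimension.\<close>

lemma (in exel_laca) AF_imp_algebraic_approx:
  assumes AF: "AF_algebra (exel_laca_algebra U S I)" and \<phi>: "\<phi> \<in> unital_cstar_hom U bop_cstar"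
    and sp: "s \<in> cstar_generated U (S ` I)" "p \<in> cstar_generated U (S ` I)" and e: "e > 0"
  obtains x r c N i where "x \<in> cstar_generated U (S ` I)" "r \<in> cstar_generated U (S ` I)"
    "norm (\<phi> x - \<phi> s) < e" "norm (\<phi> r - \<phi> p) < e"
    "(\<Sum>k\<le>N. cscalar (c k) * (1 + (\<phi> x - \<phi> r)) ^ k) = 0" "i \<le> N" "c i \<noteq> (0 :: complex)"
proof -
  define D where "D = cstar_generated U (S ` I)"
  let ?O = "U\<lparr>carrier := D\<rparr>"
  note D = generated_closed[folded D_def]
  note DU = subsetD[OF D(3)]
  interpret O: cstar_algebra ?O by (rule sub_cstar_algebra[OF D(1)])
  interpret M: Metric_space "carrier ?O" "cdist ?O" by (rule O.cstar_metric)
  note h = hom_at[OF \<phi>, simplified]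
  obtain F :: "nat \<Rightarrow> 'u set" where F: "\<And>n. cstar_subalgebra ?O (F n)" "\<And>n. finite_dimensional ?O (F n)"
    "\<And>n. F n \<subseteq> F (Suc n)" and cl: "cstar_topology ?O closure_of (\<Union>n. F n) = D"
    using AF unfolding AF_algebra_def exel_laca_algebra_def D_def by auto
  have mono: "F m \<subseteq> F n" if "m \<le> n" for m n using lift_Suc_mono_le[of F, OF F(3) that] .
  have FD: "F n \<subseteq> D" for n using F(1)[of n] by (simp add: cstar_subalgebra_def)
  have near: "\<exists>n y. y \<in> F n \<and> norm (\<phi> y - \<phi> x) < e" if x: "x \<in> D" for x
  proof -
    have "x \<in> M.mtopology closure_of (\<Union>n. F n)" using x cl by (simp add: cstar_topology_def)
    then obtain y where y': "y \<in> (\<Union>n. F n)" "y \<in> M.mball x e" unfolding M.metric_closure_of using e by blast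
    then obtain n where y: "y \<in> F n" "cdist ?O x y < e" unfolding M.in_mball by blast
    have yD: "y \<in> D" using y FD by auto
    have "norm (\<phi> (y \<ominus> x)) \<le> cnorm U (y \<ominus> x)"
      by (rule hom_bop_contractive[OF unital_cstar_algebra_axioms \<phi>]) (simp add: DU x yD)
    also have "\<dots> < e" using y(2) sub_cdist[OF D(1) x yD] cdist_commute[of x y] by (simp add: cdist_def DU x yD)
    finally show ?thesis using y(1) x yD DU by (auto simp: a_minus_def a_inv_eq h smult_closed cscalar_simps(5)[of 1] cscalar_simps(4))
  qed
  obtain n1 x where x: "x \<in> F n1" "norm (\<phi> x - \<phi> s) < e" using near[OF sp(1)[folded D_def]] by blast
  obtain n2 r where r: "r \<in> F n2" "norm (\<phi> r - \<phi> p) < e" using near[OF sp(2)[folded D_def]] by blast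
  define n where "n = max n1 n2"
  have xF: "x \<in> F n" and rF: "r \<in> F n" using x(1) r(1) mono[of n1 n] mono[of n2 n] by (auto simp: n_def)
  have cl: "\<zero> \<in> F n" "\<And>u v. u \<in> F n \<Longrightarrow> v \<in> F n \<Longrightarrow> u \<oplus> v \<in> F n" "\<And>u v. u \<in> F n \<Longrightarrow> v \<in> F n \<Longrightarrow> u \<otimes> v \<in> F n"
    "\<And>c u. u \<in> F n \<Longrightarrow> c \<odot> u \<in> F n"
    using F(1)[of n] by (auto simp: cstar_subalgebra_def)
  obtain G where G: "finite G" "G \<subseteq> D" "\<And>u. u \<in> F n \<Longrightarrow> \<exists>c. u = (\<Oplus>\<^bsub>?O\<^esub>g\<in>G. c g \<odot> g)"
    using F(2)[of n] by (auto simp: finite_dimensional_def)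
  define H where "H = insert 1 (\<phi> ` G)"
  interpret cs: vector_space "\<lambda>c (x :: bop). cscalar c * x"
    by unfold_locales (simp_all add: cscalar_simps algebra_simps)
  have h0: "\<phi> \<zero> = 0" using h(6)[of \<zero> 0] smult_0_left[of \<zero>] by (simp add: cscalar_simps)
  have span: "\<phi> u \<in> cs.span H" if u: "u \<in> F n" for u
  proof -
    obtain c where c: "u = (\<Oplus>\<^bsub>?O\<^esub>g\<in>G. c g \<odot> g)" using G(3)[OF u] by blast
    have "\<phi> u = (\<Sum>g\<in>G. \<phi> (c g \<odot> g))"
      unfolding c by (rule sum_finsum_hom[OF O.abelian_group_axioms]) (use G D(8) h h0 DU in auto)
    also have "\<dots> = (\<Sum>g\<in>G. cscalar (c g) * \<phi> g)" using G(2) DU by (intro sum.cong) (auto simp: h)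
    also have "\<dots> \<in> cs.span H" by (intro cs.span_sum cs.span_scale cs.span_base) (auto simp: H_def)
    finally show ?thesis .
  qed
  define b where "b = x \<oplus> (-1) \<odot> r"
  have bF: "b \<in> F n" unfolding b_def using xF rF cl by blast
  have FU: "u \<in> F n \<Longrightarrow> u \<in> carrier U" for u using FD[of n] DU by blast
  have b: "\<phi> b = \<phi> x - \<phi> r"
    using FU[OF xF] FU[OF rF] by (simp add: b_def h smult_closed cscalar_simps(5)[of 1] cscalar_simps(4))
  let ?y = "1 + (\<phi> x - \<phi> r)"
  have "\<exists>f\<in>F n. ?y ^ k = 1 + \<phi> f" for k
  proof (induction k)
    case 0 then show ?case using cl(1) h0 by (intro bexI[of _ \<zero>]) auto
  next
    case (Suc k)
    then obtain f where f: "f \<in> F n" "?y ^ k = 1 + \<phi> f" by blast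
    have "?y ^ Suc k = (1 + \<phi> b) * (1 + \<phi> f)" using f(2) by (simp add: b)
    also have "\<dots> = 1 + \<phi> (b \<oplus> (f \<oplus> b \<otimes> f))"
      using FU[OF bF] FU[OF f(1)] by (simp add: h algebra_simps)
    finally show ?case using bF f(1) cl by (intro bexI[of _ "b \<oplus> (f \<oplus> b \<otimes> f)"]) auto
  qed
  then have yk: "?y ^ k \<in> cs.span H" for k
    using span by (metis cs.span_add cs.span_base H_def insertI1)
  have fH: "finite H" using G by (simp add: H_def)
  have "\<exists>c. ?y ^ k = (\<Sum>g\<in>H. cscalar (c g) * g)" for k
    using yk[of k] unfolding cs.span_finite[OF fH] by auto
  then obtain c N i where "(\<Sum>k\<le>N. cscalar (c k) * ?y ^ k) = 0" "i \<le> N" "c i \<noteq> 0"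
    by (rule algebraic_of_finite_span[OF fH])
  then show thesis using that[where x = x and r = r and N = N and c = c and i = i] x(2) r(2) xF rF FD[of n] by (auto simp: D_def)
qed

theorem (in exel_laca) cycle_imp_not_AF:
  assumes br: "cut_branching I A lab pred W w0" and \<phi>: "\<phi> \<in> unital_cstar_hom U bop_cstar"
    and \<phi>S: "\<And>i. i \<in> I \<Longrightarrow> \<phi> (S i) = branching.op lab pred i"
    and path: "graph_path (i0 # \<alpha>)" "A (last (i0 # \<alpha>)) i0 = 1" "lab w0 = i0"
  shows "\<not> AF_algebra (exel_laca_algebra U S I)"
proof
  assume AF: "AF_algebra (exel_laca_algebra U S I)"
  interpret B: cut_branching I A lab pred W w0 by (rule br)
  note h = hom_at[OF \<phi>, simplified]
  define D where "D = cstar_generated U (S ` I)"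
  note D = generated_closed[folded D_def]
  note DU = subsetD[OF D(3)]
  let ?P = "proj W"
  define s where "s = word (i0 # \<alpha>)"
  define l where "l = last (i0 # \<alpha>)"
  have I: "i0 \<in> I" "set \<alpha> \<subseteq> I" "l \<in> I" using path(1) by (auto simp: graph_path_def l_def)
  have sD: "s \<in> D" unfolding D_def s_def by (rule word_generated) (use I in auto)
  have p: "s\<^sup>\<star> \<otimes> s = Q l" unfolding s_def l_def by (rule word_star_word[OF path(1)])
  have pD: "Q l \<in> D" unfolding p[symmetric] using sD D by blast
  define v where "v = \<phi> s"
  define e where "e = \<phi> (Q l)"
  have e_proj: "e = proj {z. A l (lab z) = 1}"
    using B.adj_op_op[OF I(3)] I(3) by (simp add: e_def Q_def h S_closed star_closed \<phi>S)
  have ee: "e * e = e" "adj e = e" by (simp_all add: e_proj proj_simps)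
  have vv: "adj v * v = e" using DU[OF sD] by (simp add: v_def e_def p[symmetric] h star_closed)
  \<comment> \<open>Here the path closes up: \<open>A l i0 = 1\<close> puts the range of
    \<open>v\<close> inside that of \<open>e\<close>, its initial projection, and this makes
    \<open>V\<close> an isometry.\<close>
  have "Q l \<otimes> s = s" using Q_word[OF I(3,1,2)] path(2) unfolding s_def l_def by simp
  then have ev: "e * v = v" using DU[OF sD] DU[OF pD] h(2)[of "Q l" s] by (simp add: v_def e_def)
  have ve: "adj v * e = adj v" using arg_cong[OF ev, of adj] by (simp add: adj_simps ee)
  define V where "V = v + 1 - e"
  define V' where "V' = adj v + 1 - e"
  have V'V: "V' * V = 1" by (simp add: V_def V'_def algebra_simps vv ev ve ee)
  have adjV: "adj V = V'" by (simp add: V_def V'_def adj_simps ee)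
  have "(norm V)\<^sup>2 = 1" using norm_adj_mult[of V] by (simp add: adjV V'V)
  then have "norm V = 1" by (simp add: power2_eq_1_iff) (use norm_ge_zero[of V] in linarith)
  then have norm_V': "norm V' \<le> 1" using norm_adj[of V] by (simp add: adjV)
  have inv_mult: "(1 - ?P) * (a * b) * ?P = 0" if "(1 - ?P) * a * ?P = 0" "(1 - ?P) * b * ?P = 0" for a b
  proof -
    have "(1 - ?P) * (a * b) * ?P = (1 - ?P) * a * ?P * (b * ?P) + (1 - ?P) * a * ((1 - ?P) * b * ?P)"
      by (simp add: algebra_simps)
    then show ?thesis by (simp only: that) simp
  qed
  have inv_word: "(1 - ?P) * \<phi> (word \<beta>) * ?P = 0" if "set \<beta> \<subseteq> I" for \<beta>
    using that
  proof (induction \<beta>)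
    case Nil then show ?case by (simp add: h B.P_compl)
  next
    case (Cons i \<beta>)
    have "\<phi> (word (i # \<beta>)) = B.op i * \<phi> (word \<beta>)" using Cons.prems by (simp add: h S_closed word_closed \<phi>S)
    then show ?case using inv_mult[OF B.op_invariant Cons.IH] Cons.prems by simp
  qed
  have "(1 - ?P) * e * ?P = 0"
    by (intro bop_eqI ell2_eqI) (simp add: e_proj coord_proj coord_simps)
  moreover have "(1 - ?P) * v * ?P = 0" unfolding v_def s_def by (rule inv_word) (use I in auto)
  moreover have "(1 - ?P) * V * ?P = (1 - ?P) * v * ?P + (1 - ?P) * ?P - (1 - ?P) * e * ?P"
    by (simp add: V_def algebra_simps)
  ultimately have inv_V: "(1 - ?P) * V * ?P = 0" by (simp add: B.P_compl)
  have smooth: "\<phi> x \<in> B.smooth" if "x \<in> D" for x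
  proof -
    \<comment> \<open>The adjoint is carried along because \<open>B.smooth\<close> by itself gives
      no closure under adjoints.\<close>
    define C where "C = {x \<in> carrier U. \<phi> x \<in> B.smooth \<and> \<phi> (x\<^sup>\<star>) \<in> B.smooth}"
    have "cstar_subalgebra U C"
      unfolding cstar_subalgebra_def
    proof (intro conjI ballI allI)
      show "\<zero> \<in> C" using h(6)[of \<zero> 0] B.smooth_closed(3)[of 0] by (simp add: C_def star_zero smult_0_left cscalar_simps)
      show "closedin (cstar_topology U) C"
        unfolding closedin_cstar_iff
      proof (intro conjI allI impI)
        fix \<sigma> :: "nat \<Rightarrow> 'u" and x
        assume a: "range \<sigma> \<subseteq> C \<and> x \<in> carrier U \<and> (\<forall>e>0. \<exists>N. \<forall>n\<ge>N. cdist U (\<sigma> n) x < e)"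
        have C: "\<sigma> n \<in> carrier U" "\<phi> (\<sigma> n) \<in> B.smooth" "adj (\<phi> (\<sigma> n)) \<in> B.smooth" for n
        proof -
          have "\<sigma> n \<in> C" using a by blast
          then show "\<sigma> n \<in> carrier U" "\<phi> (\<sigma> n) \<in> B.smooth" "adj (\<phi> (\<sigma> n)) \<in> B.smooth" by (auto simp: C_def h)
        qed
        have app: "\<exists>n. norm (\<phi> x - \<phi> (\<sigma> n)) < e" if "e > 0" for e
        proof -
          have "\<exists>N. \<forall>n\<ge>N. cdist U (\<sigma> n) x < e" using a that by simp
          then obtain n where n: "cdist U (\<sigma> n) x < e" by auto
          have "norm (\<phi> (x \<oplus> (-1) \<odot> \<sigma> n)) \<le> cnorm U (x \<oplus> (-1) \<odot> \<sigma> n)"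
            by (rule hom_bop_contractive[OF unital_cstar_algebra_axioms \<phi>]) (use a C in \<open>simp add: smult_closed\<close>)
          also have "\<dots> < e" using n a C(1) by (simp add: cdist_eq[symmetric] cdist_commute[of x])
          finally show ?thesis using a C(1) by (auto simp: h smult_closed cscalar_simps(5)[of 1] cscalar_simps(4))
        qed
        have "\<phi> x \<in> B.smooth" by (rule B.smooth_limit) (use app C(2) in blast)
        moreover have "norm (adj (\<phi> x) - adj (\<phi> (\<sigma> n))) = norm (\<phi> x - \<phi> (\<sigma> n))" for n
          by (simp add: adj_simps(6)[symmetric] norm_adj)
        then have "adj (\<phi> x) \<in> B.smooth" by (intro B.smooth_limit) (use app C(3) in metis)
        ultimately show "x \<in> C" using a by (simp add: C_def h)
      qed (auto simp: C_def)
      show "x \<oplus> y \<in> C" "x \<otimes> y \<in> C" if "x \<in> C" "y \<in> C" for x y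
        using that by (auto simp: C_def star_add star_mult star_closed h B.smooth_closed)
      show "x\<^sup>\<star> \<in> C" if "x \<in> C" for x using that by (auto simp: C_def star_closed star_star)
      show "c \<odot> x \<in> C" if "x \<in> C" for x c
        using that by (auto simp: C_def star_closed star_smult smult_closed h B.smooth_closed)
    qed (auto simp: C_def)
    moreover have "S ` I \<subseteq> C" by (auto simp: C_def S_closed h \<phi>S B.op_smooth B.adj_op_smooth)
    ultimately have "D \<subseteq> C" unfolding D_def cstar_generated_def by (intro hull_minimal)
    then show ?thesis using that by (auto simp: C_def)
  qed
  \<comment> \<open>The errors in \<open>v\<close> and in \<open>e\<close> add up, so each is kept
    below 1/2.\<close>
  have half: "(0::real) < 1/2" by simp
  obtain x r c N i where x: "x \<in> D" "r \<in> D" "norm (\<phi> x - v) < 1/2" "norm (\<phi> r - e) < 1/2"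
    and c: "(\<Sum>k\<le>N. cscalar (c k) * (1 + (\<phi> x - \<phi> r)) ^ k) = 0" "i \<le> N" "c i \<noteq> (0 :: complex)"
    unfolding D_def v_def e_def by (rule AF_imp_algebraic_approx[OF AF \<phi> sD[unfolded D_def] pD[unfolded D_def] half])
  have V_diff: "1 + (\<phi> x - \<phi> r) - V = (\<phi> x - v) - (\<phi> r - e)" by (simp add: V_def)
  have "norm (1 + (\<phi> x - \<phi> r) - V) < 1"
    unfolding V_diff using norm_triangle_ineq4[of "\<phi> x - v" "\<phi> r - e"] x(3,4) by linarith
  moreover have "1 + (\<phi> x - \<phi> r) \<in> B.smooth" using x smooth by (intro B.smooth_closed B.smooth_diff)
  ultimately have TT: "B.T V * B.T V' = 1"
    using B.compression_of_isometry_invertible[OF V'V norm_V' inv_V _ _ c] by blast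
  \<comment> \<open>The vector missed by the compression of \<open>V\<close>: \<open>1 - e\<close>
    kills \<open>delta w0\<close> because \<open>A l i0 = 1\<close>, and \<open>adj v\<close>
    carries it out of \<open>W\<close>.\<close>
  have "app (?P * V' * ?P) (delta w0) = 0"
  proof -
    have P0: "app ?P (delta w0) = delta w0"
      by (rule ell2_eqI) (use B.w0 in \<open>simp add: coord_proj coord_delta\<close>)
    have e0: "app e (delta w0) = delta w0"
      by (rule ell2_eqI) (use path in \<open>auto simp: l_def e_proj coord_proj coord_delta\<close>)
    \<comment> \<open>Removing the first vertex of \<open>w0\<close> crosses the cut, so the result
      is supported outside \<open>W\<close>.\<close>
    have o0: "app (adj (B.op i0)) (delta w0) = app (1 - ?P) (app (adj (B.op i0)) (delta w0))"
    proof (rule ell2_eqI)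
      fix z
      show "coord (app (adj (B.op i0)) (delta w0)) z = coord (app (1 - ?P) (app (adj (B.op i0)) (delta w0))) z"
        using B.w0
        by (cases rule: B.coord_adj_op_cases[OF I(1), of "delta w0" z])
          (auto simp: proj_simps coord_proj coord_delta simp del: app_simps(5))
    qed
    have "v = B.op i0 * \<phi> (word \<alpha>)" using I by (simp add: v_def s_def h S_closed word_closed \<phi>S)
    then have "app ?P (app (adj v) (delta w0)) = app ?P (app (adj (\<phi> (word \<alpha>))) (app (adj (B.op i0)) (delta w0)))"
      by (simp add: adj_simps)
    also have "\<dots> = app (?P * adj (\<phi> (word \<alpha>)) * (1 - ?P)) (app (adj (B.op i0)) (delta w0))"
      by (subst o0) (simp only: app_simps(7))
    \<comment> \<open>The adjoint of invariance: removing the remaining vertices cannot lead back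
      into \<open>W\<close>.\<close>
    also have "?P * adj (\<phi> (word \<alpha>)) * (1 - ?P) = 0"
      using arg_cong[OF inv_word[OF I(2)], of adj] adj_simps(4)[of 0 0]
      by (simp add: adj_simps(3,5,6) proj_simps(4) mult.assoc)
    finally show ?thesis by (simp add: P0 e0 V'_def)
  qed
  then have "app (B.T V') (delta w0) = 0"
    using B.w0 by (intro ell2_eqI) (simp add: B.T_def coord_simps coord_proj coord_delta)
  then have "delta w0 = 0" using arg_cong[OF TT, of "\<lambda>T. app T (delta w0)"] by simp
  then show False using coord_delta[of w0 w0] by (simp add: coord_simps)
qed

section \<open>The branching system of a cycle\<close>

text \<open>
  The nodes are the paths that eventually run backwards around the cycle: \<open>(\<beta>, m)\<close> stands for the finite
  path \<open>\<beta>\<close> followed by \<open>c m, c (m - 1), c (m - 2), \<dots>\<close>, and \<open>\<beta>\<close> is reduced in that it does not end in \<open>c (m + 1)\<close>.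
\<close>

lemma cycle_cut_branching:
  fixes A :: "'i \<Rightarrow> 'i \<Rightarrow> int"
  assumes I: "countable I" and A01: "\<And>i j. i \<in> I \<Longrightarrow> j \<in> I \<Longrightarrow> A i j \<in> {0, 1}"
    and cyc: "graph_cycle (graph_edges I A) p"
  obtains lab pred W w0 where "cut_branching I A lab pred W w0" "lab w0 = hd p"
proof -
  define n where "n = int (length p)"
  \<comment> \<open>The index runs backwards around \<open>p\<close>, so that there is an edge from
    \<open>c m\<close> to \<open>c (m - 1)\<close>, and \<open>c 0 = hd p\<close>. Keeping
    \<open>m\<close> as an integer, not a residue, records the lag.\<close>
  define c where "c m = p ! nat ((- m) mod n)" for m
  have p: "p \<noteq> []" and n: "n > 0" using cyc by (auto simp: graph_cycle_def n_def)
  have pe: "p ! k \<in> I \<and> p ! (if Suc k < length p then Suc k else 0) \<in> I \<and> A (p ! k) (p ! (if Suc k < length p then Suc k else 0)) = 1"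
    if "k < length p" for k
  proof (cases "Suc k < length p")
    case True
    then show ?thesis using cyc by (auto simp: graph_cycle_def graph_edges_def)
  next
    case False
    then have "k = length p - 1" using that by simp
    then show ?thesis using cyc p False by (auto simp: graph_cycle_def graph_edges_def last_conv_nth hd_conv_nth)
  qed
  have c_lt: "nat ((- m) mod n) < length p" for m using n by (simp add: nat_less_iff n_def)
  have c_in: "c m \<in> I" for m using pe[OF c_lt] by (simp add: c_def)
  have c_edge: "A (c m) (c (m - 1)) = 1" for m
  proof -
    let ?r = "(- m) mod n"
    have r: "0 \<le> ?r" "?r < n" using n by simp_all
    have "(- (m - 1)) mod n = (?r + 1) mod n" by (simp add: mod_simps add.commute)
    also have "\<dots> = (if ?r + 1 < n then ?r + 1 else 0)" 
    proof (cases "?r + 1 < n")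
      case False
      then have "?r + 1 = n" using r by linarith
      then show ?thesis by simp
    qed (use r in simp)
    finally have "nat ((- (m - 1)) mod n) = (if Suc (nat ?r) < length p then Suc (nat ?r) else 0)"
      using r by (auto simp: n_def nat_add_distrib)
    then show ?thesis using pe[OF c_lt[of m]] by (simp add: c_def)
  qed
  \<comment> \<open>Without the last condition, a path ending in \<open>c (m + 1)\<close> with index
    \<open>m\<close> could also be written with index \<open>m + 1\<close>, and \<open>eqI\<close>
    would fail.\<close>
  define Z where "Z = {(\<beta>, m). set \<beta> \<subseteq> I \<and> successively (\<lambda>i j. A i j = 1) (\<beta> @ [c m]) \<and> (\<beta> \<noteq> [] \<longrightarrow> last \<beta> \<noteq> c (m + 1))}"
  define lab where "lab = (\<lambda>(\<beta>, m). hd (\<beta> @ [c m]))"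
  define pred where "pred = (\<lambda>(\<beta> :: 'i list, m :: int). if \<beta> = [] then ([], m - 1) else (tl \<beta>, m))"
  have pred_Z: "pred z \<in> Z" if "z \<in> Z" for z
  proof (cases z)
    case (Pair \<beta> m)
    then show ?thesis using that by (cases \<beta>) (auto simp: Z_def pred_def successively_Cons split: if_splits)
  qed
  have lab_in: "lab z \<in> I" if "z \<in> Z" for z
  proof (cases z)
    case (Pair \<beta> m)
    then show ?thesis using that c_in by (cases \<beta>) (auto simp: Z_def lab_def)
  qed
  have edge: "A (lab z) (lab (pred z)) = 1" if "z \<in> Z" for z
  proof (cases z)
    case (Pair \<beta> m)
    then show ?thesis using that c_edge by (cases \<beta>) (auto simp: Z_def lab_def pred_def successively_Cons)
  qed
  have branch: "\<exists>w\<in>Z. lab w = i \<and> pred w = z" if i: "i \<in> I" "A i (lab z) = 1" and z: "z \<in> Z" for i z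
  proof (cases z)
    case (Pair \<beta> m)
    show ?thesis
    \<comment> \<open>Putting the preceding vertex of the cycle in front of a purely cyclic path
      must raise \<open>m\<close>, as the longer list would not be reduced.\<close>
    proof (cases "\<beta> = [] \<and> i = c (m + 1)")
      case True
      then show ?thesis using Pair by (intro bexI[of _ "([], m + 1)"]) (auto simp: lab_def pred_def Z_def)
    next
      case False
      then have "(i # \<beta>, m) \<in> Z" using i z Pair by (auto simp: Z_def lab_def successively_Cons)
      then show ?thesis using Pair by (intro bexI[of _ "(i # \<beta>, m)"]) (auto simp: lab_def pred_def)
    qed
  qed
  have eqI: "v = w" if "v \<in> Z" "w \<in> Z" "lab v = lab w" "pred v = pred w" for v w
  proof -
    obtain \<beta> m \<gamma> k where vw: "v = (\<beta>, m)" "w = (\<gamma>, k)" by (cases v, cases w)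
    show ?thesis using that unfolding vw by (cases \<beta>; cases \<gamma>) (auto simp: Z_def lab_def pred_def)
  qed
  have "Z \<subseteq> lists I \<times> UNIV" by (auto simp: Z_def)
  then have cZ: "countable Z" using countable_lists[OF I] by (meson countable_SIGMA countable_subset uncountable_def countableI_type)
  have nil: "([], m) \<in> Z" for m by (simp add: Z_def)
  have "inj (\<lambda>m :: int. ([] :: 'i list, m))" by (simp add: inj_on_def)
  then have "infinite (range (\<lambda>m :: int. ([] :: 'i list, m)))" using finite_imageD infinite_UNIV_int by blast
  moreover have "range (\<lambda>m :: int. ([] :: 'i list, m)) \<subseteq> Z" using nil by auto
  \<comment> \<open>The unbounded lag provides infinitely many nodes, so that they can be numbered
    by all natural numbers.\<close>
  ultimately have iZ: "infinite Z" using finite_subset by blast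
  let ?b = "from_nat_into Z" and ?t = "to_nat_on Z"
  have b: "?b k \<in> Z" "?t (?b k) = k" for k
    using from_nat_into[of Z k] iZ to_nat_on_from_nat_into_infinite[OF cZ iZ] by auto
  have t: "?b (?t z) = z" if "z \<in> Z" for z using cZ that by simp
  have b_pred: "?b (?t (pred (?b k))) = pred (?b k)" for k using t pred_Z b by blast
  show thesis
  \<comment> \<open>Passing to the tail changes \<open>m\<close> only from \<open>([], m)\<close> to
    \<open>([], m - 1)\<close>, so the half with \<open>m \<ge> 0\<close> is left only at
    \<open>([], 0)\<close>.\<close>
  proof (rule that[of "\<lambda>k. lab (?b k)" "\<lambda>k. ?t (pred (?b k))" "{k. snd (?b k) \<ge> 0}" "?t ([], 0)"])
    show "lab (?b (?t ([], 0))) = hd p" using p by (simp add: t nil lab_def c_def hd_conv_nth)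
    show "cut_branching I A (\<lambda>k. lab (?b k)) (\<lambda>k. ?t (pred (?b k))) {k. snd (?b k) \<ge> 0} (?t ([], 0))"
    proof
      show "A i j \<in> {0, 1}" if "i \<in> I" "j \<in> I" for i j using A01 that .
      show "lab (?b w) \<in> I" for w using lab_in b by blast
      show "A (lab (?b w)) (lab (?b (?t (pred (?b w))))) = 1" for w unfolding b_pred using edge b by blast
      show "\<exists>w. lab (?b w) = i \<and> ?t (pred (?b w)) = z" if iz: "i \<in> I" "A i (lab (?b z)) = 1" for i z
      proof -
        obtain w where "w \<in> Z" "lab w = i" "pred w = ?b z" using branch[OF iz b(1)] by blast
        then show ?thesis using t[of w] b(2)[of z] by (intro exI[of _ "?t w"]) simp
      qed
      show "v = w" if vw: "lab (?b v) = lab (?b w)" "?t (pred (?b v)) = ?t (pred (?b w))" for v w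
      proof -
        have "pred (?b v) = pred (?b w)" using arg_cong[OF vw(2), of ?b] unfolding b_pred .
        then have "?b v = ?b w" by (rule eqI[OF b(1) b(1) vw(1)])
        then show ?thesis using b(2) by metis
      qed
      show "w \<in> {k. snd (?b k) \<ge> 0}" if "?t (pred (?b w)) \<in> {k. snd (?b k) \<ge> 0}" for w
        using that unfolding mem_Collect_eq b_pred by (cases "?b w") (auto simp: pred_def split: if_splits)
      show "?t (pred (?b w)) \<in> {k. snd (?b k) \<ge> 0}" if "w \<in> {k. snd (?b k) \<ge> 0}" "w \<noteq> ?t ([], 0)" for w
      proof -
        have "?b w \<noteq> ([], 0)" using b(2)[of w] that(2) by metis
        then show ?thesis using that(1) unfolding mem_Collect_eq b_pred by (cases "?b w") (auto simp: pred_def split: if_splits)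
      qed
      show "?t ([], 0) \<in> {k. snd (?b k) \<ge> 0}" by (simp add: t nil)
      show "?t (pred (?b (?t ([], 0)))) \<notin> {k. snd (?b k) \<ge> 0}"
        unfolding mem_Collect_eq b_pred by (simp add: t nil pred_def)
    qed
  qed
qed

lemma graph_cycle_path:
  assumes "graph_cycle (graph_edges I A) p"
  shows "set p \<subseteq> I" "successively (\<lambda>i j. A i j = 1) p" "p \<noteq> []" "A (last p) (hd p) = 1"
proof -
  have e: "p \<noteq> []" "\<And>k. Suc k < length p \<Longrightarrow> p ! k \<in> I \<and> p ! Suc k \<in> I \<and> A (p ! k) (p ! Suc k) = 1"
    "last p \<in> I" "A (last p) (hd p) = 1"
    using assms by (auto simp: graph_cycle_def graph_edges_def)
  then show "p \<noteq> []" "A (last p) (hd p) = 1" by auto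
  show "successively (\<lambda>i j. A i j = 1) p" using e(2) by (auto simp: successively_conv_nth)
  show "set p \<subseteq> I"
  proof
    fix x assume "x \<in> set p"
    then obtain k where k: "k < length p" "x = p ! k" by (auto simp: in_set_conv_nth)
    show "x \<in> I"
    proof (cases "Suc k < length p")
      case False
      then have "k = length p - 1" using k by simp
      then show ?thesis using e(1,3) k by (simp add: last_conv_nth)
    qed (use e(2) k in auto)
  qed
qed

section \<open>Finite-dimensional subalgebras\<close>

context pre_cstar_algebra
begin

text \<open>One summand is added at a time, possibly with a repeated generator, so closure
  properties follow by rule induction; \<open>lin_span_finsum\<close> recovers the sums that
  \<open>finite_dimensional\<close> asks for.\<close>

inductive_set lin_span :: "'a set \<Rightarrow> 'a set" for X where
  zero: "\<zero> \<in> lin_span X"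
| step: "x \<in> X \<Longrightarrow> y \<in> lin_span X \<Longrightarrow> c \<odot> x \<oplus> y \<in> lin_span X"

lemma lin_span_carrier: "X \<subseteq> carrier B \<Longrightarrow> lin_span X \<subseteq> carrier B"
proof
  fix x assume X: "X \<subseteq> carrier B" and "x \<in> lin_span X"
  from this(2) show "x \<in> carrier B" by induction (use X in \<open>auto simp: smult_closed\<close>)
qed

lemma lin_span_add:
  assumes X: "X \<subseteq> carrier B" and "x \<in> lin_span X" and y: "y \<in> lin_span X"
  shows "x \<oplus> y \<in> lin_span X"
  using assms(2)
proof induction
  case zero then show ?case using y lin_span_carrier[OF X] by auto
next
  case (step x z c)
  then have "c \<odot> x \<oplus> z \<oplus> y = c \<odot> x \<oplus> (z \<oplus> y)"
    using X y lin_span_carrier[OF X] by (intro a_assoc) (auto simp: smult_closed)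
  then show ?case using lin_span.step[OF step(1,3)] by simp
qed

lemma lin_span_smult:
  assumes X: "X \<subseteq> carrier B" and "x \<in> lin_span X" shows "d \<odot> x \<in> lin_span X"
  using assms(2)
proof induction
  case zero then show ?case by (simp add: smult_0_right lin_span.zero)
next
  case (step x z c)
  have "x \<in> carrier B" "z \<in> carrier B" using step(1,2) X lin_span_carrier[OF X] by auto
  then have "d \<odot> (c \<odot> x \<oplus> z) = (d * c) \<odot> x \<oplus> d \<odot> z"
    by (simp add: smult_r_distr smult_assoc1 smult_closed)
  then show ?case using lin_span.step[OF step(1,3)] by simp
qed

lemma lin_span_base: assumes "X \<subseteq> carrier B" "x \<in> X" shows "x \<in> lin_span X"
  using lin_span.step[OF assms(2) lin_span.zero, of 1] assms by (simp add: smult_one subsetD)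

lemma lin_span_mono: "X \<subseteq> Y \<Longrightarrow> lin_span X \<subseteq> lin_span Y"
proof
  fix x assume "X \<subseteq> Y" "x \<in> lin_span X"
  from this(2,1) show "x \<in> lin_span Y" by induction (auto intro: lin_span.intros)
qed

lemma lin_span_star:
  assumes X: "X \<subseteq> carrier B" "\<And>x. x \<in> X \<Longrightarrow> x\<^sup>\<star> \<in> X" and "x \<in> lin_span X" shows "x\<^sup>\<star> \<in> lin_span X"
  using assms(3)
proof induction
  case (step x z c)
  have "x \<in> carrier B" "z \<in> carrier B" using step(1,2) X lin_span_carrier[OF X(1)] by auto
  then have "(c \<odot> x \<oplus> z)\<^sup>\<star> = cnj c \<odot> x\<^sup>\<star> \<oplus> z\<^sup>\<star>" by (simp add: star_add star_smult smult_closed)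
  then show ?case using lin_span.step[OF X(2)[OF step(1)] step(3)] by simp
qed (simp add: star_zero lin_span.zero)

lemma lin_span_mult:
  assumes X: "X \<subseteq> carrier B" "\<And>x y. x \<in> X \<Longrightarrow> y \<in> X \<Longrightarrow> x \<otimes> y \<in> X"
    and "x \<in> lin_span X" and y: "y \<in> lin_span X"
  shows "x \<otimes> y \<in> lin_span X"
  using assms(3)
proof induction
  case zero then show ?case using y lin_span_carrier[OF X(1)] lin_span.zero by (auto simp: mult_zero_left)
next
  case (step x z c)
  have x: "x \<in> carrier B" "z \<in> carrier B" "y \<in> carrier B" using step(1,2) y X lin_span_carrier[OF X(1)] by auto
  have "x \<otimes> y \<in> lin_span X"
    using y
  proof induction
    case zero then show ?case using x lin_span.zero by (simp add: mult_zero_right)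
  next
    case (step w u d)
    have "w \<in> carrier B" "u \<in> carrier B" using step(1,2) X lin_span_carrier[OF X(1)] by auto
    then have "x \<otimes> (d \<odot> w \<oplus> u) = d \<odot> (x \<otimes> w) \<oplus> x \<otimes> u" using x by (simp add: r_distr smult_mult_right smult_closed)
    then show ?case using lin_span.step[OF X(2)[OF \<open>x \<in> X\<close> step(1)] step(3)] by simp
  qed
  then have "c \<odot> (x \<otimes> y) \<oplus> z \<otimes> y \<in> lin_span X" by (intro lin_span_add X(1) lin_span_smult step(3))
  then show ?case using x by (simp add: l_distr smult_mult_left smult_closed)
qed

lemma lin_span_finsum:
  assumes X: "X \<subseteq> carrier B" "finite X" and "x \<in> lin_span X"
  shows "\<exists>c. x = (\<Oplus>g\<in>X. c g \<odot> g)"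
  using assms(3)
proof induction
  case zero
  have "(\<Oplus>g\<in>X. 0 \<odot> g) = (\<Oplus>g\<in>X. \<zero>)" using X by (intro finsum_cong') (auto simp: smult_0_left)
  then show ?case by (intro exI[of _ "\<lambda>_. 0"]) simp
next
  case (step x y c)
  then obtain d where d: "y = (\<Oplus>g\<in>X. d g \<odot> g)" by blast
  \<comment> \<open>A generator may occur several times, so the new coefficient is added to the one
    already present.\<close>
  let ?e = "d(x := c + d x)"
  have cl: "f g \<odot> g \<in> carrier B" if "g \<in> X" for f :: "'a \<Rightarrow> complex" and g using X that by (auto simp: smult_closed)
  have ins: "(\<Oplus>g\<in>X. f g \<odot> g) = f x \<odot> x \<oplus> (\<Oplus>g\<in>X - {x}. f g \<odot> g)" for f
    using finsum_insert[of "X - {x}" x "\<lambda>g. f g \<odot> g"] X cl step(1) by (auto simp: insert_absorb)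
  have rest: "(\<Oplus>g\<in>X - {x}. d g \<odot> g) = (\<Oplus>g\<in>X - {x}. ?e g \<odot> g)"
    using cl by (intro finsum_cong') auto
  have rc: "(\<Oplus>g\<in>X - {x}. ?e g \<odot> g) \<in> carrier B" using cl[of _ ?e] by (intro finsum_closed) auto
  have "c \<odot> x \<oplus> y = ?e x \<odot> x \<oplus> (\<Oplus>g\<in>X - {x}. ?e g \<odot> g)"
    unfolding d ins[of d] rest using rc step(1) X by (simp add: a_assoc[symmetric] smult_l_distr smult_closed subsetD)
  then show ?case unfolding ins[of ?e, symmetric] by blast
qed

text \<open>Collects all multiples of \<open>g\<close> in one coefficient, which allows closedness
  to be proved by induction on the generating set.\<close>

lemma lin_span_insert:
  assumes X: "insert g X \<subseteq> carrier B" and "x \<in> lin_span (insert g X)"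
  shows "\<exists>c. \<exists>y\<in>lin_span X. x = c \<odot> g \<oplus> y"
  using assms(2)
proof induction
  case zero
  show ?case using X lin_span.zero by (intro exI[of _ 0] bexI[of _ \<zero>]) (auto simp: smult_0_left)
next
  case (step x z c)
  have Xc: "X \<subseteq> carrier B" and g: "g \<in> carrier B" using X by auto
  obtain d y where y: "y \<in> lin_span X" "z = d \<odot> g \<oplus> y" using step by blast
  have yc: "y \<in> carrier B" and xc: "x \<in> carrier B" using y(1) lin_span_carrier[OF Xc] step(1) X by auto
  show ?case
  proof (cases "x = g")
    case True
    have "c \<odot> x \<oplus> z = (c + d) \<odot> g \<oplus> y" using True y(2) g yc by (simp add: smult_l_distr smult_closed a_assoc)
    then show ?thesis using y(1) by blast
  next
    case False
    then have "c \<odot> x \<oplus> y \<in> lin_span X" using lin_span.step y(1) step(1) by blast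
    moreover have "c \<odot> x \<oplus> z = d \<odot> g \<oplus> (c \<odot> x \<oplus> y)" using y(2) g yc xc by (simp add: a_lcomm smult_closed)
    ultimately show ?thesis by blast
  qed
qed

end

context cstar_algebra
begin

text \<open>
  For \<open>g\<close> outside the closed span of \<open>X\<close>, the distance of \<open>g\<close> to this span bounds the coefficient of \<open>g\<close>,
  so the coefficients along a convergent sequence converge as well.
\<close>

lemma lin_span_closed:
  assumes "finite X" "X \<subseteq> carrier B" shows "closedin (cstar_topology B) (lin_span X)"
  using assms
proof (induction X)
  interpret M: Metric_space "carrier B" "cdist B" by (rule cstar_metric)
  { case empty
    have "x = \<zero>" if "x \<in> lin_span {}" for x using that by cases auto
    then have e: "lin_span {} = {\<zero>}" using lin_span.zero by blast
    show ?case unfolding e closedin_cstar_iff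
    proof (intro conjI allI impI)
      fix \<sigma> :: "nat \<Rightarrow> 'a" and x assume a: "range \<sigma> \<subseteq> {\<zero>} \<and> x \<in> carrier B \<and> (\<forall>e>0. \<exists>N. \<forall>n\<ge>N. cdist B (\<sigma> n) x < e)"
      then have s: "\<sigma> n = \<zero>" for n by blast
      have "cdist B \<zero> x \<le> 0 + e" if e: "e > 0" for e
      proof -
        have "\<exists>N. \<forall>n\<ge>N. cdist B (\<sigma> n) x < e" using a e by simp
        then show ?thesis unfolding s by auto
      qed
      then have "cdist B \<zero> x \<le> 0" by (rule field_le_epsilon)
      then show "x \<in> {\<zero>}" using a M.zero[of \<zero> x] M.nonneg[of \<zero> x] by simp
    qed simp
  next
    case (insert g X)
    have g: "g \<in> carrier B" and X: "X \<subseteq> carrier B" and gX: "Set.insert g X \<subseteq> carrier B" using insert.prems by auto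
    note Xc = lin_span_carrier[OF X] and gXc = lin_span_carrier[OF gX]
    have IH: "closedin (cstar_topology B) (lin_span X)" using insert.IH X by blast
    note IH' = IH[unfolded closedin_cstar_iff, THEN conjunct2, rule_format]
    show ?case
    proof (cases "g \<in> lin_span X")
      case True
      have "x \<in> lin_span X" if x: "x \<in> lin_span (Set.insert g X)" for x
      proof -
        obtain c y where "y \<in> lin_span X" "x = c \<odot> g \<oplus> y" using lin_span_insert[OF gX x] by blast
        then show ?thesis using lin_span_add[OF X] lin_span_smult[OF X True] by blast
      qed
      then have "lin_span (Set.insert g X) = lin_span X" using lin_span_mono[of X "Set.insert g X"] by blast
      then show ?thesis using IH by simp
    next
      case False
      \<comment> \<open>Otherwise elements of the span of \<open>X\<close> would converge to
        \<open>g\<close>, and by the induction hypothesis \<open>g\<close> would belong to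
        it.\<close>
      have "\<exists>d>0. \<forall>x\<in>lin_span X. d \<le> cdist B x g"
      proof (rule ccontr)
        assume "\<not> ?thesis"
        then have "\<exists>x\<in>lin_span X. cdist B x g < inverse (real (Suc n))" for n
          by (metis inverse_positive_iff_positive not_le of_nat_0_less_iff zero_less_Suc)
        then obtain \<sigma> where s: "\<And>n. \<sigma> n \<in> lin_span X" "\<And>n. cdist B (\<sigma> n) g < inverse (real (Suc n))" by metis
        have "\<exists>N. \<forall>n\<ge>N. cdist B (\<sigma> n) g < e" if "e > 0" for e
        proof -
          obtain N where N: "inverse (real (Suc N)) < e" using reals_Archimedean[OF \<open>e > 0\<close>] by blast
          have "cdist B (\<sigma> n) g < e" if "n \<ge> N" for n
          proof -
            have "inverse (real (Suc n)) \<le> inverse (real (Suc N))" using that by simp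
            then show ?thesis using s(2)[of n] N by linarith
          qed
          then show ?thesis by blast
        qed
        then have "g \<in> lin_span X" using s(1) g by (intro IH'[of \<sigma>]) auto
        then show False using False by blast
      qed
      then obtain d where d: "d > 0" "\<And>x. x \<in> lin_span X \<Longrightarrow> d \<le> cdist B x g" by blast
      have low: "cmod c * d \<le> cnorm B (c \<odot> g \<oplus> x)" if x: "x \<in> lin_span X" for c x
      proof (cases "c = 0")
        case True then show ?thesis using cnorm_nonneg[of "c \<odot> g \<oplus> x"] g x Xc by (auto simp: smult_closed)
      next
        case False
        have xc: "x \<in> carrier B" using x Xc by auto
        \<comment> \<open>Scaled so that \<open>c \<odot> g \<oplus> x\<close> is \<open>- c\<close>
          times the difference of \<open>?y\<close> and \<open>g\<close>, to which the distance
          bound applies.\<close>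
        let ?y = "(- inverse c) \<odot> x"
        have "c \<odot> g \<oplus> x = (- c) \<odot> (?y \<oplus> (-1) \<odot> g)"
          using False g xc by (simp add: smult_r_distr smult_assoc1[symmetric] smult_closed smult_one a_comm)
        then have "cnorm B (c \<odot> g \<oplus> x) = cmod c * cdist B ?y g"
          using g xc by (simp add: cnorm_smult smult_closed cdist_eq)
        then show ?thesis using d(2)[OF lin_span_smult[OF X x], of "- inverse c"] by (simp add: mult_left_mono)
      qed
      show ?thesis unfolding closedin_cstar_iff
      proof (intro conjI allI impI)
        show "lin_span (Set.insert g X) \<subseteq> carrier B" by (rule gXc)
        fix \<sigma> :: "nat \<Rightarrow> 'a" and y
        assume a: "range \<sigma> \<subseteq> lin_span (Set.insert g X) \<and> y \<in> carrier B \<and> (\<forall>e>0. \<exists>N. \<forall>n\<ge>N. cdist B (\<sigma> n) y < e)"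
        then have sg: "\<sigma> n \<in> lin_span (Set.insert g X)" and y: "y \<in> carrier B" for n by auto
        have lim: "\<exists>N. \<forall>n\<ge>N. cdist B (\<sigma> n) y < e" if "e > 0" for e using a that by simp
        have sc: "\<sigma> n \<in> carrier B" for n using sg gXc by blast
        have "\<exists>c x. x \<in> lin_span X \<and> \<sigma> n = c \<odot> g \<oplus> x" for n using lin_span_insert[OF gX sg[of n]] by blast
        then obtain c x where cx: "\<And>n. x n \<in> lin_span X" "\<And>n. \<sigma> n = c n \<odot> g \<oplus> x n" by metis
        have xc: "x n \<in> carrier B" for n using cx(1) Xc by blast
        have diff: "cmod (c n - c m) * d \<le> cdist B (\<sigma> n) (\<sigma> m)" for n m
        proof -
          have "\<sigma> n \<oplus> (-1) \<odot> \<sigma> m = (c n - c m) \<odot> g \<oplus> (x n \<oplus> (-1) \<odot> x m)"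
            unfolding cx(2) using g xc
            by (simp add: smult_r_distr smult_closed smult_assoc1[symmetric] diff_conv_add_uminus smult_l_distr a_ac del: add_uminus_conv_diff)
          moreover have "x n \<oplus> (-1) \<odot> x m \<in> lin_span X" by (intro lin_span_add X lin_span_smult cx)
          ultimately show ?thesis using low[of "x n \<oplus> (-1) \<odot> x m" "c n - c m"] by (simp add: cdist_eq sc)
        qed
        have "Cauchy c"
        proof (rule metric_CauchyI)
          fix e :: real assume "e > 0"
          then obtain N where N: "\<And>n. n \<ge> N \<Longrightarrow> cdist B (\<sigma> n) y < e * d / 2" using lim[of "e * d / 2"] d(1) by auto
          have "dist (c m) (c n) < e" if "m \<ge> N" "n \<ge> N" for m n
          proof -
            have "cmod (c m - c n) * d \<le> cdist B (\<sigma> m) y + cdist B (\<sigma> n) y"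
              using diff[of m n] M.triangle[OF sc y sc, of m n] by (simp add: M.commute)
            also have "\<dots> < e * d" using N[OF that(1)] N[OF that(2)] by simp
            finally show ?thesis using d(1) by (simp add: dist_norm)
          qed
          then show "\<exists>M. \<forall>m\<ge>M. \<forall>n\<ge>M. dist (c m) (c n) < e" by blast
        qed
        then obtain l where l: "c \<longlonglongrightarrow> l" using Cauchy_convergent convergent_def by blast
        \<comment> \<open>As the coefficients converge to \<open>l\<close>, the remainders
          \<open>x n\<close> converge to this element, which the induction hypothesis places in the
          span of \<open>X\<close>.\<close>
        let ?z = "y \<oplus> (- l) \<odot> g"
        have "\<exists>N. \<forall>n\<ge>N. cdist B (x n) ?z < e" if e: "e > 0" for e
        proof -
          have G: "cnorm B g + 1 > 0" using cnorm_nonneg[OF g] by simp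
          obtain N1 where N1: "\<And>n. n \<ge> N1 \<Longrightarrow> cdist B (\<sigma> n) y < e / 2" using lim[of "e/2"] e by auto
          have "e / 2 / (cnorm B g + 1) > 0" using e G by simp
          then obtain N2 where N2: "\<And>n. n \<ge> N2 \<Longrightarrow> cmod (c n - l) < e / 2 / (cnorm B g + 1)"
            using LIMSEQ_D[OF l] by meson
          have "cdist B (x n) ?z < e" if n: "n \<ge> max N1 N2" for n
          proof -
            have "x n \<oplus> (-1) \<odot> ?z = (\<sigma> n \<oplus> (-1) \<odot> y) \<oplus> (l - c n) \<odot> g"
            proof -
              have "(\<sigma> n \<oplus> (-1) \<odot> y) \<oplus> (l - c n) \<odot> g = (c n \<odot> g \<oplus> (l - c n) \<odot> g) \<oplus> (x n \<oplus> (-1) \<odot> y)"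
                unfolding cx(2) using g xc y by (simp add: smult_closed a_ac)
              also have "c n \<odot> g \<oplus> (l - c n) \<odot> g = l \<odot> g" using g by (simp add: smult_l_distr[symmetric])
              finally show ?thesis using g xc y by (simp add: smult_r_distr smult_closed smult_assoc1[symmetric] a_ac)
            qed
            then have "cdist B (x n) ?z \<le> cdist B (\<sigma> n) y + cmod (l - c n) * cnorm B g"
              using cnorm_triangle[of "\<sigma> n \<oplus> (-1) \<odot> y" "(l - c n) \<odot> g"] g xc y sc
              by (simp add: cdist_eq smult_closed cnorm_smult)
            also have "cmod (l - c n) * cnorm B g \<le> e / 2 / (cnorm B g + 1) * cnorm B g"
              using N2[of n] n cnorm_nonneg[OF g] by (intro mult_right_mono) (auto simp: norm_minus_commute)
            also have "\<dots> \<le> e / 2" using G e by (simp add: field_simps)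
            finally show ?thesis using N1[of n] n by simp
          qed
          then show ?thesis by blast
        qed
        then have "?z \<in> lin_span X" using cx(1) g y by (intro IH'[of x]) (auto simp: smult_closed)
        then have "l \<odot> g \<oplus> ?z \<in> lin_span (Set.insert g X)"
          using lin_span.step[of g "Set.insert g X" ?z l] lin_span_mono[of X "Set.insert g X"] by blast
        moreover have "l \<odot> g \<oplus> ?z = y"
        proof -
          have "l \<odot> g \<oplus> ?z = (l \<odot> g \<oplus> (- l) \<odot> g) \<oplus> y" using g y by (simp add: smult_closed a_ac)
          also have "l \<odot> g \<oplus> (- l) \<odot> g = \<zero>" using g by (simp add: smult_l_distr[symmetric] smult_0_left)
          finally show ?thesis using y by simp
        qed
        ultimately show "y \<in> lin_span (Set.insert g X)" by simp
      qed
    qed }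
qed

lemma lin_span_subalgebra:
  assumes "finite X" "X \<subseteq> carrier B" "\<And>x y. x \<in> X \<Longrightarrow> y \<in> X \<Longrightarrow> x \<otimes> y \<in> X" "\<And>x. x \<in> X \<Longrightarrow> x\<^sup>\<star> \<in> X"
  shows "cstar_subalgebra B (lin_span X)" "finite_dimensional B (lin_span X)"
proof -
  show "cstar_subalgebra B (lin_span X)"
    unfolding cstar_subalgebra_def
    using lin_span_carrier lin_span.zero lin_span_add lin_span_mult lin_span_star lin_span_smult lin_span_closed assms by simp
  show "finite_dimensional B (lin_span X)"
    unfolding finite_dimensional_def by (intro exI[of _ X] conjI ballI assms(1,2) lin_span_finsum)
qed

end

section \<open>Words in the generators\<close>

context exel_laca
begin

definition q_word :: "'i list \<Rightarrow> 'u" where "q_word \<xi> = foldr (\<lambda>i x. Q i \<otimes> x) \<xi> \<one>"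

text \<open>Normal forms of words. The \<open>Q i\<close> are commuting idempotents, so \<xi> can be
  kept free of repetitions; together with a bound on path lengths this leaves finitely many.\<close>

definition monomials :: "'i set \<Rightarrow> 'u set" where
  "monomials F = insert \<zero> {word \<alpha> \<otimes> (q_word \<xi> \<otimes> (word \<beta>)\<^sup>\<star>) | \<alpha> \<xi> \<beta>.
     graph_path \<alpha> \<and> set \<alpha> \<subseteq> F \<and> graph_path \<beta> \<and> set \<beta> \<subseteq> F \<and> distinct \<xi> \<and> set \<xi> \<subseteq> F}"

text \<open>Only nonempty products, so that they stay in the algebra generated by the
  \<open>S i\<close>; \<open>monomials\<close> also contains the unit, which may lie outside it. The
  normal forms serve to show that the words are finitely many.\<close>

inductive_set words :: "'i set \<Rightarrow> 'u set" for F where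
  gen: "i \<in> F \<Longrightarrow> S i \<in> words F"
| gen_star: "i \<in> F \<Longrightarrow> (S i)\<^sup>\<star> \<in> words F"
| mult: "x \<in> words F \<Longrightarrow> y \<in> words F \<Longrightarrow> x \<otimes> y \<in> words F"

lemma q_word_simps [simp]: "q_word [] = \<one>" "q_word (i # \<xi>) = Q i \<otimes> q_word \<xi>"
  by (simp_all add: q_word_def)

lemma q_word_closed: "set \<xi> \<subseteq> I \<Longrightarrow> q_word \<xi> \<in> carrier U"
  by (induction \<xi>) (auto simp: Q_closed)

lemma Q_q_word: "set \<xi> \<subseteq> I \<Longrightarrow> i \<in> set \<xi> \<Longrightarrow> Q i \<otimes> q_word \<xi> = q_word \<xi>"
proof (induction \<xi>)
  case (Cons j \<xi>)
  have c: "i \<in> I" "j \<in> I" "q_word \<xi> \<in> carrier U" using Cons.prems q_word_closed by auto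
  show ?case
  proof (cases "i = j")
    case True
    then show ?thesis using c Q_idem[of j] m_assoc[of "Q j" "Q j" "q_word \<xi>"] by (simp add: Q_closed)
  next
    case False
    then have "Q i \<otimes> q_word \<xi> = q_word \<xi>" using Cons by auto
    then have "Q i \<otimes> (Q j \<otimes> q_word \<xi>) = Q j \<otimes> q_word \<xi>"
      using c Q_commute[of i j] m_assoc[of "Q i" "Q j" "q_word \<xi>"] m_assoc[of "Q j" "Q i" "q_word \<xi>"] by (simp add: Q_closed)
    then show ?thesis by simp
  qed
qed simp

lemma star_S_Q: "i \<in> I \<Longrightarrow> j \<in> I \<Longrightarrow> (S i)\<^sup>\<star> \<otimes> Q j = (if A j i = 1 then (S i)\<^sup>\<star> else \<zero>)"
  using arg_cong[OF Q_S[of j i], of "\<lambda>x. x\<^sup>\<star>"] star_mult[of "Q j" "S i"] Q_star[of j] star_zero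
  by (simp add: Q_closed S_closed split: if_splits)

text \<open>By the adjoint of \<open>Q_S\<close>, each factor of \<open>q_word\<close> is either
  absorbed by the adjoint of \<open>S i\<close> or annihilates it.\<close>

lemma star_S_q_word:
  "i \<in> I \<Longrightarrow> set \<xi> \<subseteq> I \<Longrightarrow> (S i)\<^sup>\<star> \<otimes> q_word \<xi> = (S i)\<^sup>\<star> \<or> (S i)\<^sup>\<star> \<otimes> q_word \<xi> = \<zero>"
proof (induction \<xi>)
  case Nil then show ?case by (simp add: S_closed star_closed)
next
  case (Cons j \<xi>)
  then have c: "j \<in> I" "q_word \<xi> \<in> carrier U" "(S i)\<^sup>\<star> \<in> carrier U" using q_word_closed S_closed star_closed by auto
  have "(S i)\<^sup>\<star> \<otimes> q_word (j # \<xi>) = ((S i)\<^sup>\<star> \<otimes> Q j) \<otimes> q_word \<xi>"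
    using c by (simp add: m_assoc Q_closed)
  then show ?case using Cons c star_S_Q[of i j] by (auto simp: mult_zero_left split: if_splits)
qed

lemma word_append: "set \<alpha> \<subseteq> I \<Longrightarrow> set \<beta> \<subseteq> I \<Longrightarrow> word (\<alpha> @ \<beta>) = word \<alpha> \<otimes> word \<beta>"
  by (induction \<alpha>) (auto simp: word_closed S_closed m_assoc)

lemma graph_path_Cons: "graph_path (i # \<alpha>) \<longleftrightarrow> i \<in> I \<and> graph_path \<alpha> \<and> (\<alpha> \<noteq> [] \<longrightarrow> A i (hd \<alpha>) = 1)"
  by (cases \<alpha>) (auto simp: graph_path_def)

lemma graph_path_snoc: "graph_path (\<alpha> @ [i]) \<longleftrightarrow> i \<in> I \<and> graph_path \<alpha> \<and> (\<alpha> \<noteq> [] \<longrightarrow> A (last \<alpha>) i = 1)"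
  by (auto simp: graph_path_def successively_append_iff)

lemma S_word_zero: "graph_path \<alpha> \<Longrightarrow> i \<in> I \<Longrightarrow> \<not> graph_path (i # \<alpha>) \<Longrightarrow> S i \<otimes> word \<alpha> = \<zero>"
proof (cases \<alpha>)
  case (Cons j \<beta>)
  assume a: "graph_path \<alpha>" "i \<in> I" "\<not> graph_path (i # \<alpha>)"
  then have "A i j \<noteq> 1" "j \<in> I" "set \<beta> \<subseteq> I" using Cons by (auto simp: graph_path_Cons graph_path_def)
  then show ?thesis using a(2) S_S_zero[of i j] m_assoc[of "S i" "S j" "word \<beta>"] by (simp add: Cons S_closed word_closed mult_zero_left)
qed (auto simp: graph_path_def)

lemma word_S_zero: "graph_path \<beta> \<Longrightarrow> i \<in> I \<Longrightarrow> \<not> graph_path (\<beta> @ [i]) \<Longrightarrow> word \<beta> \<otimes> S i = \<zero>"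
proof (cases \<beta> rule: rev_cases)
  case (snoc \<gamma> j)
  assume a: "graph_path \<beta>" "i \<in> I" "\<not> graph_path (\<beta> @ [i])"
  then have "A (last \<beta>) i \<noteq> 1" by (simp add: graph_path_snoc)
  then have "A j i \<noteq> 1" by (simp add: snoc)
  moreover have "j \<in> I" "set \<gamma> \<subseteq> I" using a(1) snoc by (auto simp: graph_path_def)
  ultimately show ?thesis using a(2) S_S_zero[of j i]
    by (simp add: snoc word_append m_assoc S_closed word_closed mult_zero_right)
qed (auto simp: graph_path_def)

lemma monomials_zero: "\<zero> \<in> monomials F" by (simp add: monomials_def)

lemma monomialsI:
  "graph_path \<alpha> \<Longrightarrow> set \<alpha> \<subseteq> F \<Longrightarrow> graph_path \<beta> \<Longrightarrow> set \<beta> \<subseteq> F \<Longrightarrow> distinct \<xi> \<Longrightarrow> set \<xi> \<subseteq> F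
    \<Longrightarrow> word \<alpha> \<otimes> (q_word \<xi> \<otimes> (word \<beta>)\<^sup>\<star>) \<in> monomials F"
  unfolding monomials_def by blast

text \<open>A generator is put in front of \<alpha>. Its adjoint cancels against the first vertex of
  \<alpha> or, when \<alpha> is empty, passes through \<xi> and joins \<beta>.\<close>

lemma monomials_left:
  assumes F: "F \<subseteq> I" and i: "i \<in> F" and m: "m \<in> monomials F"
  shows "S i \<otimes> m \<in> monomials F" "(S i)\<^sup>\<star> \<otimes> m \<in> monomials F"
proof -
  have iI: "i \<in> I" using F i by auto
  note Si = S_closed[OF iI] star_closed[OF S_closed[OF iI]]
  have goal: "S i \<otimes> m \<in> monomials F \<and> (S i)\<^sup>\<star> \<otimes> m \<in> monomials F"
  proof (cases "m = \<zero>")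
    case True then show ?thesis using Si by (simp add: monomials_zero mult_zero_right)
  next
    case False
    then obtain \<alpha> \<xi> \<beta> where p: "graph_path \<alpha>" "set \<alpha> \<subseteq> F" "graph_path \<beta>" "set \<beta> \<subseteq> F" "distinct \<xi>" "set \<xi> \<subseteq> F"
      and m': "m = word \<alpha> \<otimes> (q_word \<xi> \<otimes> (word \<beta>)\<^sup>\<star>)" using m by (auto simp: monomials_def)
    have sI: "set \<alpha> \<subseteq> I" "set \<beta> \<subseteq> I" "set \<xi> \<subseteq> I" using p F by auto
    have c: "word \<alpha> \<in> carrier U" "q_word \<xi> \<in> carrier U" "(word \<beta>)\<^sup>\<star> \<in> carrier U" "word \<beta> \<in> carrier U"
      using sI by (auto simp: word_closed q_word_closed star_closed)
    let ?x = "q_word \<xi> \<otimes> (word \<beta>)\<^sup>\<star>"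
    have x: "?x \<in> carrier U" using c by simp
    have m_eq: "S i \<otimes> m = (S i \<otimes> word \<alpha>) \<otimes> ?x" "(S i)\<^sup>\<star> \<otimes> m = ((S i)\<^sup>\<star> \<otimes> word \<alpha>) \<otimes> ?x"
      unfolding m' using Si c x by (simp_all add: m_assoc)
    have "S i \<otimes> m \<in> monomials F"
    proof (cases "graph_path (i # \<alpha>)")
      case True
      then show ?thesis using monomialsI[of "i # \<alpha>" F \<beta> \<xi>] p i m_eq by simp
    next
      case False
      then show ?thesis using S_word_zero[OF p(1) iI False] x m_eq monomials_zero by (simp add: mult_zero_left)
    qed
    moreover have "(S i)\<^sup>\<star> \<otimes> m \<in> monomials F"
    proof (cases \<alpha>)
      case Nil
      have e: "(S i)\<^sup>\<star> \<otimes> m = ((S i)\<^sup>\<star> \<otimes> q_word \<xi>) \<otimes> (word \<beta>)\<^sup>\<star>"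
        unfolding m_eq using Nil Si c by (simp add: m_assoc)
      show ?thesis
      proof (cases "(S i)\<^sup>\<star> \<otimes> q_word \<xi> = \<zero>")
        case True then show ?thesis using e c monomials_zero by (simp add: mult_zero_left)
      next
        case False
        \<comment> \<open>With \<xi> absorbed, the two remaining adjoints combine, so \<beta> grows
          by \<open>i\<close> at its end.\<close>
        then have "(S i)\<^sup>\<star> \<otimes> m = (word \<beta> \<otimes> S i)\<^sup>\<star>"
          using star_S_q_word[OF iI sI(3)] e Si c by (auto simp: star_mult)
        moreover have "(word \<beta> \<otimes> S i)\<^sup>\<star> \<in> monomials F"
        proof (cases "graph_path (\<beta> @ [i])")
          case True
          have w: "word (\<beta> @ [i]) = word \<beta> \<otimes> S i" using sI iI Si by (simp add: word_append)
          have "word [] \<otimes> (q_word [] \<otimes> (word (\<beta> @ [i]))\<^sup>\<star>) \<in> monomials F"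
            using True p i by (intro monomialsI) (auto simp: graph_path_def)
          then show ?thesis unfolding w using c Si by (simp add: star_closed)
        next
          case False
          then show ?thesis using word_S_zero[OF p(3) iI] monomials_zero by (simp add: star_zero)
        qed
        ultimately show ?thesis by simp
      qed
    next
      case (Cons j \<gamma>)
      have j: "j \<in> I" "set \<gamma> \<subseteq> I" "graph_path \<gamma>" "set \<gamma> \<subseteq> F" using Cons sI p by (auto simp: graph_path_Cons)
      have w: "word \<gamma> \<in> carrier U" by (rule word_closed[OF j(2)])
      have e: "(S i)\<^sup>\<star> \<otimes> word \<alpha> = ((S i)\<^sup>\<star> \<otimes> S j) \<otimes> word \<gamma>" using Cons j w Si by (simp add: m_assoc S_closed)
      show ?thesis
      proof (cases "i = j")
        case False
        then show ?thesis using star_S_S[OF iI j(1)] w x monomials_zero unfolding m_eq e by (simp add: mult_zero_left)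
      next
        case True
        then have e': "(S i)\<^sup>\<star> \<otimes> word \<alpha> = Q i \<otimes> word \<gamma>" using e by (simp add: Q_def)
        show ?thesis
        proof (cases \<gamma>)
          case Nil
          \<comment> \<open>The path \<alpha> is used up; the leftover \<open>Q i\<close> goes into
            \<xi>, unless it occurs there already.\<close>
          have e2: "(S i)\<^sup>\<star> \<otimes> m = (Q i \<otimes> q_word \<xi>) \<otimes> (word \<beta>)\<^sup>\<star>"
            unfolding m_eq e' using Nil c iI by (simp add: m_assoc Q_closed)
          have n: "graph_path []" by (simp add: graph_path_def)
          show ?thesis
          proof (cases "i \<in> set \<xi>")
            case True
            then show ?thesis using monomialsI[OF n _ p(3-6)] c Q_q_word[OF sI(3)] unfolding e2 by simp
          next
            case False
            then show ?thesis using monomialsI[OF n _ p(3,4), of "i # \<xi>"] p c i iI unfolding e2 by (simp add: Q_closed)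
          qed
        next
          case (Cons k \<delta>)
          \<comment> \<open>A further vertex remains in \<alpha>, and it absorbs the leftover
            \<open>Q i\<close>.\<close>
          then have "A i k = 1" "k \<in> I" "set \<delta> \<subseteq> I" using p(1) j True \<open>\<alpha> = j # \<gamma>\<close> by (auto simp: graph_path_Cons)
          then have "Q i \<otimes> word \<gamma> = word \<gamma>" using Q_word[OF iI, of k \<delta>] Cons by simp
          then show ?thesis using monomialsI[OF j(3,4) p(3-6)] unfolding m_eq e' by simp
        qed
      qed
    qed
    ultimately show ?thesis ..
  qed
  then show "S i \<otimes> m \<in> monomials F" "(S i)\<^sup>\<star> \<otimes> m \<in> monomials F" by auto
qed

lemma monomials_carrier: "F \<subseteq> I \<Longrightarrow> monomials F \<subseteq> carrier U"
  by (auto simp: monomials_def word_closed q_word_closed star_closed)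

lemma words_carrier: "F \<subseteq> I \<Longrightarrow> words F \<subseteq> carrier U"
proof
  fix x assume F: "F \<subseteq> I" and "x \<in> words F"
  from this(2) show "x \<in> carrier U" by induction (use F S_closed star_closed in auto)
qed

lemma words_star: assumes F: "F \<subseteq> I" and "x \<in> words F" shows "x\<^sup>\<star> \<in> words F"
  using assms(2)
proof induction
  case (gen i) then show ?case by (rule words.gen_star)
next
  case (gen_star i)
  then have "i \<in> I" using F by auto
  then show ?case using words.gen[OF gen_star] by (simp add: star_star S_closed)
next
  case (mult x y)
  then have "x \<in> carrier U" "y \<in> carrier U" using words_carrier[OF F] by auto
  then show ?case using words.mult[OF mult(4,3)] by (simp add: star_mult)
qed

lemma words_subset_monomials: assumes F: "F \<subseteq> I" shows "words F \<subseteq> monomials F"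
proof
  have left: "x \<otimes> m \<in> monomials F" if "x \<in> words F" "m \<in> monomials F" for x m
    using that
  proof (induction arbitrary: m)
    case (gen i) then show ?case by (rule monomials_left(1)[OF F])
  next
    case (gen_star i) then show ?case by (rule monomials_left(2)[OF F])
  next
    case (mult x y)
    then have "x \<in> carrier U" "y \<in> carrier U" "m \<in> carrier U" using words_carrier[OF F] monomials_carrier[OF F] by auto
    then show ?case using mult by (simp add: m_assoc)
  qed
  have n: "graph_path []" by (simp add: graph_path_def)
  fix x assume "x \<in> words F"
  then show "x \<in> monomials F"
  proof induction
    case (gen i)
    then have "i \<in> I" using F by auto
    then show ?case using monomialsI[of "[i]" F "[]" "[]"] n gen by (simp add: graph_path_Cons S_closed star_one)
  next
    case (gen_star i)
    then have "i \<in> I" using F by auto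
    then show ?case using monomialsI[of "[]" F "[i]" "[]"] n gen_star by (simp add: graph_path_Cons S_closed star_closed)
  next
    case (mult x y) then show ?case using left by blast
  qed
qed

section \<open>Acyclic graphs and approximation by spans of words\<close>

lemma graph_path_distinct:
  assumes acyclic: "\<not> (\<exists>p. graph_cycle (graph_edges I A) p)" and p: "graph_path \<alpha>" shows "distinct \<alpha>"
proof (rule ccontr)
  assume "\<not> distinct \<alpha>"
  \<comment> \<open>The stretch from one visit of \<open>a\<close> up to the next is a
    cycle.\<close>
  then obtain us vs ws a where \<alpha>: "\<alpha> = us @ [a] @ vs @ [a] @ ws" using not_distinct_decomp by blast
  have "successively (\<lambda>i j. A i j = 1) (us @ (a # vs) @ (a # ws))" using p by (simp add: \<alpha> graph_path_def)
  then have s: "successively (\<lambda>i j. A i j = 1) (a # vs)" "A (last (a # vs)) a = 1"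
    by (simp_all only: successively_append_iff) simp_all
  have I: "set (a # vs) \<subseteq> I" using p by (auto simp: \<alpha> graph_path_def)
  have "graph_cycle (graph_edges I A) (a # vs)"
    unfolding graph_cycle_def graph_edges_def
  proof (intro conjI allI impI)
    fix k assume k: "Suc k < length (a # vs)"
    then have "(a # vs) ! k \<in> I" "(a # vs) ! Suc k \<in> I" using I nth_mem[of k "a # vs"] nth_mem[of "Suc k" "a # vs"] by auto
    moreover have "A ((a # vs) ! k) ((a # vs) ! Suc k) = 1" using s(1) k unfolding successively_conv_nth by blast
    ultimately show "((a # vs) ! k, (a # vs) ! Suc k) \<in> {(i, j) \<in> I \<times> I. A i j = 1}" by simp
  next
    have "last (a # vs) \<in> I" using I last_in_set[of "a # vs"] by blast
    then show "(last (a # vs), hd (a # vs)) \<in> {(i, j) \<in> I \<times> I. A i j = 1}" using s(2) I by simp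
  qed simp
  then show False using acyclic by blast
qed

lemma finite_monomials:
  assumes acyclic: "\<not> (\<exists>p. graph_cycle (graph_edges I A) p)" and F: "finite F"
  shows "finite (monomials F)"
proof -
  let ?L = "{\<alpha>. distinct \<alpha> \<and> set \<alpha> \<subseteq> F}"
  have "?L \<subseteq> {\<alpha>. set \<alpha> \<subseteq> F \<and> length \<alpha> \<le> card F}"
    using F by (auto simp: distinct_card[symmetric] intro: card_mono)
  then have L: "finite ?L" using finite_lists_length_le[OF F] finite_subset by blast
  let ?m = "\<lambda>(\<alpha>, \<xi>, \<beta>). word \<alpha> \<otimes> (q_word \<xi> \<otimes> (word \<beta>)\<^sup>\<star>)"
  have "monomials F \<subseteq> insert \<zero> (?m ` (?L \<times> ?L \<times> ?L))"
  proof
    fix x assume "x \<in> monomials F"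
    then consider "x = \<zero>" | \<alpha> \<xi> \<beta> where "x = ?m (\<alpha>, \<xi>, \<beta>)" "(\<alpha>, \<xi>, \<beta>) \<in> ?L \<times> ?L \<times> ?L"
      using graph_path_distinct[OF acyclic] by (auto simp: monomials_def)
    then show "x \<in> insert \<zero> (?m ` (?L \<times> ?L \<times> ?L))"
      by cases (simp, blast)
  qed
  then show ?thesis by (rule finite_subset) (use L in simp)
qed

theorem acyclic_imp_AF:
  assumes acyclic: "\<not> (\<exists>p. graph_cycle (graph_edges I A) p)" and I: "countable I"
  shows "AF_algebra (exel_laca_algebra U S I)"
proof -
  define D where "D = cstar_generated U (S ` I)"
  note D = generated_closed[folded D_def]
  let ?O = "U\<lparr>carrier := D\<rparr>"
  interpret O: cstar_algebra ?O by (rule sub_cstar_algebra[OF D(1)])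
  interpret M: Metric_space "carrier ?O" "cdist ?O" by (rule O.cstar_metric)
  \<comment> \<open>Finite sets of indices that exhaust \<open>I\<close> along an
    enumeration.\<close>
  define F where "F n = {i \<in> I. to_nat_on I i < n}" for n
  have F: "F n \<subseteq> I" "finite (F n)" for n
  proof -
    show "F n \<subseteq> I" by (auto simp: F_def)
    have "inj_on (to_nat_on I) (F n)" by (rule inj_on_subset[OF inj_on_to_nat_on[OF I]]) (auto simp: F_def)
    moreover have "finite (to_nat_on I ` F n)" by (rule finite_subset[of _ "{..<n}"]) (auto simp: F_def)
    ultimately show "finite (F n)" using finite_imageD by blast
  qed
  have words_D: "words (F n) \<subseteq> D" for n
  proof
    fix x assume "x \<in> words (F n)"
    moreover have "S i \<in> D" if "i \<in> F n" for i using that F(1)[of n] D(2) by auto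
    ultimately show "x \<in> D" by induction (use D(6,7) in auto)
  qed
  have wf: "finite (words (F n))" for n
    using finite_subset[OF words_subset_monomials[OF F(1)] finite_monomials[OF acyclic F(2)]] .
  define E where "E n = O.lin_span (words (F n))" for n
  have sub: "cstar_subalgebra ?O (E n)" "finite_dimensional ?O (E n)" for n
    unfolding E_def by (rule O.lin_span_subalgebra; use wf words_D words.mult words_star[OF F(1)] in simp)+
  have F_mono: "F m \<subseteq> F n" if "m \<le> n" for m n using that by (auto simp: F_def)
  have w_mono: "words (F m) \<subseteq> words (F n)" if "m \<le> n" for m n
  proof
    fix x assume "x \<in> words (F m)"
    then show "x \<in> words (F n)" by induction (use F_mono[OF that] in \<open>auto intro: words.intros\<close>)
  qed
  have E_mono: "E m \<subseteq> E n" if "m \<le> n" for m n unfolding E_def by (rule O.lin_span_mono[OF w_mono[OF that]])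
  define L where "L = (\<Union>n. E n)"
  have "E n \<subseteq> D" for n using sub(1)[of n] by (simp add: cstar_subalgebra_def)
  then have LD: "L \<subseteq> D" by (auto simp: L_def)
  \<comment> \<open>The \<open>E n\<close> increase, so any two elements of the union lie in one of
    them and closure under the operations is inherited.\<close>
  have L_join: "\<exists>n. x \<in> E n \<and> y \<in> E n" if xy: "x \<in> L" "y \<in> L" for x y
  proof -
    obtain m n where "x \<in> E m" "y \<in> E n" using xy by (auto simp: L_def)
    then show ?thesis using E_mono[of m "max m n"] E_mono[of n "max m n"] by (intro exI[of _ "max m n"]) auto
  qed
  have L: "\<zero> \<in> L" "\<And>x y. x \<in> L \<Longrightarrow> y \<in> L \<Longrightarrow> x \<oplus> y \<in> L" "\<And>x y. x \<in> L \<Longrightarrow> y \<in> L \<Longrightarrow> x \<otimes> y \<in> L"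
    "\<And>x. x \<in> L \<Longrightarrow> x\<^sup>\<star> \<in> L" "\<And>c x. x \<in> L \<Longrightarrow> c \<odot> x \<in> L"
  proof -
    have E: "\<zero> \<in> E n" "\<And>x y. x \<in> E n \<Longrightarrow> y \<in> E n \<Longrightarrow> x \<oplus> y \<in> E n \<and> x \<otimes> y \<in> E n"
      "\<And>x. x \<in> E n \<Longrightarrow> x\<^sup>\<star> \<in> E n" "\<And>c x. x \<in> E n \<Longrightarrow> c \<odot> x \<in> E n" for n
      using sub(1)[of n] by (auto simp: cstar_subalgebra_def)
    have EL: "x \<in> L" if "x \<in> E n" for x n using that unfolding L_def by (rule UN_I[OF UNIV_I])
    show "\<zero> \<in> L" by (rule EL[OF E(1)])
    show "x\<^sup>\<star> \<in> L" "c \<odot> x \<in> L" if "x \<in> L" for x c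
      using L_join[OF that that] EL[OF E(3)] EL[OF E(4)] by blast+
    show "x \<oplus> y \<in> L" "x \<otimes> y \<in> L" if xy: "x \<in> L" "y \<in> L" for x y
      using L_join[OF xy] EL[OF E(2)[THEN conjunct1]] EL[OF E(2)[THEN conjunct2]] by blast+
  qed
  \<comment> \<open>The sequence of generators on which terms are evaluated; zero takes their place
    when \<open>I\<close> is empty.\<close>
  define g where "g n = (if I = {} then \<zero> else S (from_nat_into I n))" for n
  have g: "S ` I \<subseteq> range g"
  proof
    fix x assume "x \<in> S ` I"
    then obtain i where i: "i \<in> I" "x = S i" by blast
    then have "x = g (to_nat_on I i)" using I by (auto simp: g_def)
    then show "x \<in> range g" by blast
  qed
  have gL: "g n \<in> L" for n
  proof (cases "I = {}")
    case True then show ?thesis using L(1) by (simp add: g_def)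
  next
    case False
    let ?i = "from_nat_into I n"
    have "?i \<in> F (Suc (to_nat_on I ?i))" using from_nat_into[OF False] by (simp add: F_def)
    then have "S ?i \<in> words (F (Suc (to_nat_on I ?i)))" by (rule words.gen)
    then have "S ?i \<in> E (Suc (to_nat_on I ?i))"
      unfolding E_def using O.lin_span_base words_D by simp
    then show ?thesis using False by (auto simp: g_def L_def)
  qed
  have gU: "range g \<subseteq> carrier U" using gL LD D(3) by blast
  obtain q :: "nat \<Rightarrow> complex" where q: "\<And>c e. e > 0 \<Longrightarrow> \<exists>n. cmod (c - q n) < e" using complex_dense_seq by blast
  \<comment> \<open>Term values never leave \<open>L\<close>, so the density of the term values
    gives the density of \<open>L\<close>.\<close>
  have tL: "cterm_val U g q t \<in> L" for t by (induction t) (use gL L in auto)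
  have "D \<subseteq> cstar_generated U (range g)" unfolding D_def cstar_generated_def by (rule hull_mono[OF g])
  then have approx: "\<exists>y\<in>L. cdist U y x < e" if "x \<in> D" "e > 0" for x e
    using generated_approx[OF gU q _ that(2)] that(1) tL by blast
  have "M.mtopology closure_of L = D"
    unfolding M.metric_closure_of
  proof (intro equalityI subsetI CollectI conjI allI impI)
    fix x assume x: "x \<in> D"
    then show "x \<in> carrier ?O" by simp
    fix r :: real assume "r > 0"
    then obtain y where y: "y \<in> L" "cdist U y x < r" using approx x by blast
    then have "cdist ?O x y < r" using sub_cdist[OF D(1) x, of y] LD cdist_commute[of x y] by auto
    then have "y \<in> M.mball x r" unfolding M.in_mball using y(1) LD x by auto
    then show "\<exists>y\<in>L. y \<in> M.mball x r" using y(1) by blast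
  qed auto
  then have cl: "cstar_topology ?O closure_of (\<Union>n. E n) = carrier ?O" by (simp add: cstar_topology_def L_def)
  have "AF_algebra ?O"
    unfolding AF_algebra_def
  proof (intro conjI exI[of _ E] allI)
    show "cstar_algebra ?O" by (rule O.cstar_algebra_axioms)
    show "cstar_subalgebra ?O (E n)" "finite_dimensional ?O (E n)" for n by (rule sub)+
    show "E n \<subseteq> E (Suc n)" for n by (rule E_mono) simp
    show "cstar_topology ?O closure_of (\<Union>n. E n) = carrier ?O" by (rule cl)
  qed
  then show ?thesis by (simp add: exel_laca_algebra_def D_def)
qed

end

theorem theorem3p6:
  fixes I :: "'i set" and A :: "'i \<Rightarrow> 'i \<Rightarrow> int"
    and U :: "'u cstar" and S :: "'i \<Rightarrow> 'u"
  assumes "countable I"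
    and "\<forall>i\<in>I. \<forall>j\<in>I. A i j \<in> {0, 1}"
    and "\<forall>i\<in>I. \<exists>j\<in>I. A i j \<noteq> 0"
    and "universal_exel_laca I A U S"
  shows "AF_algebra (exel_laca_algebra U S I) \<longleftrightarrow>
    \<not> (\<exists>p. graph_cycle (graph_edges I A) p)"
proof -
  interpret unital_cstar_algebra U using assms(4) by (simp add: universal_exel_laca_def)
  interpret exel_laca U I A S
    by unfold_locales (use assms(2,4) in \<open>auto simp: universal_exel_laca_def\<close>)
  have "\<not> AF_algebra (exel_laca_algebra U S I)" if cyc: "graph_cycle (graph_edges I A) p" for p
  proof -
    note path = graph_cycle_path[OF cyc]
    obtain lab pred W w0 where br: "cut_branching I A lab pred W w0" and w0: "lab w0 = hd p"
      using cycle_cut_branching[OF assms(1) A01 cyc] by blast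
    interpret B: cut_branching I A lab pred W w0 by (rule br)
    \<comment> \<open>The operators \<open>B.op\<close> live on the type \<open>bop\<close>, not on
      \<open>test_elem\<close>, so the universal property for arbitrary types is needed.\<close>
    obtain \<phi> where \<phi>: "\<phi> \<in> unital_cstar_hom U bop_cstar" "\<forall>i\<in>I. \<phi> (S i) = B.op i"
      using universal_exel_laca_hom[OF assms(1,4) bop_unital_cstar B.op_family] by blast
    obtain i0 \<alpha> where p: "p = i0 # \<alpha>" using path(3) by (cases p) auto
    show ?thesis
      by (rule cycle_imp_not_AF[OF br \<phi>(1)]) (use \<phi>(2) path w0 p in \<open>auto simp: graph_path_def\<close>)
  qed
  then show ?thesis using acyclic_imp_AF[OF _ assms(1)] by blast
qed

end
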